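(* Let $\mathbf u^\epsilon$ be the solution of the nonlocal evolution described in the context and let $\mathcal P^\epsilon_\delta(t)$, with boundary contour $\Gamma^\epsilon_\delta(t)$, be the domain containing the crack tip and moving with the crack tip velocity $V^\epsilon(t)\mathbf e^1$ described there. The rate of change of internal energy inside the domain containing the crack tip is given by $$\frac{d}{dt}\int_{\mathcal P^\epsilon_\delta(t)}T^\epsilon+W^\epsilon\,d\mathbf x=I^\epsilon(\Gamma^\epsilon_\delta(t)),$$ with $$I^\epsilon(\Gamma^\epsilon_\delta(t))=\int_{\Gamma^\epsilon_\delta(t)}(T^{\epsilon}+W^{\epsilon})V^{\epsilon}\mathbf e^1\cdot\mathbf n\,ds-E^{\epsilon}(\Gamma^{\epsilon}_\delta(t)),$$ and $$E^{\epsilon}(\Gamma^{\epsilon}_\delta(t))=\int_{A^{\epsilon}_\delta(t)}\int_{\mathcal H_{\epsilon}(\mathbf x)\cap\mathcal P^{\epsilon}_\delta(t)}\partial_S\mathcal W^{\epsilon}(S(\mathbf y,\mathbf x,\mathbf u^{\epsilon}))\,\mathbf e_{\mathbf y-\mathbf x}\cdot(\dot{\mathbf u}^{\epsilon}(\mathbf x)+\dot{\mathbf u}^{\epsilon}(\mathbf y))\,d\mathbf y\,d\mathbf x,$$ where $\mathbf n$ is the unit normal pointing out of $\mathcal P^{\epsilon}_\delta(t)$ and $A^{\epsilon}_\delta(t)$ is the part of $D$ exterior to $\mathcal P^{\epsilon}_\delta(t)$.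
   Context: Domain. $R=\{0<x_1<a,\ -b/2<x_2<b/2\}$; the notch is $C=\{0\le x_1\le \ell(0)-d,\ -d<x_2<d\}\cup\{\ell(0)-d\le x_1\le \ell(0)-d+\sqrt{d^2-x_2^2},\ -d<x_2<d\}$; $D=R\setminus C$. $\mathbf e^1,\mathbf e^2$ are the horizontal and vertical unit vectors. Strain. $S(\mathbf y,\mathbf x,\mathbf u(t))=\frac{\mathbf u(\mathbf y,t)-\mathbf u(\mathbf x,t)}{|\mathbf y-\mathbf x|}\cdot\mathbf e_{\mathbf y-\mathbf x}$, $\mathbf e_{\mathbf y-\mathbf x}=\frac{\mathbf y-\mathbf x}{|\mathbf y-\mathbf x|}$. Potential. $J^\epsilon(r)=J(r/\epsilon)$ with $J(r)=0$ for $r\ge1$ and $0\le J(r)\le M_J<\infty$ for $r<1$. $\omega_2$ is the area of the unit disk, $\mathcal H_\epsilon(\mathbf x)$ the disk of radius $\epsilon$ centered at $\mathbf x$. $\mathcal W^\epsilon(S(\mathbf y,\mathbf x,\mathbf u(t)))=\frac{J^\epsilon(|\mathbf y-\mathbf x|)}{\epsilon^3\omega_2|\mathbf y-\mathbf x|}\,g(\sqrt{|\mathbf y-\mathbf x|}\,S(\mathbf y,\mathbf x,\mathbf u(t)))$, where $g(r)=h(r^2)$ with $h$ concave, $g$ bounded and smooth, $g(0)=g'(0)=0$, $g$ convex-concave with inflection points $\pm r^c$ ($r^c>0$), $\lim_{|r|\to\infty}g(r)=C^+$, and $g'$ goes smoothly to zero at $\pm r^+$ ($r^+>r^c$). $\partial_S\mathcal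 W^\epsilon(S)=\frac{1}{\epsilon^3\omega_2}\frac{J^\epsilon(|\mathbf y-\mathbf x|)}{|\mathbf y-\mathbf x|}\partial_S g(\sqrt{|\mathbf y-\mathbf x|}S)$. Convention for $\mathcal H_\epsilon(\mathbf x)\cap D$: if the segment from $\mathbf x$ to $\mathbf y$ crosses $\partial D$, the strain and energy of that pair are set to zero. Body force. With layer thickness $\eta>0$: $\mathbf b=\mathbf e^2\eta^{-1}g_+(x_1,t)$ on $\{0<x_1<a,\ b/2-\eta<x_2<b/2\}$, $\mathbf b=\mathbf e^2\eta^{-1}g_-(x_1,t)$ on $\{0<x_1<a,\ -b/2<x_2<-b/2+\eta\}$, $\mathbf b=0$ elsewhere, $g_\pm$ smooth, $g_-=-g_+$, $g_+>0$, $\sup_{t\in[0,T]}\|\mathbf b(\cdot,t)\|_{L^2(D;\mathbb R^2)}^2<\infty$. Evolution. $\dot L^2(D;\mathbb R^2)$ is the subspace of $L^2$ fields that are $L^2$-orthogonal to all in-plane rigid motions $\Omega\times\mathbf x+\mathbf c$. With constant density $\rho>0$, $\mathbf u^\epsilon\in C^2([0,T];\dot L^2(D;\mathbb R^2))$ is the unique solution of $\rho\ddot{\mathbf u}^\epsilon=\int_{\mathcal H_\epsilon(\mathbf x)\cap D}2\,\partial_S\mathcal W^\epsilon(S(\mathbf y,\mathbf x,\mathbf u^\epsilon))\,\mathbf e_{\mathbf y-\mathbf x}\,d\mathbf y+\mathbf b$ on $D$, with $\mathbf u^\epsilon(\cdot,0)=\mathbf u_0$, $\dot{\mathbf u}^\epsilon(\cdot,0)=\mathbf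 v_0$, $\mathbf u_0,\mathbf v_0\in\dot L^2(D;\mathbb R^2)$. Crack and contour. The crack center line is the interval $C^\epsilon(t)=\{\ell(0)\le x_1\le\ell^\epsilon(t),\ x_2=0\}$ across which the force between two points is zero if the segment joining them intersects this interval; its tip is $(\ell^\epsilon(t),0)$. $\Gamma^\epsilon_\delta(t)$ is a rectangular contour of diameter $\delta$ bounding the domain $\mathcal P^\epsilon_\delta(t)\subset D$ that contains the crack tip, does not meet the support of $\mathbf b$, and moves with the crack tip velocity $V^\epsilon(t)\mathbf e^1=\dot\ell^\epsilon(t)\mathbf e^1$. Energies. $T^\epsilon=\rho|\dot{\mathbf u}^\epsilon(\mathbf x,t)|^2/2$ and $W^\epsilon(\mathbf x,t)=\int_{\mathcal H_\epsilon(\mathbf x)\cap D}|\mathbf y-\mathbf x|\mathcal W^\epsilon(S(\mathbf y,\mathbf x,\mathbf u^\epsilon(t)))\,d\mathbf y$.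
   Formalization: Since T+W is only an integrable density, its contour integral is undefined as stated; the formal theorem adds that at the time considered T+W is bounded near the contour and continuous at almost every contour point (jumps where the crack crosses are allowed). *)

theory Defs
  imports "HOL-Analysis.Analysis"
begin

definition plate :: "real \<Rightarrow> real \<Rightarrow> (real^2) set" where
  "plate a b = {x. 0 < x$1 \<and> x$1 < a \<and> -b/2 < x$2 \<and> x$2 < b/2}"

definition notch :: "real \<Rightarrow> real \<Rightarrow> (real^2) set" where
  "notch l0 d =
     {x. 0 \<le> x$1 \<and> x$1 \<le> l0 - d \<and> -d < x$2 \<and> x$2 < d} \<union>
     {x. l0 - d \<le> x$1 \<and> x$1 \<le> l0 - d + sqrt (d^2 - (x$2)^2) \<and> -d < x$2 \<and> x$2 < d}"

definition notched_plate :: "real \<Rightarrow> real \<Rightarrow> real \<Rightarrow> real \<Rightarrow> (real^2) set" where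
  "notched_plate a b l0 d = plate a b - notch l0 d"

definition crack_tip :: "real \<Rightarrow> real^2" where
  "crack_tip l = vector [l, 0]"

definition crack_line :: "real \<Rightarrow> real \<Rightarrow> (real^2) set" where
  "crack_line l0 l = {x. l0 \<le> x$1 \<and> x$1 \<le> l \<and> x$2 = 0}"

text \<open>Smoothness on a set that may contain some of its boundary points (one-sided derivatives
  there).\<close>

fun Ck_on :: "nat \<Rightarrow> 'a::euclidean_space set \<Rightarrow> ('a \<Rightarrow> real) \<Rightarrow> bool" where
  "Ck_on 0 S f \<longleftrightarrow> continuous_on S f"
| "Ck_on (Suc k) S f \<longleftrightarrow>
     (\<exists>f'. (\<forall>x\<in>S. (f has_derivative f' x) (at x within S)) \<and> (\<forall>v. Ck_on k S (\<lambda>x. f' x v)))"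

definition smooth_fun_on :: "'a::euclidean_space set \<Rightarrow> ('a \<Rightarrow> real) \<Rightarrow> bool" where
  "smooth_fun_on S f \<longleftrightarrow> (\<forall>k. Ck_on k S f)"

definition influence_function :: "(real \<Rightarrow> real) \<Rightarrow> real \<Rightarrow> bool" where
  "influence_function J MJ \<longleftrightarrow>
     J \<in> borel_measurable borel \<and>
     (\<forall>r\<ge>1. J r = 0) \<and> (\<forall>r. 0 \<le> r \<and> r < 1 \<longrightarrow> 0 \<le> J r \<and> J r \<le> MJ)"

definition cohesive_potential ::
  "(real \<Rightarrow> real) \<Rightarrow> (real \<Rightarrow> real) \<Rightarrow> real \<Rightarrow> real \<Rightarrow> real \<Rightarrow> bool" where
  "cohesive_potential g h rc rp Cp \<longleftrightarrow>
     (\<forall>r. g r = h (r^2)) \<and> concave_on {0..} h \<and>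
     bounded (range g) \<and> smooth_fun_on UNIV g \<and> g 0 = 0 \<and> deriv g 0 = 0 \<and>
     0 < rc \<and> convex_on {-rc..rc} g \<and> concave_on {rc..} g \<and> concave_on {..-rc} g \<and>
     (g \<longlongrightarrow> Cp) at_infinity \<and>
     rc < rp \<and> (\<forall>r. rp \<le> \<bar>r\<bar> \<longrightarrow> deriv g r = 0)"

definition bond_dir :: "real^2 \<Rightarrow> real^2 \<Rightarrow> real^2" where
  "bond_dir y x = (y - x) /\<^sub>R norm (y - x)"

text \<open>Bonds that cross the boundary of the body carry zero strain. Their energy and force then
  vanish as well, because \<open>g 0 = 0\<close> and \<open>deriv g 0 = 0\<close>.\<close>

definition strain :: "(real^2) set \<Rightarrow> real^2 \<Rightarrow> real^2 \<Rightarrow> (real^2 \<Rightarrow> real^2) \<Rightarrow> real" where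
  "strain D y x f =
     (if closed_segment x y \<inter> frontier D \<noteq> {} then 0
      else ((f y - f x) /\<^sub>R norm (y - x)) \<bullet> bond_dir y x)"

definition bond_energy ::
  "real \<Rightarrow> (real \<Rightarrow> real) \<Rightarrow> (real \<Rightarrow> real) \<Rightarrow> real^2 \<Rightarrow> real^2 \<Rightarrow> real \<Rightarrow> real" where
  "bond_energy \<epsilon> J g y x s =
     J (norm (y - x) / \<epsilon>) / (\<epsilon>^3 * measure lebesgue (ball (0::real^2) 1) * norm (y - x)) *
     g (sqrt (norm (y - x)) * s)"

definition bond_force ::
  "real \<Rightarrow> (real \<Rightarrow> real) \<Rightarrow> (real \<Rightarrow> real) \<Rightarrow> real^2 \<Rightarrow> real^2 \<Rightarrow> real \<Rightarrow> real" where
  "bond_force \<epsilon> J g y x s = deriv (bond_energy \<epsilon> J g y x) s"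

definition internal_force ::
  "(real^2) set \<Rightarrow> real \<Rightarrow> (real \<Rightarrow> real) \<Rightarrow> (real \<Rightarrow> real) \<Rightarrow> (real^2 \<Rightarrow> real^2) \<Rightarrow> real^2 \<Rightarrow> real^2"
where
  "internal_force D \<epsilon> J g f x =
     (LINT y:ball x \<epsilon> \<inter> D|lebesgue. (2 * bond_force \<epsilon> J g y x (strain D y x f)) *\<^sub>R bond_dir y x)"

definition kinetic_density :: "real \<Rightarrow> (real^2 \<Rightarrow> real^2) \<Rightarrow> real^2 \<Rightarrow> real" where
  "kinetic_density \<rho> f x = \<rho> * (norm (f x))^2 / 2"

definition stored_density ::
  "(real^2) set \<Rightarrow> real \<Rightarrow> (real \<Rightarrow> real) \<Rightarrow> (real \<Rightarrow> real) \<Rightarrow> (real^2 \<Rightarrow> real^2) \<Rightarrow> real^2 \<Rightarrow> real"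
where
  "stored_density D \<epsilon> J g f x =
     (LINT y:ball x \<epsilon> \<inter> D|lebesgue. norm (y - x) * bond_energy \<epsilon> J g y x (strain D y x f))"

definition body_force ::
  "real \<Rightarrow> real \<Rightarrow> real \<Rightarrow> (real \<times> real \<Rightarrow> real) \<Rightarrow> (real \<times> real \<Rightarrow> real) \<Rightarrow> real \<Rightarrow> real^2 \<Rightarrow> real^2"
where
  "body_force a b \<eta> gp gm t x =
     (indicator {x. 0 < x$1 \<and> x$1 < a \<and> b/2 - \<eta> < x$2 \<and> x$2 < b/2} x * (gp (x$1, t) / \<eta>) +
      indicator {x. 0 < x$1 \<and> x$1 < a \<and> -b/2 < x$2 \<and> x$2 < -b/2 + \<eta>} x * (gm (x$1, t) / \<eta>))
     *\<^sub>R axis 2 1"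

text \<open>Elements of \<open>L\<^sup>2\<close> are represented by functions; the values off \<open>D\<close> are irrelevant.\<close>

definition L2_fields :: "(real^2) set \<Rightarrow> (real^2 \<Rightarrow> real^2) set" where
  "L2_fields D = {f. f \<in> borel_measurable (lebesgue_on D) \<and>
                     integrable (lebesgue_on D) (\<lambda>x. (norm (f x))^2)}"

definition L2_norm :: "(real^2) set \<Rightarrow> (real^2 \<Rightarrow> real^2) \<Rightarrow> real" where
  "L2_norm D f = sqrt (LINT x|lebesgue_on D. (norm (f x))^2)"

text \<open>The planar rigid motions \<open>\<Omega> \<times> x + c\<close>, with \<open>\<Omega>\<close> orthogonal to the plane, are the fields
  \<open>\<omega> (- x\<^sub>2, x\<^sub>1) + c\<close>.\<close>

definition perp :: "real^2 \<Rightarrow> real^2" where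
  "perp x = vector [- (x$2), x$1]"

definition L2_dot :: "(real^2) set \<Rightarrow> (real^2 \<Rightarrow> real^2) set" where
  "L2_dot D = {f \<in> L2_fields D. \<forall>\<omega> c. (LINT x|lebesgue_on D. f x \<bullet> (\<omega> *\<^sub>R perp x + c)) = 0}"

definition has_L2_derivative_on ::
  "(real^2) set \<Rightarrow> real \<Rightarrow> (real \<Rightarrow> real^2 \<Rightarrow> real^2) \<Rightarrow> (real \<Rightarrow> real^2 \<Rightarrow> real^2) \<Rightarrow> bool" where
  "has_L2_derivative_on D T u v \<longleftrightarrow>
     (\<forall>t\<in>{0..T}. ((\<lambda>s. L2_norm D (\<lambda>x. (u s x - u t x) /\<^sub>R (s - t) - v t x)) \<longlongrightarrow> 0)
                   (at t within {0..T}))"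

text \<open>\<open>u\<close> is twice continuously differentiable from \<open>{0..T}\<close> to \<open>L2_dot D\<close>, with first and
  second derivatives represented by \<open>v\<close> and \<open>w\<close>.\<close>

definition C2_L2_dot ::
  "(real^2) set \<Rightarrow> real \<Rightarrow> (real \<Rightarrow> real^2 \<Rightarrow> real^2) \<Rightarrow> (real \<Rightarrow> real^2 \<Rightarrow> real^2) \<Rightarrow>
   (real \<Rightarrow> real^2 \<Rightarrow> real^2) \<Rightarrow> bool" where
  "C2_L2_dot D T u v w \<longleftrightarrow>
     (\<forall>t\<in>{0..T}. u t \<in> L2_dot D \<and> v t \<in> L2_dot D \<and> w t \<in> L2_dot D) \<and>
     has_L2_derivative_on D T u v \<and> has_L2_derivative_on D T v w \<and>
     (\<forall>t\<in>{0..T}. ((\<lambda>s. L2_norm D (\<lambda>x. w s x - w t x)) \<longlongrightarrow> 0) (at t within {0..T}))"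

definition nonlocal_evolution ::
  "(real^2) set \<Rightarrow> real \<Rightarrow> real \<Rightarrow> real \<Rightarrow> (real \<Rightarrow> real) \<Rightarrow> (real \<Rightarrow> real) \<Rightarrow>
   (real \<Rightarrow> real^2 \<Rightarrow> real^2) \<Rightarrow> (real^2 \<Rightarrow> real^2) \<Rightarrow> (real^2 \<Rightarrow> real^2) \<Rightarrow>
   (real \<Rightarrow> real^2 \<Rightarrow> real^2) \<Rightarrow> (real \<Rightarrow> real^2 \<Rightarrow> real^2) \<Rightarrow> (real \<Rightarrow> real^2 \<Rightarrow> real^2) \<Rightarrow> bool" where
  "nonlocal_evolution D T \<rho> \<epsilon> J g bf u0 v0 u v w \<longleftrightarrow>
     C2_L2_dot D T u v w \<and>
     (\<forall>t\<in>{0..T}. AE x in lebesgue_on D. \<rho> *\<^sub>R w t x = internal_force D \<epsilon> J g (u t) x + bf t x) \<and>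
     (AE x in lebesgue_on D. u 0 x = u0 x) \<and> (AE x in lebesgue_on D. v 0 x = v0 x)"

text \<open>The open rectangle with centre \<open>c\<close>, side directions \<open>e\<close> and \<open>perp e\<close> (\<open>e\<close> a unit vector) and
  half side lengths \<open>p\<close> and \<open>q\<close>.\<close>

definition rectangle :: "real^2 \<Rightarrow> real^2 \<Rightarrow> real \<Rightarrow> real \<Rightarrow> (real^2) set" where
  "rectangle c e p q = {x. \<bar>(x - c) \<bullet> e\<bar> < p \<and> \<bar>(x - c) \<bullet> perp e\<bar> < q}"

text \<open>Each side of the boundary is given by its midpoint, its outward unit normal and half its
  length. A side \<open>(m, n, L)\<close> has the arc length parametrization \<open>\<lambda>s. m + s *\<^sub>R perp n\<close> on
  \<open>{-L..L}\<close>.\<close>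

definition rectangle_sides ::
  "real^2 \<Rightarrow> real^2 \<Rightarrow> real \<Rightarrow> real \<Rightarrow> ((real^2) \<times> (real^2) \<times> real) list" where
  "rectangle_sides c e p q =
     [(c + p *\<^sub>R e, e, q), (c - p *\<^sub>R e, - e, q),
      (c + q *\<^sub>R perp e, perp e, p), (c - q *\<^sub>R perp e, - perp e, p)]"

definition boundary_integral ::
  "((real^2) \<times> (real^2) \<times> real) list \<Rightarrow> (real^2 \<Rightarrow> real^2 \<Rightarrow> real) \<Rightarrow> real" where
  "boundary_integral sides \<phi> =
     (\<Sum>(m, n, L)\<leftarrow>sides. LINT s:{-L..L}|lebesgue. \<phi> (m + s *\<^sub>R perp n) n)"

definition boundary_AE :: "((real^2) \<times> (real^2) \<times> real) list \<Rightarrow> (real^2 \<Rightarrow> bool) \<Rightarrow> bool" where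
  "boundary_AE sides Q \<longleftrightarrow>
     (\<forall>(m, n, L)\<in>set sides. AE s in lebesgue_on {-L..L}. Q (m + s *\<^sub>R perp n))"

text \<open>An integrable density has no values on a curve. The following is what gives the values of a
  representative on the contour a meaning: boundedness near the contour and continuity at almost
  every contour point with respect to arc length. Isolated discontinuities on the contour, such as
  the point where it crosses the crack, are thus allowed.\<close>

definition has_contour_values ::
  "(real^2 \<Rightarrow> real) \<Rightarrow> (real^2) set \<Rightarrow> ((real^2) \<times> (real^2) \<times> real) list \<Rightarrow> bool" where
  "has_contour_values f \<Gamma> sides \<longleftrightarrow>
     (\<exists>U. open U \<and> \<Gamma> \<subseteq> U \<and> bounded (f ` U)) \<and> boundary_AE sides (\<lambda>x. isCont f x)"

definition nonlocal_flux ::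
  "(real^2) set \<Rightarrow> real \<Rightarrow> (real \<Rightarrow> real) \<Rightarrow> (real \<Rightarrow> real) \<Rightarrow> (real^2) set \<Rightarrow>
   (real^2 \<Rightarrow> real^2) \<Rightarrow> (real^2 \<Rightarrow> real^2) \<Rightarrow> real" where
  "nonlocal_flux D \<epsilon> J g P f vel =
     (LINT x:D - closure P|lebesgue. LINT y:ball x \<epsilon> \<inter> P|lebesgue.
        (bond_force \<epsilon> J g y x (strain D y x f) *\<^sub>R bond_dir y x) \<bullet> (vel x + vel y))"

end

theory Submission
  imports Defs
begin

text \<open>
  The energy density is differentiable in time as a curve in \<open>L\<^sup>1(D)\<close>, although not pointwise: for the
  kinetic part this is the product rule, and for the stored part Taylor's formula for the potential
  bounds the remainder of each bond by the integrable kernel \<open>1 / |y - x|\<close> times squared increments of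
  the displacement. Differentiability in \<open>L\<^sup>1\<close> suffices for a domain that moves, because the
  difference between integrating over \<open>P s\<close> and over \<open>P t\<close> only affects terms of higher order.
  The frozen density is transported by the moving rectangle, which gives the contour integral. The
  \<open>L\<^sup>1\<close> derivative integrated over \<open>P t\<close> is, by the equation of motion, the work of the pair forces
  \<open>f(x, y) \<bullet> (v x + v y)\<close>, which is antisymmetric in \<open>(x, y)\<close>. Bonds inside \<open>P t\<close> cancel, and the
  bonds leaving \<open>P t\<close> give the flux.
\<close>

section \<open>Integrals over a moving rectangle\<close>

text \<open>Two kinds of irregularity meet. In time, \<open>u\<close> is differentiable only as a
  curve in \<open>L\<^sup>2\<close>, so a single bond need not have an energy rate; what an
  \<open>L\<^sup>2\<close> curve does control is the integral of a squared increment, and this is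
  why the remainders are measured in \<open>L\<^sup>1\<close>. In space, the density is an
  integrable function, while the contour integral asks for values of one representative. Boundedness
  near the contour and continuity at almost every contour point make the mean over the thin strip
  swept by a side converge to these values.

  The planar integrability of \<open>1 / |y - x|\<close> is just sufficient: the square root of the
  length in the argument of \<open>g\<close> leaves exactly one power of the length in the
  denominator of the quadratic remainder.

  The sum \<open>v x + v y\<close> arises from two sources. The equation of motion contributes twice
  the pair force tested on \<open>v x\<close>, the variation of the stored energy contributes the
  pair force tested on \<open>v y - v x\<close>.\<close>

lemma perp_simps [simp]: "perp x $ 1 = - (x$2)" "perp x $ 2 = x$1"
  by (simp_all add: perp_def)

lemma inner_vec2: "(x::real^2) \<bullet> y = x$1 * y$1 + x$2 * y$2"
  by (simp add: inner_vec_def sum_2)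

lemma norm_vec2_sq: "(norm (x::real^2))\<^sup>2 = (x$1)\<^sup>2 + (x$2)\<^sup>2"
  by (simp add: power2_norm_eq_inner inner_vec2) (simp add: power2_eq_square)

lemma norm_perp: "norm (perp x) = norm x"
  by (rule power2_eq_imp_eq) (simp_all add: norm_vec2_sq add.commute)

section \<open>Orthonormal coordinates along the normal and the tangent of a side\<close>

definition frame :: "real^2 \<Rightarrow> real^2 \<Rightarrow> real \<times> real \<Rightarrow> real^2" where
  "frame c e z = c + fst z *\<^sub>R e + snd z *\<^sub>R perp e"

lemma continuous_frame [continuous_intros]: "continuous_on S (frame c e)"
  unfolding frame_def by (intro continuous_intros)

lemma frame_measurable [measurable]: "frame c e \<in> borel_measurable borel"
  by (rule borel_measurable_continuous_onI) (rule continuous_frame)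

text \<open>Fubini's theorem lives on pairs and the densities on \<open>real^2\<close>. The map is
  the identity in coordinates, so boxes pull back to boxes with the same side lengths, and these
  values determine \<open>lborel\<close>.\<close>

lemma distr_lborel_pair_vec2:
  "distr lborel borel (\<lambda>z. vector [fst z, snd z] :: real^2) = lborel"
proof (rule lborel_eqI[symmetric])
  have eq: "(\<lambda>z. vector [fst z, snd z] :: real^2) = frame 0 (axis 1 1)"
    by (auto simp: frame_def vec_eq_iff forall_2 axis_def)
  have m [measurable]: "(\<lambda>z. vector [fst z, snd z] :: real^2) \<in> borel_measurable borel"
    unfolding eq by measurable
  fix l u :: "real^2"
  assume lu: "\<And>b. b \<in> Basis \<Longrightarrow> l \<bullet> b \<le> u \<bullet> b"
  have B2: "(Basis :: (real^2) set) = {axis 1 1, axis 2 1}"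
    by (simp add: Basis_vec_def UNIV_2 insert_commute)
  have ne: "axis 1 1 \<noteq> (axis 2 1 :: real^2)" by (simp add: axis_eq_axis)
  have "(\<lambda>z. vector [fst z, snd z] :: real^2) -` box l u = box (l$1, l$2) (u$1, u$2)"
    by (auto simp: box_def B2 inner_axis Basis_prod_def)
  moreover have "l$1 \<le> u$1" "l$2 \<le> u$2"
    using lu[of "axis 1 1"] lu[of "axis 2 1"] by (auto simp: B2 inner_axis)
  ultimately show "emeasure (distr lborel borel (\<lambda>z. vector [fst z, snd z] :: real^2)) (box l u) =
      ennreal (\<Prod>b\<in>Basis. (u - l) \<bullet> b)"
    by (simp add: emeasure_distr emeasure_lborel_box_eq B2 ne inner_axis Basis_prod_def)
qed simp

text \<open>The preimage of a box is its image under \<open>inv T\<close>, which is orthogonal as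
  well and preserves measure; the values on boxes determine \<open>lborel\<close>.\<close>

lemma distr_lborel_orthogonal:
  fixes T :: "(real^'n::{finite,wellorder}) \<Rightarrow> real^'n::{finite,wellorder}"
  assumes T: "orthogonal_transformation T"
  shows "distr lborel borel T = lborel"
proof (rule lborel_eqI[symmetric])
  have m [measurable]: "T \<in> borel_measurable borel"
    by (intro borel_measurable_continuous_onI linear_continuous_on)
       (use T in \<open>simp add: orthogonal_transformation_linear linear_linear\<close>)
  fix l u :: "real^'n::{finite,wellorder}"
  assume lu: "\<And>b. b \<in> Basis \<Longrightarrow> l \<bullet> b \<le> u \<bullet> b"
  have iT: "orthogonal_transformation (inv T)"
    using T by (rule orthogonal_transformation_inv)
  have vi: "T -` box l u = inv T ` box l u"
    using T by (simp add: bij_vimage_eq_inv_image orthogonal_transformation_bij)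
  have "emeasure lborel (T -` box l u) = emeasure lebesgue (T -` box l u)"
    using measurable_sets_borel[OF m, of "box l u"] by (simp add: emeasure_completion)
  also have "\<dots> = ennreal (measure lebesgue (inv T ` box l u))"
    unfolding vi by (rule emeasure_eq_measure2, rule measurable_orthogonal_image[OF iT]) simp
  also have "measure lebesgue (inv T ` box l u) = measure lebesgue (box l u)"
    by (rule measure_orthogonal_image[OF iT]) simp
  also have "ennreal (measure lebesgue (box l u)) = ennreal (\<Prod>b\<in>Basis. (u - l) \<bullet> b)"
    using lu by (simp add: measure_completion measure_lborel_box_eq)
  finally show "emeasure (distr lborel borel T) (box l u) = ennreal (\<Prod>b\<in>Basis. (u - l) \<bullet> b)"
    by (simp add: emeasure_distr)
qed simp

text \<open>A frame is the identification of pairs with vectors, followed by an isometry and a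
  translation, and each factor preserves Lebesgue measure. Integrals near a side can thus be taken
  first across it and then along it.\<close>

lemma distr_lborel_frame:
  assumes "norm e = 1"
  shows "distr lborel borel (frame c e) = lborel"
proof -
  define T where "T = (\<lambda>x::real^2. x$1 *\<^sub>R e + x$2 *\<^sub>R perp e)"
  have n: "e$1 * e$1 + e$2 * e$2 = 1"
    using norm_vec2_sq[of e] assms by (simp add: power2_eq_square)
  have T: "orthogonal_transformation T"
    unfolding orthogonal_transformation T_def
  proof (intro conjI allI)
    show "linear (\<lambda>x::real^2. x$1 *\<^sub>R e + x$2 *\<^sub>R perp e)"
      by (rule linearI) (simp_all add: algebra_simps)
    fix x :: "real^2"
    have "(norm (x$1 *\<^sub>R e + x$2 *\<^sub>R perp e))\<^sup>2 =
      ((x$1)\<^sup>2 + (x$2)\<^sup>2) * (e$1 * e$1 + e$2 * e$2)"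
      unfolding norm_vec2_sq by (simp add: power2_eq_square algebra_simps)
    then show "norm (x$1 *\<^sub>R e + x$2 *\<^sub>R perp e) = norm x"
      using n norm_vec2_sq[of x] by (metis mult.right_neutral norm_ge_zero power2_eq_imp_eq)
  qed
  have mT [measurable]: "T \<in> borel_measurable borel"
    by (intro borel_measurable_continuous_onI linear_continuous_on)
       (use T in \<open>simp add: orthogonal_transformation_linear linear_linear\<close>)
  have eq: "(\<lambda>z. vector [fst z, snd z] :: real^2) = frame 0 (axis 1 1)"
    by (auto simp: frame_def vec_eq_iff forall_2 axis_def)
  have mv [measurable]: "(\<lambda>z. vector [fst z, snd z] :: real^2) \<in> borel_measurable borel"
    unfolding eq by measurable
  have "frame c e = (+) c \<circ> (T \<circ> (\<lambda>z. vector [fst z, snd z]))"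
    by (auto simp: frame_def T_def)
  then have "distr lborel borel (frame c e) =
     distr (distr (distr lborel borel (\<lambda>z. vector [fst z, snd z] :: real^2)) borel T) borel ((+) c)"
    by (simp add: distr_distr comp_assoc)
  then show ?thesis
    by (simp add: distr_lborel_pair_vec2 distr_lborel_orthogonal[OF T] lborel_distr_plus)
qed

text \<open>The difference of steps is the signed indicator of the strip between \<open>z\<close>
  and \<open>z + a\<close>: positive when a side moves outward, negative when it moves inward. One
  formula then serves both directions.\<close>

lemma has_bochner_integral_step_shift:
  fixes z a :: real
  shows "has_bochner_integral lborel (\<lambda>X. indicator {..<z + a} X - indicator {..<z} X :: real) a"
    and "has_bochner_integral lborel (\<lambda>X. \<bar>indicator {..<z + a} X - indicator {..<z} X :: real\<bar>) \<bar>a\<bar>"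
proof -
  have *: "has_bochner_integral lborel (indicator {l..<r} :: real \<Rightarrow> real) (r - l)" if "l \<le> r" for l r :: real
    using has_bochner_integral_real_indicator[of "{l..<r}" lborel] that by simp
  show "has_bochner_integral lborel (\<lambda>X. indicator {..<z + a} X - indicator {..<z} X :: real) a"
  proof (cases "0 \<le> a")
    case True
    then have "(\<lambda>X. indicator {..<z + a} X - indicator {..<z} X :: real) = indicator {z..<z+a}"
      by (auto simp: fun_eq_iff indicator_def)
    then show ?thesis using *[of z "z + a"] True by simp
  next
    case False
    then have "(\<lambda>X. indicator {..<z + a} X - indicator {..<z} X :: real) = (\<lambda>X. - indicator {z+a..<z} X)"
      by (auto simp: fun_eq_iff indicator_def)
    then show ?thesis using has_bochner_integral_minus[OF *[of "z + a" z]] False by simp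
  qed
  show "has_bochner_integral lborel (\<lambda>X. \<bar>indicator {..<z + a} X - indicator {..<z} X :: real\<bar>) \<bar>a\<bar>"
  proof (cases "0 \<le> a")
    case True
    then have "(\<lambda>X. \<bar>indicator {..<z + a} X - indicator {..<z} X :: real\<bar>) = indicator {z..<z+a}"
      by (auto simp: fun_eq_iff indicator_def)
    then show ?thesis using *[of z "z + a"] True by simp
  next
    case False
    then have "(\<lambda>X. \<bar>indicator {..<z + a} X - indicator {..<z} X :: real\<bar>) = indicator {z+a..<z}"
      by (auto simp: fun_eq_iff indicator_def)
    then show ?thesis using *[of "z + a" z] False by simp
  qed
qed

text \<open>The step difference vanishes outside the interval of radius \<open>\<bar>a\<bar>\<close>
  about \<open>z\<close>, so only a local bound on \<open>K\<close> enters. In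
  \<open>step_shift_average\<close> this bound becomes small together with the interval.\<close>

lemma integral_step_shift_bound:
  fixes K :: "real \<Rightarrow> real"
  assumes [measurable]: "K \<in> borel_measurable borel"
    and bound: "AE X in lborel. X \<in> {z - \<bar>a\<bar>..z + \<bar>a\<bar>} \<longrightarrow> \<bar>K X\<bar> \<le> B"
  shows "integrable lborel (\<lambda>X. (indicator {..<z + a} X - indicator {..<z} X) * K X)" (is ?int)
    and "\<bar>LINT X|lborel. (indicator {..<z + a} X - indicator {..<z} X) * K X\<bar> \<le> B * \<bar>a\<bar>"
proof -
  let ?s = "\<lambda>X. indicator {..<z + a} X - indicator {..<z} X :: real"
  have i: "integrable lborel (\<lambda>X. \<bar>?s X\<bar> * B)" and v: "(LINT X|lborel. \<bar>?s X\<bar> * B) = \<bar>a\<bar> * B"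
    using has_bochner_integral_mult_left[of B lborel "\<lambda>X. \<bar>?s X\<bar>" "\<bar>a\<bar>"]
      has_bochner_integral_step_shift(2)[of z a]
    by (auto simp: has_bochner_integral_iff)
  have le: "AE X in lborel. norm (?s X * K X) \<le> \<bar>?s X\<bar> * B"
    using bound
  proof eventually_elim
    case (elim X)
    then show ?case
      by (cases "X < z"; cases "X < z + a") (auto simp: abs_mult)
  qed
  show ?int
    by (rule Bochner_Integration.integrable_bound[OF i]) (use le in \<open>simp, eventually_elim, metis abs_ge_self order_trans real_norm_def\<close>)
  then have "\<bar>LINT X|lborel. ?s X * K X\<bar> \<le> (LINT X|lborel. \<bar>?s X\<bar> * B)"
    using le i by (intro order_trans[OF integral_abs_bound] integral_mono_AE) auto
  then show "\<bar>LINT X|lborel. ?s X * K X\<bar> \<le> B * \<bar>a\<bar>"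
    by (simp only: v mult.commute[of B])
qed

text \<open>Continuity of \<open>F\<close> takes the place of a Lebesgue point of \<open>K\<close>:
  on a short strip \<open>K\<close> is close to the constant \<open>F z\<close> for almost every
  \<open>X\<close>, and the constant integrates to \<open>\<tau> * \<alpha> * F z\<close>. The value
  of \<open>K\<close> at \<open>z\<close> never enters.\<close>

lemma step_shift_average:
  fixes K F :: "real \<Rightarrow> real"
  assumes K [measurable]: "K \<in> borel_measurable borel" and B: "\<And>X. \<bar>K X\<bar> \<le> B"
    and eq: "AE X in lborel. K X = F X" and cont: "isCont F z"
  shows "((\<lambda>\<tau>. (LINT X|lborel. (indicator {..<z + \<tau> * \<alpha>} X - indicator {..<z} X) * K X) / \<tau>) \<longlongrightarrow> \<alpha> * F z) (at 0)"
proof (rule LIM_I)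
  fix r :: real assume "0 < r"
  \<comment> \<open>Adding 1 covers \<open>\<alpha> = 0\<close>; the radius below is guarded in the
    same way.\<close>
  define r' where "r' = r / (\<bar>\<alpha>\<bar> + 1)"
  have r': "0 < r'" "\<bar>\<alpha>\<bar> * r' < r" using \<open>0 < r\<close> by (auto simp: r'_def field_simps)
  obtain \<delta> where \<delta>: "0 < \<delta>" "\<And>X. \<bar>X - z\<bar> < \<delta> \<Longrightarrow> \<bar>F X - F z\<bar> < r'"
    using cont r' unfolding continuous_at_eps_delta by (auto simp: dist_real_def)
  show "\<exists>s>0. \<forall>x. x \<noteq> 0 \<and> norm (x - 0) < s \<longrightarrow>
     norm ((LINT X|lborel. (indicator {..<z + x * \<alpha>} X - indicator {..<z} X) * K X) / x - \<alpha> * F z) < r"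
  proof (intro exI[of _ "\<delta> / (\<bar>\<alpha>\<bar> + 1)"] conjI allI impI)
    show "0 < \<delta> / (\<bar>\<alpha>\<bar> + 1)" using \<delta> by (simp add: add_nonneg_pos)
    fix x :: real assume x: "x \<noteq> 0 \<and> norm (x - 0) < \<delta> / (\<bar>\<alpha>\<bar> + 1)"
    let ?s = "\<lambda>X. indicator {..<z + x * \<alpha>} X - indicator {..<z} X :: real"
    have "\<bar>x\<bar> * (\<bar>\<alpha>\<bar> + 1) < \<delta>" using x by (simp add: field_simps)
    then have small: "\<bar>x * \<alpha>\<bar> < \<delta>" using x by (simp add: abs_mult algebra_simps)
    have "AE X in lborel. X \<in> {z - \<bar>x * \<alpha>\<bar>..z + \<bar>x * \<alpha>\<bar>} \<longrightarrow> \<bar>K X - F z\<bar> \<le> r'"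
      using eq
    proof eventually_elim
      case (elim X)
      have "\<bar>F X - F z\<bar> < r'" if "X \<in> {z - \<bar>x * \<alpha>\<bar>..z + \<bar>x * \<alpha>\<bar>}"
        by (rule \<delta>) (use that small in auto)
      then show ?case using elim by auto
    qed
    from integral_step_shift_bound(2)[OF _ this]
    have 1: "\<bar>LINT X|lborel. ?s X * (K X - F z)\<bar> \<le> r' * \<bar>x * \<alpha>\<bar>" by simp
    have iK: "integrable lborel (\<lambda>X. ?s X * K X)"
      by (rule integral_step_shift_bound(1)[where B=B]) (use B in auto)
    have h: "has_bochner_integral lborel (\<lambda>X. ?s X * F z) (x * \<alpha> * F z)"
      by (rule has_bochner_integral_mult_left) (rule has_bochner_integral_step_shift(1))
    have "(LINT X|lborel. ?s X * (K X - F z)) = (LINT X|lborel. ?s X * K X) - x * \<alpha> * F z"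
      using iK h by (simp add: right_diff_distrib has_bochner_integral_iff)
    with 1 have 2: "\<bar>(LINT X|lborel. ?s X * K X) - x * \<alpha> * F z\<bar> \<le> r' * \<bar>x * \<alpha>\<bar>" by simp
    have "(LINT X|lborel. ?s X * K X) / x - \<alpha> * F z = ((LINT X|lborel. ?s X * K X) - x * \<alpha> * F z) / x"
      using x by (simp add: field_simps)
    then have "\<bar>(LINT X|lborel. ?s X * K X) / x - \<alpha> * F z\<bar> \<le> r' * \<bar>\<alpha>\<bar>"
      using 2 x by (simp add: abs_mult abs_divide field_simps)
    then show "norm ((LINT X|lborel. ?s X * K X) / x - \<alpha> * F z) < r"
      using r' by (simp add: mult.commute)
  qed
qed


section \<open>Flux through one side of the rectangle\<close>

lemma frame_coordinates:
  assumes "norm e = 1"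
  shows "(frame c e z - c) \<bullet> e = fst z" "(frame c e z - c) \<bullet> perp e = snd z"
proof -
  have n: "e$1 * e$1 + e$2 * e$2 = 1"
    using norm_vec2_sq[of e] assms by (simp add: power2_eq_square)
  have "(frame c e z - c) \<bullet> e = fst z * (e$1 * e$1 + e$2 * e$2)"
    "(frame c e z - c) \<bullet> perp e = snd z * (e$1 * e$1 + e$2 * e$2)"
    by (simp_all add: inner_vec2 frame_def algebra_simps)
  then show "(frame c e z - c) \<bullet> e = fst z" "(frame c e z - c) \<bullet> perp e = snd z"
    using n by simp_all
qed

lemma perp_measurable [measurable]: "perp \<in> borel_measurable borel"
proof -
  have "perp = (\<lambda>x. - (x$2) *\<^sub>R axis 1 1 + x$1 *\<^sub>R axis 2 1)"
    by (auto simp: vec_eq_iff forall_2 axis_def)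
  moreover have "continuous_on UNIV (\<lambda>x::real^2. - (x$2) *\<^sub>R axis 1 1 + x$1 *\<^sub>R axis 2 (1::real) :: real^2)"
    by (intro continuous_intros)
  ultimately have "continuous_on UNIV perp" by (simp only:)
  then show ?thesis by (rule borel_measurable_continuous_onI)
qed

text \<open>In frame coordinates the two indicators confine the integrand to a bounded box, on which
  it is at most \<open>B\<close> in modulus.\<close>

lemma side_flux_integrand_integrable:
  fixes f :: "real^2 \<Rightarrow> real"
  assumes n: "norm n = 1" and f [measurable]: "f \<in> borel_measurable borel" and B: "\<And>x. \<bar>f x\<bar> \<le> B"
  shows "integrable lborel (\<lambda>x. (indicator {..<d + a} ((x - c) \<bullet> n) - indicator {..<d} ((x - c) \<bullet> n))
           * indicator {-L<..<L} ((x - c) \<bullet> perp n - b) * f x)"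
proof -
  let ?g = "\<lambda>x. (indicator {..<d + a} ((x - c) \<bullet> n) - indicator {..<d} ((x - c) \<bullet> n))
           * indicator {-L<..<L} ((x - c) \<bullet> perp n - b) * f x"
  let ?h = "\<lambda>z::real\<times>real. (indicator {..<d + a} (fst z) - indicator {..<d} (fst z))
           * indicator {-L<..<L} (snd z - b) * f (frame c n z)"
  have m: "?g \<in> borel_measurable borel" by measurable
  have h: "(\<lambda>z. ?g (frame c n z)) = ?h"
    by (simp add: frame_coordinates[OF n])
  have box: "integrable lborel (\<lambda>z::real\<times>real. indicator (cbox (d - \<bar>a\<bar>, b - L) (d + \<bar>a\<bar>, b + L)) z * B)"
    by (intro integrable_mult_left integrable_real_indicator) (auto simp: emeasure_lborel_cbox_eq)
  have [measurable]: "?h \<in> borel_measurable borel" unfolding h[symmetric] by (intro measurable_compose[OF _ m]) simp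
  have "integrable lborel ?h"
  proof (rule Bochner_Integration.integrable_bound[OF box])
    show "AE z in lborel. norm (?h z) \<le> norm (indicator (cbox (d - \<bar>a\<bar>, b - L) (d + \<bar>a\<bar>, b + L)) z * B)"
    proof (rule AE_I2)
      fix z :: "real \<times> real"
      have "0 \<le> B" using B[of 0] by linarith
      then show "norm (?h z) \<le> norm (indicator (cbox (d - \<bar>a\<bar>, b - L) (d + \<bar>a\<bar>, b + L)) z * B)"
        using B[of "frame c n z"]
        by (cases z) (auto simp: indicator_def abs_mult split: if_splits)
    qed
  qed simp
  then have "integrable (distr lborel borel (frame c n)) ?g"
    by (subst integrable_distr_eq) (use m in \<open>simp_all add: h\<close>)
  then show ?thesis by (simp add: distr_lborel_frame[OF n])
qed

text \<open>Fubini's theorem needs the Borel version \<open>f'\<close> of the density, whereas its limit on the side is a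
  value of \<open>f\<close> itself. The lemma covers all four sides of a rectangle, each seen from the frame of its
  outward normal \<open>n\<close>.\<close>

lemma side_flux:
  fixes f f' :: "real^2 \<Rightarrow> real"
  assumes n: "norm n = 1" and L: "0 < L"
    and f' [measurable]: "f' \<in> borel_measurable borel" and B: "\<And>x. \<bar>f' x\<bar> \<le> B"
    and eq: "AE x in lborel. f' x = f x"
    and cont: "AE s in lebesgue_on {-L..L}. isCont f (c + d *\<^sub>R n + s *\<^sub>R perp n)"
  shows "((\<lambda>\<tau>. (LINT x|lborel. (indicator {..<d + \<tau> * \<alpha>} ((x - c) \<bullet> n) - indicator {..<d} ((x - c) \<bullet> n))
           * indicator {-L<..<L} ((x - c) \<bullet> perp n - \<tau> * \<beta>) * f' x) / \<tau>)
      \<longlongrightarrow> \<alpha> * (LINT s:{-L..L}|lebesgue. f (c + d *\<^sub>R n + s *\<^sub>R perp n))) (at 0)"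
proof -
  let ?F = "\<lambda>Y X. f (frame c n (X, Y))" and ?K = "\<lambda>Y X. f' (frame c n (X, Y))"
  let ?s = "\<lambda>a X. indicator {..<d + a} X - indicator {..<d} X :: real"
  \<comment> \<open>Integral of \<open>f'\<close> across the strip swept at tangential position
    \<open>Y\<close> by a normal displacement \<open>\<tau>\<close>.\<close>
  define H where "H \<tau> Y = (LINT X|lborel. ?s \<tau> X * ?K Y X)" for \<tau> Y
  define \<phi> where "\<phi> s = f (c + d *\<^sub>R n + s *\<^sub>R perp n)" for s
  have B0: "0 \<le> B" using B[of 0] by linarith
  have \<phi>: "\<phi> Y = ?F Y d" for Y by (simp add: \<phi>_def frame_def)
  have Km [measurable]: "?K Y \<in> borel_measurable borel" for Y
    by (intro measurable_compose[OF _ f'] measurable_compose[OF _ frame_measurable]) measurable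
  have Km2 [measurable]: "(\<lambda>(Y, X). ?K Y X) \<in> borel_measurable (lborel \<Otimes>\<^sub>M lborel)"
    unfolding case_prod_beta
    by (intro measurable_compose[OF _ f'] measurable_compose[OF _ frame_measurable])
       (simp add: borel_prod[symmetric] measurable_lborel1)
  have H_meas [measurable]: "H \<tau> \<in> borel_measurable borel" for \<tau>
    unfolding H_def by measurable
  have H_bound: "\<bar>H \<tau> Y\<bar> \<le> B * \<bar>\<tau>\<bar>" for \<tau> Y
    unfolding H_def by (rule integral_step_shift_bound(2)) (use B in auto)
  \<comment> \<open>The tangential coordinate comes first in the pair because \<open>AE_pair\<close>
    fixes the first component: for almost every \<open>Y\<close>, the two versions of the density
    agree at almost every \<open>X\<close>.\<close>
  have "AE z in distr (lborel \<Otimes>\<^sub>M lborel) borel (\<lambda>(Y, X). frame c n (X, Y)). f' z = f z"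
  proof -
    have "distr (lborel \<Otimes>\<^sub>M lborel) borel (\<lambda>(Y, X). frame c n (X, Y)) =
      distr (distr (lborel \<Otimes>\<^sub>M lborel) (lborel \<Otimes>\<^sub>M lborel) (\<lambda>(x, y). (y, x))) borel (frame c n)"
      by (subst distr_distr[OF _ measurable_pair_swap']) (simp_all add: lborel_prod comp_def case_prod_beta')
    also have "distr (lborel \<Otimes>\<^sub>M lborel) (lborel \<Otimes>\<^sub>M lborel) (\<lambda>(x, y). (y, x)) = (lborel :: (real \<times> real) measure)"
      by (subst lborel_pair.distr_pair_swap[symmetric]) (rule lborel_prod)
    also have "distr lborel borel (frame c n) = lborel"
      by (rule distr_lborel_frame[OF n])
    finally show ?thesis using eq by (simp only:)
  qed
  then have "AE z in lborel \<Otimes>\<^sub>M lborel. f' (case z of (Y, X) \<Rightarrow> frame c n (X, Y)) = f (case z of (Y, X) \<Rightarrow> frame c n (X, Y))"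
    by (rule AE_distrD[rotated]) (simp add: case_prod_beta borel_prod)
  then have "AE z in lborel \<Otimes>\<^sub>M lborel. (case z of (Y, X) \<Rightarrow> ?K Y X = ?F Y X)"
    by (simp add: case_prod_beta)
  then have eq': "AE Y in lborel. AE X in lborel. ?K Y X = ?F Y X"
    by (drule_tac lborel_pair.AE_pair) simp
  have cont': "AE Y in lebesgue. Y \<in> {-L..L} \<longrightarrow> isCont (?F Y) d"
  proof -
    have *: "AE Y in lebesgue. Y \<in> {-L..L} \<longrightarrow> isCont f (frame c n (d, Y))"
      using cont by (subst (asm) AE_restrict_space_iff) (auto simp: frame_def)
    show ?thesis using *
    proof eventually_elim
      case (elim Y)
      then show ?case
        by (auto intro!: continuous_within_compose2[of _ _ "\<lambda>X. frame c n (X, Y)" f] isCont_o2[where g=f] simp: frame_def)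
    qed
  qed
  have lim: "AE Y in lebesgue. Y \<in> {-L..L} \<longrightarrow> ((\<lambda>\<tau>. H (\<tau> * \<alpha>) Y / \<tau>) \<longlongrightarrow> \<alpha> * \<phi> Y) (at 0)" for \<alpha>
    using AE_completion[OF eq'] cont'
  proof eventually_elim
    case (elim Y)
    then show ?case unfolding H_def \<phi>
      by (intro impI step_shift_average[OF Km B]) auto
  qed
  \<comment> \<open>Nothing is assumed about the measurability of the contour values. They are
    almost everywhere the limit of the measurable quotients \<open>H \<tau> Y / \<tau>\<close> along
    a sequence, which suffices for a complete measure.\<close>
  have \<phi>_meas: "(\<lambda>Y. indicator {-L..L} Y * \<phi> Y) \<in> borel_measurable lebesgue"
  proof (rule borel_measurable_AE)
    let ?\<tau> = "\<lambda>i. inverse (real (Suc i))"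
    let ?g = "\<lambda>Y. lim (\<lambda>i. indicator {-L..L} Y * (H (?\<tau> i) Y / ?\<tau> i))"
    have t0: "filterlim ?\<tau> (at 0) sequentially"
      using LIMSEQ_inverse_real_of_nat by (simp add: filterlim_at del: of_nat_Suc)
    show "?g \<in> borel_measurable lebesgue"
      by (intro measurable_completion) measurable
    show "AE Y in lebesgue. ?g Y = indicator {-L..L} Y * \<phi> Y"
      using lim[of 1]
    proof eventually_elim
      case (elim Y)
      show ?case
      proof (cases "Y \<in> {-L..L}")
        case True
        then have "(\<lambda>i. H (?\<tau> i) Y / ?\<tau> i) \<longlonglongrightarrow> \<phi> Y"
          using filterlim_compose[OF _ t0] elim by fastforce
        then show ?thesis using True by (simp add: limI)
      qed (simp add: limI)
    qed
  qed
  show ?thesis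
    unfolding tendsto_at_iff_sequentially
  proof (intro allI impI)
    fix t :: "nat \<Rightarrow> real"
    assume tn: "\<forall>i. t i \<in> UNIV - {0}" and t0: "t \<longlonglongrightarrow> 0"
    have ft: "filterlim t (at 0) sequentially"
      using tn t0 by (simp add: filterlim_at)
    obtain R where R: "\<And>i. \<bar>t i\<bar> \<le> R" "0 < R"
      using convergent_imp_Bseq[OF convergentI[OF t0]] unfolding Bseq_def by auto
    define S where "S i Y = indicator {-L<..<L} (Y - t i * \<beta>) * (H (t i * \<alpha>) Y / t i)" for i Y
    \<comment> \<open>\<open>R * \<bar>\<beta>\<bar>\<close> bounds the tangential drift along the
      sequence, so \<open>{-C..C}\<close> contains all displaced windows and carries the dominating
      function.\<close>
    define C where "C = L + R * \<bar>\<beta>\<bar>"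
    have S_meas: "S i \<in> borel_measurable lborel" for i unfolding S_def by measurable
    have "(\<lambda>i. integral\<^sup>L lebesgue (S i)) \<longlonglongrightarrow> (LINT Y|lebesgue. indicator {-L..L} Y * (\<alpha> * \<phi> Y))"
    proof (rule integral_dominated_convergence[where w="\<lambda>Y. indicator {-C..C} Y * (B * \<bar>\<alpha>\<bar>)"])
      show "(\<lambda>Y. indicator {-L..L} Y * (\<alpha> * \<phi> Y)) \<in> borel_measurable lebesgue"
        using borel_measurable_times[OF borel_measurable_const[of \<alpha>] \<phi>_meas] by (simp add: ac_simps)
      show "S i \<in> borel_measurable lebesgue" for i
        using S_meas by (rule measurable_completion)
      show "integrable lebesgue (\<lambda>Y. indicator {-C..C} Y * (B * \<bar>\<alpha>\<bar>))"
        by (intro integrable_mult_left integrable_real_indicator) (auto simp: emeasure_lborel_Icc_eq)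
      show "AE Y in lebesgue. norm (S i Y) \<le> indicator {-C..C} Y * (B * \<bar>\<alpha>\<bar>)" for i
      proof (rule AE_I2)
        fix Y
        have "\<bar>H (t i * \<alpha>) Y / t i\<bar> \<le> B * \<bar>\<alpha>\<bar>"
          using H_bound[of "t i * \<alpha>" Y] tn by (simp add: abs_mult field_simps)
        moreover have "\<bar>t i * \<beta>\<bar> \<le> R * \<bar>\<beta>\<bar>"
          using R(1)[of i] by (simp add: abs_mult mult_right_mono)
        ultimately show "norm (S i Y) \<le> indicator {-C..C} Y * (B * \<bar>\<alpha>\<bar>)"
          using B0 by (auto simp: S_def C_def indicator_def split: if_splits)
      qed
      \<comment> \<open>The end points of the side are excluded: there the indicator of the
        displaced window may oscillate. Away from them it is eventually constant.\<close>
      show "AE Y in lebesgue. (\<lambda>i. S i Y) \<longlonglongrightarrow> indicator {-L..L} Y * (\<alpha> * \<phi> Y)"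
        using lim[of \<alpha>] AE_completion[OF AE_lborel_singleton[of L]] AE_completion[OF AE_lborel_singleton[of "-L"]]
      proof eventually_elim
        case (elim Y)
        have tb: "(\<lambda>i. Y - t i * \<beta>) \<longlonglongrightarrow> Y"
          using tendsto_diff[OF tendsto_const tendsto_mult_left[OF t0, of \<beta>]] by (simp add: mult.commute)
        consider "\<bar>Y\<bar> < L" | "\<bar>Y\<bar> > L" using elim by fastforce
        then show ?case
        proof cases
          case 1
          have "(\<lambda>i. H (t i * \<alpha>) Y / t i) \<longlonglongrightarrow> \<alpha> * \<phi> Y"
            using filterlim_compose[OF _ ft] elim 1 by fastforce
          moreover have "eventually (\<lambda>i. Y - t i * \<beta> \<in> {-L<..<L}) sequentially"
            by (rule topological_tendstoD[OF tb]) (use 1 in auto)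
          then have "eventually (\<lambda>i. S i Y = H (t i * \<alpha>) Y / t i) sequentially"
            by eventually_elim (simp add: S_def)
          moreover have "indicator {-L..L} Y = (1::real)" using 1 by (auto simp: indicator_def)
          ultimately show ?thesis
            by (simp add: tendsto_cong)
        next
          case 2
          have "eventually (\<lambda>i. Y - t i * \<beta> \<in> - {-L..L}) sequentially"
            by (rule topological_tendstoD[OF tb]) (use 2 in auto)
          then have "eventually (\<lambda>i. S i Y = 0) sequentially"
            by eventually_elim (auto simp: S_def)
          moreover have "indicator {-L..L} Y = (0::real)" using 2 by (auto simp: indicator_def)
          ultimately show ?thesis
            by (simp add: tendsto_cong)
        qed
      qed
    qed
    moreover have "(LINT Y|lebesgue. indicator {-L..L} Y * (\<alpha> * \<phi> Y)) = \<alpha> * (LINT s:{-L..L}|lebesgue. \<phi> s)"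
      unfolding set_lebesgue_integral_def
      by (subst integral_mult_right_zero[symmetric]) (simp add: ac_simps)
    moreover have "integral\<^sup>L lebesgue (S i) =
        (LINT x|lborel. (indicator {..<d + t i * \<alpha>} ((x - c) \<bullet> n) - indicator {..<d} ((x - c) \<bullet> n))
           * indicator {-L<..<L} ((x - c) \<bullet> perp n - t i * \<beta>) * f' x) / t i" for i
    proof -
      let ?g = "\<lambda>x. (indicator {..<d + t i * \<alpha>} ((x - c) \<bullet> n) - indicator {..<d} ((x - c) \<bullet> n))
           * indicator {-L<..<L} ((x - c) \<bullet> perp n - t i * \<beta>) * f' x"
      let ?h = "\<lambda>(X, Y). ?s (t i * \<alpha>) X * indicator {-L<..<L} (Y - t i * \<beta>) * ?K Y X"
      have gm: "?g \<in> borel_measurable borel" by measurable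
      have gh: "(\<lambda>z. ?g (frame c n z)) = ?h"
        by (auto simp: frame_coordinates[OF n])
      have gi: "integrable (distr lborel borel (frame c n)) ?g"
        using side_flux_integrand_integrable[OF n f' B] by (simp add: distr_lborel_frame[OF n])
      then have hi: "integrable (lborel \<Otimes>\<^sub>M lborel) ?h"
        using gm by (subst (asm) integrable_distr_eq) (simp_all add: gh lborel_prod)
      have "integral\<^sup>L lborel ?g = integral\<^sup>L (distr lborel borel (frame c n)) ?g"
        by (simp add: distr_lborel_frame[OF n])
      also have "\<dots> = integral\<^sup>L (lborel \<Otimes>\<^sub>M lborel) ?h"
        using gm by (subst integral_distr) (simp_all add: gh lborel_prod)
      also have "\<dots> = (LINT Y|lborel. LINT X|lborel. ?s (t i * \<alpha>) X * indicator {-L<..<L} (Y - t i * \<beta>) * ?K Y X)"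
        using lborel_pair.integral_snd[OF hi] by simp
      also have "\<dots> = (LINT Y|lborel. S i Y * t i)"
      proof (rule Bochner_Integration.integral_cong[OF refl])
        fix Y
        have "(LINT X|lborel. ?s (t i * \<alpha>) X * indicator {-L<..<L} (Y - t i * \<beta>) * ?K Y X) =
            indicator {-L<..<L} (Y - t i * \<beta>) * H (t i * \<alpha>) Y"
          unfolding H_def by (subst integral_mult_right_zero[symmetric]) (simp add: ac_simps)
        then show "(LINT X|lborel. ?s (t i * \<alpha>) X * indicator {-L<..<L} (Y - t i * \<beta>) * ?K Y X) = S i Y * t i"
          using tn by (simp add: S_def)
      qed
      also have "\<dots> = (LINT Y|lborel. S i Y) * t i" by simp
      also have "(LINT Y|lborel. S i Y) = integral\<^sup>L lebesgue (S i)"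
        using integral_completion[OF S_meas] by simp
      finally show ?thesis using tn by (simp add: field_simps)
    qed
    ultimately show "((\<lambda>\<tau>. (LINT x|lborel. (indicator {..<d + \<tau> * \<alpha>} ((x - c) \<bullet> n) - indicator {..<d} ((x - c) \<bullet> n))
           * indicator {-L<..<L} ((x - c) \<bullet> perp n - \<tau> * \<beta>) * f' x) / \<tau>) \<circ> t)
        \<longlonglongrightarrow> \<alpha> * (LINT s:{-L..L}|lebesgue. f (c + d *\<^sub>R n + s *\<^sub>R perp n))"
      by (simp add: comp_def \<phi>_def)
  qed
qed


section \<open>Geometry of the rectangle and its transport\<close>

lemma rectangle_eq_indicator:
  "indicator (rectangle (c + a) e p q) x =
    (indicator {-p<..<p} ((x - c) \<bullet> e - a \<bullet> e) * indicator {-q<..<q} ((x - c) \<bullet> perp e - a \<bullet> perp e) :: real)"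
  by (auto simp: rectangle_def indicator_def inner_diff_left inner_add_left algebra_simps abs_less_iff)

lemma open_rectangle: "open (rectangle c e p q)"
  unfolding rectangle_def Collect_conj_eq
  by (intro open_Int open_Collect_less continuous_intros)

lemma convex_rectangle: "convex (rectangle c e p q)"
proof -
  have "rectangle c e p q = {x. e \<bullet> x < p + c \<bullet> e} \<inter> {x. e \<bullet> x > c \<bullet> e - p}
      \<inter> {x. perp e \<bullet> x < q + c \<bullet> perp e} \<inter> {x. perp e \<bullet> x > c \<bullet> perp e - q}"
    by (auto simp: rectangle_def inner_diff_left abs_less_iff algebra_simps inner_commute)
  then show ?thesis
    by (simp add: convex_Int convex_halfspace_lt convex_halfspace_gt)
qed

lemma rectangle_frame:
  assumes "norm e = 1"
  shows "rectangle c e p q = frame c e ` ({-p<..<p} \<times> {-q<..<q})"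
proof -
  have "x = frame c e ((x - c) \<bullet> e, (x - c) \<bullet> perp e)" for x
  proof -
    have "e$1 * e$1 + e$2 * e$2 = 1"
      using norm_vec2_sq[of e] assms by (simp add: power2_eq_square)
    then show ?thesis
      by (simp add: vec_eq_iff forall_2 frame_def inner_vec2) algebra
  qed
  then show ?thesis
    using frame_coordinates[OF assms, of c]
    by (force simp: rectangle_def abs_less_iff)
qed

lemma bounded_rectangle:
  assumes "norm e = 1"
  shows "bounded (rectangle c e p q)"
proof -
  have "compact (frame c e ` ({-p..p} \<times> {-q..q}))"
    by (intro compact_continuous_image continuous_frame compact_Times compact_Icc)
  then show ?thesis
    unfolding rectangle_frame[OF assms]
    by (rule bounded_subset[OF compact_imp_bounded]) auto
qed

text \<open>A point of a side is the limit of its contractions towards the centre, which lie in the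
  open rectangle; one of its own frame coordinates is extremal, so it is not in the
  rectangle.\<close>

lemma rectangle_side_frontier:
  assumes e: "norm e = 1" and "0 < p" "0 < q" "(m, n, L) \<in> set (rectangle_sides c e p q)" "s \<in> {-L..L}"
  shows "m + s *\<^sub>R perp n \<in> frontier (rectangle c e p q)"
proof -
  have pp: "perp (perp e) = - e" "perp (- e) = - perp e" by (simp_all add: vec_eq_iff forall_2)
  obtain X Y where XY: "m + s *\<^sub>R perp n = frame c e (X, Y)"
      "\<bar>X\<bar> \<le> p" "\<bar>Y\<bar> \<le> q" "\<bar>X\<bar> = p \<or> \<bar>Y\<bar> = q"
  proof -
    have "m + s *\<^sub>R perp n = frame c e (p, s) \<and> L = q \<or> m + s *\<^sub>R perp n = frame c e (-p, -s) \<and> L = q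
      \<or> m + s *\<^sub>R perp n = frame c e (-s, q) \<and> L = p \<or> m + s *\<^sub>R perp n = frame c e (s, -q) \<and> L = p"
      using assms(4) by (auto simp: rectangle_sides_def frame_def pp perp_def[of "- perp e"] vec_eq_iff forall_2)
    then show ?thesis using assms that by (auto simp: abs_le_iff)
  qed
  let ?r = "\<lambda>k. 1 - inverse (real (Suc k))"
  have "frame c e (X, Y) \<notin> rectangle c e p q"
    using XY frame_coordinates[OF e] by (auto simp: rectangle_def)
  moreover have "frame c e (X, Y) \<in> closure (rectangle c e p q)"
    unfolding closure_sequential
  proof (intro exI[of _ "\<lambda>k. frame c e (?r k * X, ?r k * Y)"] conjI allI)
    fix k
    have "\<bar>?r k\<bar> < 1" by (simp add: field_simps)
    moreover have "\<bar>x\<bar> * \<bar>r\<bar> < y" if "\<bar>x\<bar> \<le> y" "0 < y" "\<bar>r\<bar> < 1" for x y r :: real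
      using that by (metis abs_ge_zero linorder_not_less mult.right_neutral mult_le_cancel_left_pos mult_less_cancel_left_pos mult_mono mult_zero_left order_less_le order_le_less_trans abs_not_less_zero)
    ultimately show "frame c e (?r k * X, ?r k * Y) \<in> rectangle c e p q"
      using XY assms(2,3) unfolding rectangle_def
      by (simp add: frame_coordinates[OF e] abs_mult mult.commute)
  next
    have r: "?r \<longlonglongrightarrow> 1 - 0" by (intro tendsto_diff tendsto_const LIMSEQ_inverse_real_of_nat)
    then have "(\<lambda>k. c + (?r k * X) *\<^sub>R e + (?r k * Y) *\<^sub>R perp e) \<longlonglongrightarrow> c + ((1 - 0) * X) *\<^sub>R e + ((1 - 0) * Y) *\<^sub>R perp e"
      by (intro tendsto_add tendsto_scaleR tendsto_mult r tendsto_const)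
    then show "(\<lambda>k. frame c e (?r k * X, ?r k * Y)) \<longlonglongrightarrow> frame c e (X, Y)"
      by (simp add: frame_def)
  qed
  ultimately show ?thesis
    by (simp add: XY frontier_def interior_open[OF open_rectangle])
qed

text \<open>For small \<open>\<tau>\<close> only a neighbourhood of the contour is swept. There
  \<open>f\<close> is bounded and can be replaced by a bounded Borel function, after which
  \<open>side_flux\<close> applies to each side with \<open>w \<bullet> n\<close> as its normal
  speed.\<close>

lemma moving_rectangle_flux:
  fixes f :: "real^2 \<Rightarrow> real"
  assumes e: "norm e = 1" and p: "0 < p" and q: "0 < q"
    and D [measurable]: "D \<in> sets lebesgue" and f: "integrable (lebesgue_on D) f"
    and sub: "closure (rectangle c e p q) \<subseteq> interior D"
    and reg: "has_contour_values f (frontier (rectangle c e p q)) (rectangle_sides c e p q)"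
  shows "((\<lambda>\<tau>. LINT x:rectangle (c + \<tau> *\<^sub>R w) e p q|lebesgue. f x) has_real_derivative
           boundary_integral (rectangle_sides c e p q) (\<lambda>x n. f x * (w \<bullet> n))) (at 0)"
proof -
  define R where "R \<tau> = rectangle (c + \<tau> *\<^sub>R w) e p q" for \<tau>
  have R0: "R 0 = rectangle c e p q" by (simp add: R_def)
  obtain U0 where U0: "open U0" "frontier (R 0) \<subseteq> U0" "bounded (f ` U0)"
    using reg unfolding has_contour_values_def R0 by blast
  define U where "U = U0 \<inter> interior D"
  have U: "open U" "frontier (R 0) \<subseteq> U" "U \<subseteq> D"
    using U0 sub interior_subset[of D] unfolding U_def R0 frontier_def by auto
  obtain B where B: "0 < B" "\<And>x. x \<in> U \<Longrightarrow> \<bar>f x\<bar> \<le> B"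
    using U0(3) unfolding U_def bounded_pos by auto
  have "compact (frontier (R 0))"
    unfolding R0 by (rule compact_frontier_bounded[OF bounded_rectangle[OF e]])
  then obtain \<delta> where \<delta>: "0 < \<delta>" "(\<Union>x\<in>frontier (R 0). ball x \<delta>) \<subseteq> U"
    using compact_subset_open_imp_ball_epsilon_subset U by blast
  define f1 where "f1 x = indicator U x * f x" for x
  have fD: "integrable lebesgue (\<lambda>x. indicator D x * f x)"
    using f D by (simp add: integrable_restrict_space)
  have f1_meas: "f1 \<in> borel_measurable lebesgue"
  proof -
    have "f1 = (\<lambda>x. indicator U x * (indicator D x * f x))"
      using U by (auto simp: f1_def fun_eq_iff indicator_def)
    moreover have "(\<lambda>x. indicator U x * (indicator D x * f x)) \<in> borel_measurable lebesgue"
      by (rule borel_measurable_times[OF borel_measurable_indicator borel_measurable_integrable[OF fD]])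
         (simp add: sets_completionI_sets U)
    ultimately show ?thesis by simp
  qed
  obtain f2 where f2: "f2 \<in> borel_measurable lborel" "AE x in lborel. f1 x = f2 x"
    using completion_ex_borel_measurable_real[OF f1_meas] by blast
  \<comment> \<open>Clipping turns an almost everywhere bound into a bound everywhere, as
    \<open>side_flux\<close> asks, and changes nothing where \<open>f2\<close> agrees with
    \<open>f1\<close>.\<close>
  define f' where "f' x = max (- B) (min B (f2 x))" for x
  have f' [measurable]: "f' \<in> borel_measurable borel" using f2 unfolding f'_def by simp
  have f'B: "\<bar>f' x\<bar> \<le> B" for x using B by (auto simp: f'_def)
  have f'eq: "AE x in lborel. f' x = f1 x"
    using f2(2)
  proof eventually_elim
    case (elim x)
    have "\<bar>f1 x\<bar> \<le> B" using B by (auto simp: f1_def indicator_def)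
    then show ?case using elim by (auto simp: f'_def)
  qed
  let ?\<alpha> = "w \<bullet> e" and ?\<beta> = "w \<bullet> perp e"
  let ?side = "\<lambda>n d L \<alpha> \<beta> x. (indicator {..<d + \<alpha>} ((x - c) \<bullet> n) - indicator {..<d} ((x - c) \<bullet> n))
           * indicator {-L<..<L} ((x - c) \<bullet> perp n - \<beta>) * f' x :: real"
  have ne: "norm (- e) = 1" "norm (perp e) = 1" "norm (- perp e) = 1"
    using e by (simp_all add: norm_perp)
  have pp: "perp (perp e) = - e" "perp (- e) = - perp e" "perp (- perp e) = e" by (simp_all add: vec_eq_iff forall_2)
  \<comment> \<open>Telescoping the product,
    \<open>a' * b' - a * b = (a' - a) * b' + (b' - b) * a\<close>, splits the difference exactly.
    Hence the sides normal to \<open>e\<close> carry the displaced tangential window and the other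
    two the original one, and no corner is counted twice.\<close>
  have split: "(indicator (R \<tau>) x - indicator (R 0) x) * f' x =
      ?side e p q (\<tau> * ?\<alpha>) (\<tau> * ?\<beta>) x + ?side (- e) p q (\<tau> * (w \<bullet> - e)) (\<tau> * (w \<bullet> perp (- e))) x +
      (?side (perp e) q p (\<tau> * ?\<beta>) (\<tau> * 0) x + ?side (- perp e) q p (\<tau> * (w \<bullet> - perp e)) (\<tau> * 0) x)" for \<tau> x
  proof -
    have neg: "indicator {-L<..<L} (- y) = (indicator {-L<..<L} y :: real)" for L y :: real
      by (auto simp: indicator_def)
    \<comment> \<open>Displacing an interval by \<open>a\<close> moves its right end outward by
      \<open>a\<close> and its left end outward by \<open>- a\<close>, the latter seen in the
      reflected coordinate. With \<open>0 < L\<close> the two half lines cover the line, so the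
      indicator of the interval is the sum of theirs minus 1.\<close>
    have *: "indicator {-L<..<L} (y - a) - indicator {-L<..<L} y =
       (indicator {..<L + a} y - indicator {..<L} y) + (indicator {..<L - a} (- y) - indicator {..<L} (- y) :: real)"
      if "0 < L" for L y a :: real
      using that by (auto simp: indicator_def)
    have ring: "((a + b) * u + (a' + b') * v) * z = a * u * z + b * u * z + (a' * v * z + b' * v * z)"
      for a b a' b' u v z :: real
      by (simp add: distrib_right)
    define X Y where "X = (x - c) \<bullet> e" and "Y = (x - c) \<bullet> perp e"
    have 1: "(indicator (R \<tau>) x - indicator (R 0) x :: real) =
      (indicator {-p<..<p} (X - \<tau> * ?\<alpha>) - indicator {-p<..<p} X) * indicator {-q<..<q} (Y - \<tau> * ?\<beta>) +
      (indicator {-q<..<q} (Y - \<tau> * ?\<beta>) - indicator {-q<..<q} Y) * indicator {-p<..<p} X"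
      unfolding R_def rectangle_eq_indicator[of c] X_def Y_def by (simp add: algebra_simps)
    have "((indicator {-p<..<p} (X - \<tau> * ?\<alpha>) - indicator {-p<..<p} X) * indicator {-q<..<q} (Y - \<tau> * ?\<beta>) +
      (indicator {-q<..<q} (Y - \<tau> * ?\<beta>) - indicator {-q<..<q} Y) * indicator {-p<..<p} X) * f' x = ?side e p q (\<tau> * ?\<alpha>) (\<tau> * ?\<beta>) x + ?side (- e) p q (\<tau> * (w \<bullet> - e)) (\<tau> * (w \<bullet> perp (- e))) x +
      (?side (perp e) q p (\<tau> * ?\<beta>) (\<tau> * 0) x + ?side (- perp e) q p (\<tau> * (w \<bullet> - perp e)) (\<tau> * 0) x)"
      unfolding X_def[symmetric] Y_def[symmetric] *[OF p] *[OF q] pp inner_minus_right X_def[symmetric] Y_def[symmetric] mult_minus_right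
        minus_diff_minus neg diff_zero mult_zero_right add_uminus_conv_diff
      by (rule ring)
    then show ?thesis by (simp only: 1)
  qed
  have int: "integrable lborel (?side n d L \<alpha> \<beta>)" if "norm n = 1" for n d L \<alpha> \<beta>
    by (rule side_flux_integrand_integrable[OF that f' f'B])
  \<comment> \<open>A point in exactly one of \<open>R \<tau>\<close> and \<open>R 0\<close> is
    joined to its translate \<open>x - \<tau> *\<^sub>R w\<close> by a segment with one end in
    \<open>R 0\<close> and the other outside. This segment meets the contour and is shorter than
    \<open>\<delta>\<close>.\<close>
  have small: "x \<in> U" if "\<bar>\<tau>\<bar> * norm w < \<delta>" and "x \<in> R \<tau> - R 0 \<or> x \<in> R 0 - R \<tau>" for x \<tau>
  proof -
    have sh: "x \<in> R \<tau> \<longleftrightarrow> x - \<tau> *\<^sub>R w \<in> R 0"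
      by (simp add: R_def rectangle_def algebra_simps)
    have "closed_segment (x - \<tau> *\<^sub>R w) x \<inter> frontier (R 0) \<noteq> {}"
      by (rule connected_Int_frontier) (use that sh in \<open>auto intro: convex_connected\<close>)
    then obtain y where y: "y \<in> closed_segment (x - \<tau> *\<^sub>R w) x" "y \<in> frontier (R 0)" by blast
    have "dist y x \<le> dist (x - \<tau> *\<^sub>R w) x"
      using y(1) by (meson dist_in_closed_segment)
    also have "\<dots> < \<delta>" using that by (simp add: dist_norm)
    finally show ?thesis using \<delta>(2) y(2) by (auto simp: subset_iff)
  qed
  define S where "S n d L \<alpha> \<beta> = (LINT x|lborel. ?side n d L \<alpha> \<beta> x)" for n d L \<alpha> \<beta>
  have diff: "(LINT x:R \<tau>|lebesgue. f x) - (LINT x:R 0|lebesgue. f x) =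
      S e p q (\<tau> * ?\<alpha>) (\<tau> * ?\<beta>) + S (- e) p q (\<tau> * (w \<bullet> - e)) (\<tau> * (w \<bullet> perp (- e))) +
      (S (perp e) q p (\<tau> * ?\<beta>) (\<tau> * 0) + S (- perp e) q p (\<tau> * (w \<bullet> - perp e)) (\<tau> * 0))"
    if \<tau>: "\<bar>\<tau>\<bar> * norm w < \<delta>" for \<tau>
  proof -
    have RD: "R \<tau> \<subseteq> D" "R 0 \<subseteq> D"
      using small[OF \<tau>] sub interior_subset[of D] closure_subset[of "R 0"] U unfolding R0 by blast+
    have I: "set_integrable lebesgue A f" if "A \<subseteq> D" "A \<in> sets lebesgue" for A
    proof -
      have "(\<lambda>x. indicator A x *\<^sub>R f x) = (\<lambda>x. indicator A x * (indicator D x * f x))"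
        using that by (auto simp: fun_eq_iff indicator_def)
      then show ?thesis
        unfolding set_integrable_def
        using integrable_mult_indicator[OF that(2) fD] by simp
    qed
    have oR: "R \<tau> \<in> sets lebesgue" for \<tau> unfolding R_def by (simp add: sets_completionI_sets open_rectangle)
    have "(LINT x:R \<tau>|lebesgue. f x) - (LINT x:R 0|lebesgue. f x) =
       (LINT x|lebesgue. indicator (R \<tau>) x *\<^sub>R f x - indicator (R 0) x *\<^sub>R f x)"
      unfolding set_lebesgue_integral_def
      using I[OF RD(1) oR] I[OF RD(2) oR] unfolding set_integrable_def
      by (rule Bochner_Integration.integral_diff[symmetric])
    also have "\<dots> = (LINT x|lebesgue. (indicator (R \<tau>) x - indicator (R 0) x) * f1 x)"
      by (rule Bochner_Integration.integral_cong)
         (use small[OF \<tau>] in \<open>auto simp: f1_def indicator_def\<close>)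
    also have "\<dots> = (LINT x|lebesgue. (indicator (R \<tau>) x - indicator (R 0) x) * f' x)"
    proof (rule integral_cong_AE)
      show "(\<lambda>x. (indicator (R \<tau>) x - indicator (R 0) x) * f1 x) \<in> borel_measurable lebesgue"
        using f1_meas oR by measurable
      show "(\<lambda>x. (indicator (R \<tau>) x - indicator (R 0) x) * f' x) \<in> borel_measurable lebesgue"
        using f' oR by (intro borel_measurable_times borel_measurable_diff borel_measurable_indicator measurable_completion) auto
      show "AE x in lebesgue. (indicator (R \<tau>) x - indicator (R 0) x) * f1 x = (indicator (R \<tau>) x - indicator (R 0) x) * f' x"
        using AE_completion[OF f'eq] by eventually_elim simp
    qed
    also have "\<dots> = (LINT x|lborel. (indicator (R \<tau>) x - indicator (R 0) x) * f' x)"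
      by (rule integral_completion)
         (intro borel_measurable_times borel_measurable_diff borel_measurable_indicator; simp add: R_def open_rectangle)
    also have "\<dots> = S e p q (\<tau> * ?\<alpha>) (\<tau> * ?\<beta>) + S (- e) p q (\<tau> * (w \<bullet> - e)) (\<tau> * (w \<bullet> perp (- e))) +
      (S (perp e) q p (\<tau> * ?\<beta>) (\<tau> * 0) + S (- perp e) q p (\<tau> * (w \<bullet> - perp e)) (\<tau> * 0))"
      unfolding split S_def
      by (simp only: Bochner_Integration.integral_add Bochner_Integration.integrable_add int ne e)
    finally show ?thesis .
  qed
  have side: "((\<lambda>\<tau>. S n d L (\<tau> * (w \<bullet> n)) (\<tau> * \<beta>) / \<tau>) \<longlongrightarrow> (LINT s:{-L..L}|lebesgue. f (c + d *\<^sub>R n + s *\<^sub>R perp n) * (w \<bullet> n))) (at 0)"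
    if s: "(c + d *\<^sub>R n, n, L) \<in> set (rectangle_sides c e p q)" and n: "norm n = 1" and L: "0 < L" for n d L \<beta>
  proof -
    have fr: "c + d *\<^sub>R n + s *\<^sub>R perp n \<in> U" if "s \<in> {-L..L}" for s
      using rectangle_side_frontier[OF e p q s that] U(2) unfolding R0 by blast
    have "AE s in lebesgue_on {-L..L}. isCont f (c + d *\<^sub>R n + s *\<^sub>R perp n)"
      using reg s unfolding has_contour_values_def boundary_AE_def by fastforce
    moreover have "AE s in lebesgue_on {-L..L}. s \<in> {-L..L}" by (rule AE_I2) simp
    \<comment> \<open>\<open>f1\<close> equals \<open>f\<close> on the open set \<open>U\<close>,
      which contains the contour, so continuity carries over.\<close>
    ultimately have "AE s in lebesgue_on {-L..L}. isCont f1 (c + d *\<^sub>R n + s *\<^sub>R perp n)"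
    proof eventually_elim
      case (elim s)
      have "eventually (\<lambda>x. f1 x = f x) (nhds (c + d *\<^sub>R n + s *\<^sub>R perp n))"
        using eventually_nhds_in_open[OF U(1) fr[OF elim(2)]] by eventually_elim (simp add: f1_def)
      then show ?case using elim(1) by (simp add: isCont_cong)
    qed
    from side_flux[OF n L f' f'B f'eq this, of "w \<bullet> n" \<beta>]
    have "((\<lambda>\<tau>. S n d L (\<tau> * (w \<bullet> n)) (\<tau> * \<beta>) / \<tau>) \<longlongrightarrow> (w \<bullet> n) * (LINT s:{-L..L}|lebesgue. f1 (c + d *\<^sub>R n + s *\<^sub>R perp n))) (at 0)"
      unfolding S_def .
    also have "(LINT s:{-L..L}|lebesgue. f1 (c + d *\<^sub>R n + s *\<^sub>R perp n)) = (LINT s:{-L..L}|lebesgue. f (c + d *\<^sub>R n + s *\<^sub>R perp n))"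
      by (rule set_lebesgue_integral_cong) (use fr in \<open>auto simp: f1_def\<close>)
    finally show ?thesis by (simp add: mult.commute)
  qed
  define I where "I d n L = (LINT s:{-L..L}|lebesgue. f (c + d *\<^sub>R n + s *\<^sub>R perp n) * (w \<bullet> n))" for d n L
  have bi: "boundary_integral (rectangle_sides c e p q) (\<lambda>x n. f x * (w \<bullet> n)) =
      (I p e q + I p (- e) q) + (I q (perp e) p + I q (- perp e) p)"
    by (simp add: I_def boundary_integral_def rectangle_sides_def del: set_integral_mult_left set_integral_mult_right)
  have "((\<lambda>\<tau>. ((LINT x:R \<tau>|lebesgue. f x) - (LINT x:R 0|lebesgue. f x)) / \<tau>) \<longlongrightarrow>
      boundary_integral (rectangle_sides c e p q) (\<lambda>x n. f x * (w \<bullet> n))) (at 0)"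
  proof (rule Lim_transform_eventually)
    show "((\<lambda>\<tau>. (S e p q (\<tau> * ?\<alpha>) (\<tau> * ?\<beta>) / \<tau> + S (- e) p q (\<tau> * (w \<bullet> - e)) (\<tau> * (w \<bullet> perp (- e))) / \<tau>) +
      (S (perp e) q p (\<tau> * ?\<beta>) (\<tau> * 0) / \<tau> + S (- perp e) q p (\<tau> * (w \<bullet> - perp e)) (\<tau> * 0) / \<tau>)) \<longlongrightarrow>
      boundary_integral (rectangle_sides c e p q) (\<lambda>x n. f x * (w \<bullet> n))) (at 0)"
      unfolding bi I_def
    proof (intro tendsto_add)
      show "((\<lambda>\<tau>. S e p q (\<tau> * ?\<alpha>) (\<tau> * ?\<beta>) / \<tau>) \<longlongrightarrow>
          (LINT s:{-q..q}|lebesgue. f (c + p *\<^sub>R e + s *\<^sub>R perp e) * (w \<bullet> e))) (at 0)"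
        by (rule side) (use e q in \<open>auto simp: rectangle_sides_def\<close>)
      show "((\<lambda>\<tau>. S (- e) p q (\<tau> * (w \<bullet> - e)) (\<tau> * (w \<bullet> perp (- e))) / \<tau>) \<longlongrightarrow>
          (LINT s:{-q..q}|lebesgue. f (c + p *\<^sub>R - e + s *\<^sub>R perp (- e)) * (w \<bullet> - e))) (at 0)"
        by (rule side) (use e q in \<open>auto simp: rectangle_sides_def\<close>)
      show "((\<lambda>\<tau>. S (perp e) q p (\<tau> * ?\<beta>) (\<tau> * 0) / \<tau>) \<longlongrightarrow>
          (LINT s:{-p..p}|lebesgue. f (c + q *\<^sub>R perp e + s *\<^sub>R perp (perp e)) * (w \<bullet> perp e))) (at 0)"
        by (rule side) (use ne p in \<open>auto simp: rectangle_sides_def\<close>)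
      show "((\<lambda>\<tau>. S (- perp e) q p (\<tau> * (w \<bullet> - perp e)) (\<tau> * 0) / \<tau>) \<longlongrightarrow>
          (LINT s:{-p..p}|lebesgue. f (c + q *\<^sub>R - perp e + s *\<^sub>R perp (- perp e)) * (w \<bullet> - perp e))) (at 0)"
        by (rule side) (use ne p in \<open>auto simp: rectangle_sides_def\<close>)
    qed
    have "eventually (\<lambda>\<tau>. \<bar>\<tau>\<bar> * norm w < \<delta>) (at 0)"
    proof -
      have "((\<lambda>\<tau>::real. \<bar>\<tau>\<bar> * norm w) \<longlongrightarrow> \<bar>0\<bar> * norm w) (at 0)" by (intro tendsto_intros)
      then show ?thesis by (rule order_tendstoD) (use \<delta> in simp)
    qed
    then show "\<forall>\<^sub>F \<tau> in at 0. (S e p q (\<tau> * ?\<alpha>) (\<tau> * ?\<beta>) / \<tau> + S (- e) p q (\<tau> * (w \<bullet> - e)) (\<tau> * (w \<bullet> perp (- e))) / \<tau>) +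
      (S (perp e) q p (\<tau> * ?\<beta>) (\<tau> * 0) / \<tau> + S (- perp e) q p (\<tau> * (w \<bullet> - perp e)) (\<tau> * 0) / \<tau>) =
      ((LINT x:R \<tau>|lebesgue. f x) - (LINT x:R 0|lebesgue. f x)) / \<tau>"
      by eventually_elim (simp only: diff add_divide_distrib)
  qed
  then show ?thesis
    unfolding has_field_derivative_iff R_def by simp
qed

section \<open>Bond forces and bond energies\<close>

text \<open>Coordinate factor of the planar majorant below. The value \<open>\<infinity>\<close> at
  the origin costs nothing in the integral and keeps the majorant valid on the coordinate axes,
  where the convention \<open>1 / 0 = 0\<close> would make it vanish.\<close>

lemma nn_integral_inverse_sqrt_finite:
  fixes r :: real
  assumes "0 \<le> r"
  shows "(\<integral>\<^sup>+s. (if s = 0 then \<infinity> else indicator {-r..r} s * ennreal (1 / sqrt \<bar>s\<bar>)) \<partial>lborel) < \<infinity>"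
proof -
  define f where "f s = indicator {0..r} s * (s powr (-1/2))" for s :: real
  have f_meas [measurable]: "f \<in> borel_measurable borel" unfolding f_def by measurable
  have "(\<integral>\<^sup>+s. ennreal (f s) \<partial>lborel) = ennreal (r powr (-1/2 + 1) / (-1/2 + 1))"
    unfolding f_def
    by (rule nn_integral_has_integral_lebesgue[OF _ has_integral_powr_from_0]) (use assms in auto)
  then have fin: "(\<integral>\<^sup>+s. ennreal (f s) \<partial>lborel) < \<infinity>" by simp
  have flip: "(\<integral>\<^sup>+s. ennreal (f (- s)) \<partial>lborel) = (\<integral>\<^sup>+s. ennreal (f s) \<partial>lborel)"
  proof -
    have "(\<integral>\<^sup>+s. ennreal (f s) \<partial>lborel) = (\<integral>\<^sup>+s. ennreal (f s) \<partial>distr lborel borel uminus)"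
      by (simp only: lborel_distr_uminus)
    also have "\<dots> = (\<integral>\<^sup>+s. ennreal (f (- s)) \<partial>lborel)"
      by (rule nn_integral_distr) auto
    finally show ?thesis by simp
  qed
  have "(\<integral>\<^sup>+s. (if s = 0 then \<infinity> else indicator {-r..r} s * ennreal (1 / sqrt \<bar>s\<bar>)) \<partial>lborel)
      \<le> (\<integral>\<^sup>+s. ennreal (f s) + ennreal (f (- s)) \<partial>lborel)"
  proof (rule nn_integral_mono_AE)
    show "AE s in lborel. (if s = 0 then \<infinity> else indicator {-r..r} s * ennreal (1 / sqrt \<bar>s\<bar>)) \<le> ennreal (f s) + ennreal (f (- s))"
      using AE_lborel_singleton[of "0::real"]
    proof eventually_elim
      case (elim s)
      have sq: "1 / sqrt x = x powr (-1/2)" if "0 < x" for x :: real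
        using powr_minus[of x "1/2"] that by (simp add: powr_half_sqrt inverse_eq_divide)
      show ?case
      proof (cases "s \<in> {-r..r}")
        case True
        then have "1 / sqrt \<bar>s\<bar> = f (if 0 < s then s else - s)"
          using elim sq[of "\<bar>s\<bar>"] by (auto simp: f_def)
        moreover have "f s \<ge> 0" "f (- s) \<ge> 0" by (auto simp: f_def)
        ultimately show ?thesis
          using True elim by (auto intro: add_increasing add_increasing2)
      qed (use elim in simp)
    qed
  qed
  also have "\<dots> = (\<integral>\<^sup>+s. ennreal (f s) \<partial>lborel) + (\<integral>\<^sup>+s. ennreal (f (- s)) \<partial>lborel)"
    by (rule nn_integral_add) auto
  also have "\<dots> < \<infinity>" using fin flip by simp
  finally show ?thesis .
qed

text \<open>One singular kernel for all bond estimates. On the diagonal \<open>1 / 0 = 0\<close>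
  gives the value 0, in agreement with the vanishing of \<open>bond_dir x x\<close>.\<close>

definition inverse_distance :: "real \<Rightarrow> real^2 \<Rightarrow> real^2 \<Rightarrow> real" where
  "inverse_distance r x y = (if norm (y - x) < r then 1 / norm (y - x) else 0)"

lemma inverse_distance_nonneg [simp]: "0 \<le> inverse_distance r x y"
  by (simp add: inverse_distance_def)

lemma inverse_distance_sym: "inverse_distance r x y = inverse_distance r y x"
  by (simp add: inverse_distance_def norm_minus_commute)

text \<open>Since \<open>sqrt \<bar>z$1\<bar> * sqrt \<bar>z$2\<bar> \<le> norm z\<close>, a product
  of one-dimensional inverse square roots dominates the kernel, and polar coordinates are avoided.
  Translation invariance makes the bound uniform in \<open>x\<close>.\<close>

lemma nn_integral_inverse_distance_bounded:
  assumes "0 < r"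
  obtains C where "0 \<le> C" "\<And>x. (\<integral>\<^sup>+y. ennreal (inverse_distance r x y) \<partial>lborel) \<le> ennreal C"
proof -
  define h where "h s = (if s = 0 then \<infinity> else indicator {-r..r} s * ennreal (1 / sqrt \<bar>s\<bar>))" for s :: real
  define C where "C = (\<integral>\<^sup>+s. h s \<partial>lborel) * (\<integral>\<^sup>+s. h s \<partial>lborel)"
  have h_meas [measurable]: "h \<in> borel_measurable borel" unfolding h_def by measurable
  have "C < \<infinity>"
    using nn_integral_inverse_sqrt_finite[of r] assms unfolding C_def h_def
    by (simp add: ennreal_mult_less_top)
  have B2: "(Basis :: (real^2) set) = {axis 1 1, axis 2 1}"
    by (simp add: Basis_vec_def UNIV_2 insert_commute)
  have ne: "axis 1 1 \<noteq> (axis 2 1 :: real^2)" by (simp add: axis_eq_axis)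
  have le: "ennreal (inverse_distance r 0 z) \<le> h (z$1) * h (z$2)" for z
  proof (cases "norm z < r \<and> z \<noteq> 0")
    case True
    have c: "\<bar>z$1\<bar> \<le> norm z" "\<bar>z$2\<bar> \<le> norm z"
      using component_le_norm_cart by blast+
    show ?thesis
    proof (cases "z$1 = 0 \<or> z$2 = 0")
      case z0: True
      have "h (z$1) \<noteq> 0" "h (z$2) \<noteq> 0"
        using c True by (auto simp: h_def abs_le_iff indicator_def)
      moreover have "h (z$1) = \<infinity> \<or> h (z$2) = \<infinity>" using z0 by (auto simp: h_def)
      ultimately have "h (z$1) * h (z$2) = \<infinity>"
        by (auto simp: ennreal_top_mult ennreal_mult_top)
      then show ?thesis by simp
    next
      case False
      have "sqrt \<bar>z$1\<bar> * sqrt \<bar>z$2\<bar> \<le> sqrt (norm z) * sqrt (norm z)"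
        using c by (intro mult_mono real_sqrt_le_mono) auto
      then have "1 / norm z \<le> 1 / (sqrt \<bar>z$1\<bar> * sqrt \<bar>z$2\<bar>)"
        using True False by (intro divide_left_mono) auto
      then show ?thesis using False c True
        by (simp add: h_def inverse_distance_def ennreal_mult[symmetric] abs_le_iff ennreal_leI)
    qed
  qed (auto simp: inverse_distance_def)
  have 0: "(\<integral>\<^sup>+z. ennreal (inverse_distance r 0 z) \<partial>lborel) \<le> C"
  proof -
    have "(\<integral>\<^sup>+z. ennreal (inverse_distance r 0 z) \<partial>lborel) \<le> (\<integral>\<^sup>+z. (\<Prod>b\<in>Basis. h (z \<bullet> b)) \<partial>(lborel :: (real^2) measure))"
      by (rule nn_integral_mono) (use le in \<open>simp add: B2 ne inner_axis\<close>)
    also have "\<dots> = C"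
      by (subst nn_integral_lborel_prod) (auto simp: B2 ne C_def)
    finally show ?thesis .
  qed
  have [measurable]: "inverse_distance r x \<in> borel_measurable borel" for x
    unfolding inverse_distance_def by measurable
  have eq: "(\<integral>\<^sup>+y. ennreal (inverse_distance r x y) \<partial>lborel) = (\<integral>\<^sup>+z. ennreal (inverse_distance r 0 z) \<partial>lborel)" for x
  proof -
    have "(\<integral>\<^sup>+y. ennreal (inverse_distance r x y) \<partial>lborel) =
        (\<integral>\<^sup>+y. ennreal (inverse_distance r x y) \<partial>distr lborel borel ((+) x))"
      by (simp only: lborel_distr_plus)
    also have "\<dots> = (\<integral>\<^sup>+z. ennreal (inverse_distance r x (x + z)) \<partial>lborel)"
      by (rule nn_integral_distr) auto
    also have "\<dots> = (\<integral>\<^sup>+z. ennreal (inverse_distance r 0 z) \<partial>lborel)"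
      by (simp add: inverse_distance_def cong: if_cong)
    finally show ?thesis .
  qed
  show ?thesis
  proof
    show "0 \<le> enn2real C" by simp
    show "(\<integral>\<^sup>+y. ennreal (inverse_distance r x y) \<partial>lborel) \<le> ennreal (enn2real C)" for x
      using 0 \<open>C < \<infinity>\<close> by (subst eq) simp
  qed
qed

section \<open>Square-integrable fields on the body\<close>

lemma L2_fieldsD:
  assumes "f \<in> L2_fields D"
  shows "f \<in> borel_measurable (lebesgue_on D)" "integrable (lebesgue_on D) (\<lambda>x. (norm (f x))\<^sup>2)"
  using assms by (auto simp: L2_fields_def)

lemma L2_fields_diff:
  assumes "f \<in> L2_fields D" "h \<in> L2_fields D"
  shows "(\<lambda>x. f x - h x) \<in> L2_fields D"
proof -
  note [measurable] = L2_fieldsD(1)[OF assms(1)] L2_fieldsD(1)[OF assms(2)]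
  have "integrable (lebesgue_on D) (\<lambda>x. (norm (f x - h x))\<^sup>2)"
  proof (rule Bochner_Integration.integrable_bound)
    show "integrable (lebesgue_on D) (\<lambda>x. 2 * (norm (f x))\<^sup>2 + 2 * (norm (h x))\<^sup>2)"
      using assms by (auto simp: L2_fields_def)
    show "AE x in lebesgue_on D. norm ((norm (f x - h x))\<^sup>2) \<le> norm (2 * (norm (f x))\<^sup>2 + 2 * (norm (h x))\<^sup>2)"
    proof (rule AE_I2)
      fix x
      have "(norm (f x - h x))\<^sup>2 \<le> (norm (f x) + norm (h x))\<^sup>2"
        by (intro power_mono norm_triangle_ineq4) auto
      also have "\<dots> \<le> 2 * (norm (f x))\<^sup>2 + 2 * (norm (h x))\<^sup>2"
        using sum_squares_bound[of "norm (f x)" "norm (h x)"] by (simp add: power2_sum)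
      finally show "norm ((norm (f x - h x))\<^sup>2) \<le> norm (2 * (norm (f x))\<^sup>2 + 2 * (norm (h x))\<^sup>2)"
        by simp
    qed
  qed measurable
  then show ?thesis by (simp add: L2_fields_def)
qed

lemma L2_fields_scaleR:
  assumes "f \<in> L2_fields D"
  shows "(\<lambda>x. c *\<^sub>R f x) \<in> L2_fields D"
  using assms by (auto simp: L2_fields_def power_mult_distrib)

lemma L2_fields_integrable_norm:
  assumes D: "D \<in> lmeasurable" and f: "f \<in> L2_fields D"
  shows "integrable (lebesgue_on D) (\<lambda>x. norm (f x))"
proof (rule Bochner_Integration.integrable_bound)
  interpret finite_measure "lebesgue_on D" using D by (rule finite_measure_lebesgue_on)
  show "integrable (lebesgue_on D) (\<lambda>x. 1 + (norm (f x))\<^sup>2)"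
    using f by (auto simp: L2_fields_def)
  show "AE x in lebesgue_on D. norm (norm (f x)) \<le> norm (1 + (norm (f x))\<^sup>2)"
  proof (rule AE_I2)
    fix x
    show "norm (norm (f x)) \<le> norm (1 + (norm (f x))\<^sup>2)"
    proof -
      have "norm (f x) \<le> 1 + (norm (f x))\<^sup>2"
        using sum_squares_bound[of 1 "norm (f x)"] norm_ge_zero[of "f x"]
        unfolding power_one mult_1_right by linarith
      then show ?thesis by simp
    qed
  qed
qed (use L2_fieldsD(1)[OF f] in measurable)

text \<open>The set is the projection of a closed set along the compact parameter interval. It makes
  the cutoff in \<open>strain\<close> a Borel condition on the pair of points.\<close>

lemma closed_meeting_segments:
  fixes K :: "(real^2) set"
  assumes "closed K"
  shows "closed {z. closed_segment (fst z) (snd z) \<inter> K \<noteq> {}}"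
proof -
  have "closed ((\<lambda>(\<theta>, z). (1 - \<theta>) *\<^sub>R fst z + \<theta> *\<^sub>R snd z) -` K :: (real \<times> (real^2) \<times> (real^2)) set)"
    using assms by (rule closed_vimage) (auto simp: case_prod_beta intro!: continuous_intros)
  from closed_compact_projection[OF compact_Icc[of 0 "1::real"] this]
  show ?thesis
    by (rule back_subst[of closed]) (auto simp: closed_segment_def)
qed

section \<open>Pair forces and pair energies for a bounded potential with bounded Lipschitz
  derivative\<close>

locale bond_model =
  fixes D :: "(real^2) set" and \<epsilon> MJ K1 K2 Kg :: real and J g g1 :: "real \<Rightarrow> real"
  assumes D_lmeasurable: "D \<in> lmeasurable" and eps_pos: "0 < \<epsilon>"
    and influence: "influence_function J MJ"
    and g_deriv: "\<And>r. (g has_real_derivative g1 r) (at r)"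
    and g1_bound: "\<And>r. \<bar>g1 r\<bar> \<le> K1"
    and g1_Lipschitz: "\<And>r s. \<bar>g1 r - g1 s\<bar> \<le> K2 * \<bar>r - s\<bar>"
    and g1_0: "g1 0 = 0" and g_bound: "\<And>r. \<bar>g r\<bar> \<le> Kg"
begin

sublocale M: finite_measure "lebesgue_on D"
  by (rule finite_measure_lebesgue_on[OF D_lmeasurable])

sublocale MM: pair_sigma_finite "lebesgue_on D" "lebesgue_on D" ..

sublocale MM: finite_measure "lebesgue_on D \<Otimes>\<^sub>M lebesgue_on D"
  by (rule finite_measure_pair_measure) unfold_locales

definition normalization :: real where
  "normalization = \<epsilon>^3 * measure lebesgue (ball (0::real^2) 1)"

lemma normalization_pos: "0 < normalization"
  unfolding normalization_def using eps_pos by (intro mult_pos_pos) (auto simp: content_ball_pos)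

lemma J_bounds:
  assumes "0 \<le> r"
  shows "0 \<le> J (r / \<epsilon>)" "J (r / \<epsilon>) \<le> MJ" "\<epsilon> \<le> r \<Longrightarrow> J (r / \<epsilon>) = 0"
proof -
  have J: "\<And>r. 1 \<le> r \<Longrightarrow> J r = 0" "\<And>r. 0 \<le> r \<Longrightarrow> r < 1 \<Longrightarrow> 0 \<le> J r \<and> J r \<le> MJ"
    using influence by (auto simp: influence_function_def)
  have "0 \<le> r / \<epsilon>" using assms eps_pos by simp
  moreover have "0 \<le> MJ" using J(2)[of 0] by simp
  ultimately show "0 \<le> J (r / \<epsilon>)" "J (r / \<epsilon>) \<le> MJ"
    using J by (metis linorder_not_less order_refl)+
  show "J (r / \<epsilon>) = 0" if "\<epsilon> \<le> r" using that J(1) eps_pos by simp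
qed

lemma MJ_nonneg: "0 \<le> MJ" using J_bounds[of 0] by simp

lemma K1_nonneg: "0 \<le> K1" using g1_bound[of 0] by simp

lemma K2_nonneg: "0 \<le> K2" using g1_Lipschitz[of 1 0] by (simp add: order_trans[OF abs_ge_zero])

lemma bond_force_eq:
  "bond_force \<epsilon> J g y x s =
     J (norm (y - x) / \<epsilon>) / (normalization * norm (y - x)) *
       (sqrt (norm (y - x)) * g1 (sqrt (norm (y - x)) * s))"
proof -
  have "(bond_energy \<epsilon> J g y x has_real_derivative
     J (norm (y - x) / \<epsilon>) / (normalization * norm (y - x)) *
       (g1 (sqrt (norm (y - x)) * s) * sqrt (norm (y - x)))) (at s)"
    unfolding bond_energy_def[abs_def] normalization_def
    by (intro DERIV_cmult DERIV_chain2[OF g_deriv]) (auto intro!: derivative_eq_intros)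
  then show ?thesis unfolding bond_force_def by (simp add: DERIV_imp_deriv mult.commute)
qed

text \<open>Without the factor 2 of \<open>internal_force\<close> this is the derivative of
  \<open>pair_energy\<close>: the weight \<open>norm (y - x)\<close> of the energy cancels the
  division by the length in the strain, so the first-order change along \<open>\<phi>\<close> is
  \<open>pair_force f x y \<bullet> (\<phi> y - \<phi> x)\<close>.\<close>

definition pair_force :: "(real^2 \<Rightarrow> real^2) \<Rightarrow> real^2 \<Rightarrow> real^2 \<Rightarrow> real^2" where
  "pair_force f x y = bond_force \<epsilon> J g y x (strain D y x f) *\<^sub>R bond_dir y x"

definition pair_energy :: "(real^2 \<Rightarrow> real^2) \<Rightarrow> real^2 \<Rightarrow> real^2 \<Rightarrow> real" where
  "pair_energy f x y = norm (y - x) * bond_energy \<epsilon> J g y x (strain D y x f)"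

lemma pair_force_outside: "\<epsilon> \<le> norm (y - x) \<Longrightarrow> pair_force f x y = 0"
  by (simp add: pair_force_def bond_force_eq J_bounds)

lemma pair_energy_outside: "\<epsilon> \<le> norm (y - x) \<Longrightarrow> pair_energy f x y = 0"
  by (simp add: pair_energy_def bond_energy_def J_bounds)

lemma strain_sym: "strain D y x f = strain D x y f"
proof -
  have "((f y - f x) /\<^sub>R norm (y - x)) \<bullet> bond_dir y x = ((f x - f y) /\<^sub>R norm (x - y)) \<bullet> bond_dir x y"
    by (simp add: bond_dir_def norm_minus_commute inner_diff_left inner_diff_right algebra_simps)
  then show ?thesis by (simp add: strain_def closed_segment_commute)
qed

lemma pair_force_antisym: "pair_force f y x = - pair_force f x y"
proof -
  have "bond_dir x y = - bond_dir y x"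
    by (simp add: bond_dir_def norm_minus_commute scaleR_minus_right[symmetric] del: scaleR_minus_right)
  then show ?thesis
    unfolding pair_force_def strain_sym[of x y] by (simp add: bond_force_eq norm_minus_commute)
qed

lemma norm_bond_dir: "norm (bond_dir y x) \<le> 1"
  by (cases "y = x") (simp_all add: bond_dir_def)

text \<open>The force is of order \<open>1 / sqrt r\<close> in the bond length \<open>r\<close>; the
  step \<open>sqrt r \<le> sqrt \<epsilon>\<close> trades the half power for the kernel
  \<open>1 / r\<close>, which the energy remainder requires in any case.\<close>

lemma pair_force_bound:
  "norm (pair_force f x y) \<le> MJ * K1 * sqrt \<epsilon> / normalization * inverse_distance \<epsilon> x y"
proof (cases "norm (y - x) < \<epsilon> \<and> y \<noteq> x")
  case True
  define r where "r = norm (y - x)"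
  have r: "0 < r" "r < \<epsilon>" using True by (auto simp: r_def)
  let ?b = "bond_force \<epsilon> J g y x (strain D y x f)"
  have "norm (pair_force f x y) \<le> \<bar>?b\<bar> * 1"
    unfolding pair_force_def norm_scaleR by (intro mult_left_mono norm_bond_dir) simp
  also have "\<bar>?b\<bar> = J (r / \<epsilon>) * sqrt r * \<bar>g1 (sqrt r * strain D y x f)\<bar> / (normalization * r)"
    unfolding bond_force_eq r_def[symmetric] using r J_bounds[of r] normalization_pos
    by (simp add: abs_mult abs_divide)
  also have "\<dots> \<le> MJ * sqrt \<epsilon> * K1 / (normalization * r)"
    using r J_bounds[of r] normalization_pos MJ_nonneg eps_pos g1_bound
    by (intro divide_right_mono mult_mono) auto
  finally show ?thesis using True by (simp add: inverse_distance_def r_def ac_simps)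
next
  case False
  then show ?thesis
    by (auto simp: inverse_distance_def pair_force_outside) (simp add: pair_force_def bond_dir_def)
qed

text \<open>The weight \<open>norm (y - x)\<close> removes the singular factor of
  \<open>bond_energy\<close>, so the energies of pairs are bounded without any kernel.\<close>

lemma pair_energy_bound: "\<bar>pair_energy f x y\<bar> \<le> MJ * Kg / normalization"
proof -
  have "pair_energy f x y = (if y = x then 0 else J (norm (y - x) / \<epsilon>) * g (sqrt (norm (y - x)) * strain D y x f) / normalization)"
    by (simp add: pair_energy_def bond_energy_def normalization_def)
  moreover have "0 \<le> Kg" using g_bound[of 0] by simp
  ultimately show ?thesis
    using J_bounds[of "norm (y - x)"] g_bound[of "sqrt (norm (y - x)) * strain D y x f"] MJ_nonneg normalization_pos
    by (auto simp: abs_mult abs_divide intro!: divide_right_mono mult_mono)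
qed

text \<open>Mean value bound for \<open>g z - g1 s * z\<close> between \<open>s\<close> and
  \<open>r\<close>, whose derivative is at most \<open>K2 * \<bar>r - s\<bar>\<close> there; hence
  the constant \<open>K2\<close> and not half of it.\<close>

lemma g_Taylor: "\<bar>g r - g s - g1 s * (r - s)\<bar> \<le> K2 * (r - s)\<^sup>2"
proof -
  define G where "G z = g z - g1 s * z" for z
  have G: "(G has_field_derivative (g1 z - g1 s)) (at z within closed_segment s r)" for z
    unfolding G_def by (rule has_field_derivative_at_within) (auto intro!: derivative_eq_intros g_deriv)
  have "norm (G r - G s) \<le> (K2 * \<bar>r - s\<bar>) * norm (r - s)"
  proof (rule field_differentiable_bound[OF convex_closed_segment G])
    fix z assume z: "z \<in> closed_segment s r"
    have "\<bar>g1 z - g1 s\<bar> \<le> K2 * \<bar>z - s\<bar>" by (rule g1_Lipschitz)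
    also have "\<dots> \<le> K2 * \<bar>r - s\<bar>"
      using z K2_nonneg by (intro mult_left_mono) (auto simp: closed_segment_eq_real_ivl split: if_splits)
    finally show "norm (g1 z - g1 s) \<le> K2 * \<bar>r - s\<bar>" by simp
  qed auto
  then show ?thesis
    by (simp add: G_def algebra_simps power2_eq_square flip: abs_mult)
qed

text \<open>\<open>2 * K2\<close> bounds the Taylor remainder, the 2 coming from the square of a sum
  of two norms; \<open>K1 * sqrt \<epsilon>\<close> bounds the derivative on the part of the
  increment that the prediction misses.\<close>

definition energy_const :: real where
  "energy_const = MJ / normalization * (2 * K2 + K1 * sqrt \<epsilon>)"

lemma energy_const_nonneg: "0 \<le> energy_const"
  unfolding energy_const_def using MJ_nonneg K1_nonneg K2_nonneg normalization_pos eps_pos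
  by (intro mult_nonneg_nonneg add_nonneg_nonneg divide_nonneg_pos) auto

text \<open>Here \<open>\<phi>\<close> is a predicted increment. The error has a part quadratic in
  the true increment, from Taylor's formula, and a part linear in the mismatch
  \<open>f1 - f0 - \<phi>\<close>, since \<open>g1\<close> is bounded. Writing the right side as a
  sum over the two end points prepares \<open>weighted_kernel_integral\<close>.\<close>

lemma pair_energy_linearization:
  "\<bar>pair_energy f1 x y - pair_energy f0 x y - pair_force f0 x y \<bullet> (\<phi> y - \<phi> x)\<bar>
     \<le> energy_const * (inverse_distance \<epsilon> x y *
         (((norm (f1 x - f0 x))\<^sup>2 + norm (f1 x - f0 x - \<phi> x)) + ((norm (f1 y - f0 y))\<^sup>2 + norm (f1 y - f0 y - \<phi> y))))"
    (is "?lhs \<le> ?rhs")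
proof -
  have rhs: "0 \<le> ?rhs" using energy_const_nonneg by simp
  define r where "r = norm (y - x)"
  consider "y = x" | "\<epsilon> \<le> r" | "closed_segment x y \<inter> frontier D \<noteq> {}"
    | "y \<noteq> x" "r < \<epsilon>" "closed_segment x y \<inter> frontier D = {}" by (fastforce simp: r_def)
  then show ?thesis
  proof cases
    case 1
    then have "?lhs = 0" by (simp add: pair_energy_def pair_force_def bond_dir_def)
    then show ?thesis using rhs by simp
  next
    case 2
    then have "?lhs = 0" by (simp add: r_def pair_energy_outside pair_force_outside)
    then show ?thesis using rhs by simp
  next
    case 3
    then have "?lhs = 0"
      by (simp add: pair_energy_def pair_force_def strain_def bond_force_eq g1_0)
    then show ?thesis using rhs by simp
  next
    case 4
    have r: "0 < r" "r < \<epsilon>" using 4 by (auto simp: r_def)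
    define e where "e = bond_dir y x"
    define \<delta>x \<delta>y \<zeta>x \<zeta>y where d: "\<delta>x = f1 x - f0 x" "\<delta>y = f1 y - f0 y" "\<zeta>x = f1 x - f0 x - \<phi> x" "\<zeta>y = f1 y - f0 y - \<phi> y"
    \<comment> \<open>The arguments that \<open>g\<close> receives for \<open>f1\<close> and
      \<open>f0\<close>, and the predicted change of this argument. Each carries
      \<open>sqrt r / r\<close>, so a square leaves the factor \<open>1 / r\<close>.\<close>
    define A B Q where "A = sqrt r * (((f1 y - f1 x) \<bullet> e) / r)" and "B = sqrt r * (((f0 y - f0 x) \<bullet> e) / r)"
      and "Q = sqrt r * (((\<phi> y - \<phi> x) \<bullet> e) / r)"
    have str: "strain D y x f = ((f y - f x) \<bullet> e) / r" for f
      using 4 by (simp add: strain_def e_def r_def divide_inverse mult.commute)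
    have en: "pair_energy f1 x y = J (r / \<epsilon>) / normalization * g A" "pair_energy f0 x y = J (r / \<epsilon>) / normalization * g B"
      using r by (simp_all add: pair_energy_def bond_energy_def normalization_def A_def B_def str r_def[symmetric])
    have fo: "pair_force f0 x y \<bullet> (\<phi> y - \<phi> x) = J (r / \<epsilon>) / normalization * (g1 B * Q)"
      using r by (simp add: pair_force_def bond_force_eq str B_def Q_def e_def[symmetric] r_def[symmetric] inner_commute)
    have ip: "\<bar>(a - b) \<bullet> e\<bar> \<le> norm a + norm b" for a b
    proof -
      have "\<bar>(a - b) \<bullet> e\<bar> \<le> norm (a - b) * norm e" by (rule Cauchy_Schwarz_ineq2)
      also have "\<dots> \<le> norm (a - b) * 1" using norm_bond_dir by (intro mult_left_mono) (auto simp: e_def)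
      also have "\<dots> \<le> norm a + norm b" using norm_triangle_ineq4 by simp
      finally show ?thesis .
    qed
    have sr: "sqrt r * sqrt r = r" using r by simp
    have AB: "A - B = sqrt r * (((\<delta>y - \<delta>x) \<bullet> e) / r)"
      by (simp add: A_def B_def d algebra_simps inner_diff_left diff_divide_distrib add_divide_distrib)
    have ABQ: "A - B - Q = sqrt r * (((\<zeta>y - \<zeta>x) \<bullet> e) / r)"
      by (simp add: A_def B_def Q_def d algebra_simps inner_diff_left diff_divide_distrib add_divide_distrib)
    have "(A - B)\<^sup>2 = ((\<delta>y - \<delta>x) \<bullet> e)\<^sup>2 / r"
      unfolding AB using r sr by (simp add: power2_eq_square field_simps)
    also have "\<dots> \<le> (norm \<delta>y + norm \<delta>x)\<^sup>2 / r"
      using r ip[of \<delta>y \<delta>x] by (intro divide_right_mono) (auto simp: abs_le_square_iff[symmetric])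
    also have "\<dots> \<le> 2 * ((norm \<delta>x)\<^sup>2 + (norm \<delta>y)\<^sup>2) / r"
      using r sum_squares_bound[of "norm \<delta>y" "norm \<delta>x"] by (intro divide_right_mono) (auto simp: power2_sum)
    finally have b1: "(A - B)\<^sup>2 \<le> 2 * ((norm \<delta>x)\<^sup>2 + (norm \<delta>y)\<^sup>2) / r" .
    have "\<bar>A - B - Q\<bar> = sqrt r * (\<bar>(\<zeta>y - \<zeta>x) \<bullet> e\<bar> / r)"
      unfolding ABQ using r by (simp add: abs_mult)
    also have "\<dots> \<le> sqrt \<epsilon> * ((norm \<zeta>x + norm \<zeta>y) / r)"
      using r ip[of \<zeta>y \<zeta>x] by (intro mult_mono divide_right_mono) auto
    finally have b2: "\<bar>A - B - Q\<bar> \<le> sqrt \<epsilon> * ((norm \<zeta>x + norm \<zeta>y) / r)" .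
    \<comment> \<open>The first bracket is a Taylor remainder, the second tests the derivative at
      \<open>B\<close> on the mismatch.\<close>
    have "g A - g B - g1 B * Q = (g A - g B - g1 B * (A - B)) + g1 B * (A - B - Q)"
      by (simp add: algebra_simps)
    also have "\<bar>\<dots>\<bar> \<le> K2 * (A - B)\<^sup>2 + K1 * \<bar>A - B - Q\<bar>"
      using g_Taylor[of A B] g1_bound[of B]
      by (intro order_trans[OF abs_triangle_ineq] add_mono) (auto simp: abs_mult intro: mult_right_mono)
    also have "\<dots> \<le> K2 * (2 * ((norm \<delta>x)\<^sup>2 + (norm \<delta>y)\<^sup>2) / r) + K1 * (sqrt \<epsilon> * ((norm \<zeta>x + norm \<zeta>y) / r))"
      using b1 b2 K1_nonneg K2_nonneg by (intro add_mono mult_left_mono) auto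
    also have "\<dots> = (2 * K2 * ((norm \<delta>x)\<^sup>2 + (norm \<delta>y)\<^sup>2) + K1 * sqrt \<epsilon> * (norm \<zeta>x + norm \<zeta>y)) / r"
      by (simp add: add_divide_distrib distrib_left ac_simps)
    also have "\<dots> \<le> (2 * K2 + K1 * sqrt \<epsilon>) * (((norm \<delta>x)\<^sup>2 + norm \<zeta>x) + ((norm \<delta>y)\<^sup>2 + norm \<zeta>y)) / r"
    proof (rule divide_right_mono)
      have "0 \<le> 2 * K2 * (norm \<zeta>x + norm \<zeta>y)" "0 \<le> K1 * sqrt \<epsilon> * ((norm \<delta>x)\<^sup>2 + (norm \<delta>y)\<^sup>2)"
        using K1_nonneg K2_nonneg eps_pos by auto
      then show "2 * K2 * ((norm \<delta>x)\<^sup>2 + (norm \<delta>y)\<^sup>2) + K1 * sqrt \<epsilon> * (norm \<zeta>x + norm \<zeta>y)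
          \<le> (2 * K2 + K1 * sqrt \<epsilon>) * (((norm \<delta>x)\<^sup>2 + norm \<zeta>x) + ((norm \<delta>y)\<^sup>2 + norm \<zeta>y))"
        by (simp add: algebra_simps)
    qed (use r in simp)
    finally have main: "\<bar>g A - g B - g1 B * Q\<bar> \<le> (2 * K2 + K1 * sqrt \<epsilon>) * (((norm \<delta>x)\<^sup>2 + norm \<zeta>x) + ((norm \<delta>y)\<^sup>2 + norm \<zeta>y)) / r" .
    have "?lhs = \<bar>J (r / \<epsilon>) / normalization * (g A - g B - g1 B * Q)\<bar>"
      unfolding en fo by (simp only: right_diff_distrib)
    also have "\<dots> = J (r / \<epsilon>) / normalization * \<bar>g A - g B - g1 B * Q\<bar>"
      using r J_bounds[of r] normalization_pos by (simp add: abs_mult)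
    also have "\<dots> \<le> MJ / normalization * ((2 * K2 + K1 * sqrt \<epsilon>) * (((norm \<delta>x)\<^sup>2 + norm \<zeta>x) + ((norm \<delta>y)\<^sup>2 + norm \<zeta>y)) / r)"
      using main r J_bounds[of r] normalization_pos MJ_nonneg by (intro mult_mono divide_right_mono) auto
    also have "\<dots> = ?rhs"
      using 4 r by (simp add: energy_const_def inverse_distance_def d r_def)
    finally show ?thesis .
  qed
qed

end

section \<open>Double integrals over pairs of points of the body\<close>

context bond_model begin

lemma M_borel_id [measurable]: "(\<lambda>x. x) \<in> borel_measurable (lebesgue_on D)"
  by (intro measurable_restrict_space1 measurable_completion) simp

lemma fst_borel [measurable]: "fst \<in> borel_measurable (lebesgue_on D \<Otimes>\<^sub>M lebesgue_on D)"
  by (rule measurable_compose[OF measurable_fst M_borel_id])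

lemma snd_borel [measurable]: "snd \<in> borel_measurable (lebesgue_on D \<Otimes>\<^sub>M lebesgue_on D)"
  by (rule measurable_compose[OF measurable_snd M_borel_id])

lemma J_measurable [measurable]: "J \<in> borel_measurable borel"
  using influence by (simp add: influence_function_def)

lemma g_measurable [measurable]: "g \<in> borel_measurable borel"
  by (intro borel_measurable_continuous_onI continuous_at_imp_continuous_on ballI DERIV_isCont[OF g_deriv])

lemma g1_measurable [measurable]: "g1 \<in> borel_measurable borel"
proof (rule borel_measurable_continuous_onI)
  have "K2-lipschitz_on UNIV g1"
    using g1_Lipschitz K2_nonneg by (intro lipschitz_onI) (auto simp: dist_real_def)
  then show "continuous_on UNIV g1" by (rule lipschitz_on_continuous_on)
qed

lemma strain_measurable [measurable]:
  assumes [measurable]: "f \<in> borel_measurable (lebesgue_on D)"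
  shows "(\<lambda>z. strain D (snd z) (fst z) f) \<in> borel_measurable (lebesgue_on D \<Otimes>\<^sub>M lebesgue_on D)"
proof -
  define S :: "((real^2) \<times> (real^2)) set" where "S = {z. closed_segment (fst z) (snd z) \<inter> frontier D \<noteq> {}}"
  have S: "S \<in> sets borel" unfolding S_def by (intro borel_closed closed_meeting_segments) simp
  have id2: "(\<lambda>z. z) \<in> borel_measurable (lebesgue_on D \<Otimes>\<^sub>M lebesgue_on D)"
    using borel_measurable_Pair[OF fst_borel snd_borel] by simp
  have "Measurable.pred (lebesgue_on D \<Otimes>\<^sub>M lebesgue_on D) (\<lambda>z. z \<in> S)"
    by (rule measurable_compose[OF id2]) (use S in \<open>simp add: pred_def\<close>)
  moreover have "(\<lambda>z. ((f (snd z) - f (fst z)) /\<^sub>R norm (snd z - fst z)) \<bullet> ((snd z - fst z) /\<^sub>R norm (snd z - fst z)))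
      \<in> borel_measurable (lebesgue_on D \<Otimes>\<^sub>M lebesgue_on D)"
    by measurable
  ultimately have "(\<lambda>z. if z \<in> S then 0 else
       ((f (snd z) - f (fst z)) /\<^sub>R norm (snd z - fst z)) \<bullet> ((snd z - fst z) /\<^sub>R norm (snd z - fst z)))
      \<in> borel_measurable (lebesgue_on D \<Otimes>\<^sub>M lebesgue_on D)"
    by (intro measurable_If borel_measurable_const predE)
  then show ?thesis
    by (simp only: strain_def S_def bond_dir_def mem_Collect_eq)
qed

lemma pair_force_measurable [measurable]:
  assumes [measurable]: "f \<in> borel_measurable (lebesgue_on D)"
  shows "(\<lambda>z. pair_force f (fst z) (snd z)) \<in> borel_measurable (lebesgue_on D \<Otimes>\<^sub>M lebesgue_on D)"
  unfolding pair_force_def bond_force_eq bond_dir_def by measurable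

lemma pair_energy_measurable [measurable]:
  assumes [measurable]: "f \<in> borel_measurable (lebesgue_on D)"
  shows "(\<lambda>z. pair_energy f (fst z) (snd z)) \<in> borel_measurable (lebesgue_on D \<Otimes>\<^sub>M lebesgue_on D)"
  unfolding pair_energy_def bond_energy_def by measurable

lemma inverse_distance_measurable [measurable]:
  "(\<lambda>z. inverse_distance r (fst z) (snd z)) \<in> borel_measurable (lebesgue_on D \<Otimes>\<^sub>M lebesgue_on D)"
  unfolding inverse_distance_def by measurable

lemma section_measurable:
  assumes "(\<lambda>z. F (fst z) (snd z)) \<in> borel_measurable (lebesgue_on D \<Otimes>\<^sub>M lebesgue_on D)" "x \<in> D"
  shows "F x \<in> borel_measurable (lebesgue_on D)"
  using measurable_compose[OF measurable_Pair1' assms(1), of x] assms(2) by simp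

definition kernel_const :: real where
  "kernel_const = (SOME C. 0 \<le> C \<and> (\<forall>x. (\<integral>\<^sup>+y. ennreal (inverse_distance \<epsilon> x y) \<partial>lebesgue_on D) \<le> ennreal C))"

lemma kernel_const:
  "0 \<le> kernel_const"
  "(\<integral>\<^sup>+y. ennreal (inverse_distance \<epsilon> x y) \<partial>lebesgue_on D) \<le> ennreal kernel_const"
proof -
  obtain C where C: "0 \<le> C" "\<And>x. (\<integral>\<^sup>+y. ennreal (inverse_distance \<epsilon> x y) \<partial>lborel) \<le> ennreal C"
    using nn_integral_inverse_distance_bounded[OF eps_pos] by blast
  have "(\<integral>\<^sup>+y. ennreal (inverse_distance \<epsilon> x y) \<partial>lebesgue_on D) \<le> ennreal C" for x
  proof -
    have "(\<integral>\<^sup>+y. ennreal (inverse_distance \<epsilon> x y) \<partial>lebesgue_on D) =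
        (\<integral>\<^sup>+y. ennreal (inverse_distance \<epsilon> x y) * indicator D y \<partial>lebesgue)"
      using D_lmeasurable by (subst nn_integral_restrict_space) auto
    also have "\<dots> \<le> (\<integral>\<^sup>+y. ennreal (inverse_distance \<epsilon> x y) \<partial>lebesgue)"
      by (intro nn_integral_mono) (auto simp: indicator_def)
    also have "\<dots> = (\<integral>\<^sup>+y. ennreal (inverse_distance \<epsilon> x y) \<partial>lborel)"
      by (rule nn_integral_completion)
    finally show ?thesis using C(2)[of x] by simp
  qed
  then have "\<exists>C. 0 \<le> C \<and> (\<forall>x. (\<integral>\<^sup>+y. ennreal (inverse_distance \<epsilon> x y) \<partial>lebesgue_on D) \<le> ennreal C)"
    using C(1) by blast
  from someI_ex[OF this] show "0 \<le> kernel_const"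
    "(\<integral>\<^sup>+y. ennreal (inverse_distance \<epsilon> x y) \<partial>lebesgue_on D) \<le> ennreal kernel_const"
    unfolding kernel_const_def by auto
qed

lemma inverse_distance_integrable:
  assumes "x \<in> D"
  shows "integrable (lebesgue_on D) (inverse_distance \<epsilon> x)"
proof -
  have [measurable]: "inverse_distance \<epsilon> x \<in> borel_measurable (lebesgue_on D)"
    by (rule section_measurable[OF inverse_distance_measurable assms])
  have "(\<integral>\<^sup>+y. ennreal (norm (inverse_distance \<epsilon> x y)) \<partial>lebesgue_on D) < \<infinity>"
    using kernel_const(2)[of x] by (simp add: le_less_trans)
  then show ?thesis by (intro integrableI_bounded) auto
qed

text \<open>By Tonelli's theorem each term costs one integral of the kernel, which is at most
  \<open>kernel_const\<close> whichever point is held fixed, because the kernel is symmetric. The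
  two end points give the factor 2.\<close>

lemma weighted_kernel_integral:
  assumes h: "integrable (lebesgue_on D) h" and h0: "\<And>x. 0 \<le> h x"
  shows "integrable (lebesgue_on D \<Otimes>\<^sub>M lebesgue_on D)
           (\<lambda>z. inverse_distance \<epsilon> (fst z) (snd z) * (h (fst z) + h (snd z)))" (is "integrable ?MM ?F")
    and "(LINT z|(lebesgue_on D \<Otimes>\<^sub>M lebesgue_on D). inverse_distance \<epsilon> (fst z) (snd z) * (h (fst z) + h (snd z)))
           \<le> 2 * kernel_const * (LINT x|lebesgue_on D. h x)"
proof -
  note [measurable] = borel_measurable_integrable[OF h]
  let ?I = "LINT x|lebesgue_on D. h x"
  have hI: "(\<integral>\<^sup>+x. ennreal (h x) \<partial>lebesgue_on D) = ennreal ?I"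
    by (rule nn_integral_eq_integral[OF h]) (simp add: h0)
  have I0: "0 \<le> ?I" by (intro Bochner_Integration.integral_nonneg h0)
  have 1: "(\<integral>\<^sup>+z. ennreal (inverse_distance \<epsilon> (fst z) (snd z) * h (fst z)) \<partial>?MM) \<le> ennreal (kernel_const * ?I)"
  proof -
    have "(\<integral>\<^sup>+z. ennreal (inverse_distance \<epsilon> (fst z) (snd z) * h (fst z)) \<partial>?MM) =
      (\<integral>\<^sup>+x. (\<integral>\<^sup>+y. ennreal (inverse_distance \<epsilon> x y * h x) \<partial>lebesgue_on D) \<partial>lebesgue_on D)"
      by (subst M.nn_integral_fst[symmetric]) auto
    also have "\<dots> \<le> (\<integral>\<^sup>+x. ennreal kernel_const * ennreal (h x) \<partial>lebesgue_on D)"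
    proof (rule nn_integral_mono)
      fix x assume "x \<in> space (lebesgue_on D)"
      then have [measurable]: "inverse_distance \<epsilon> x \<in> borel_measurable (lebesgue_on D)"
        by (intro section_measurable[OF inverse_distance_measurable]) simp
      have "(\<integral>\<^sup>+y. ennreal (inverse_distance \<epsilon> x y * h x) \<partial>lebesgue_on D) =
        (\<integral>\<^sup>+y. ennreal (inverse_distance \<epsilon> x y) \<partial>lebesgue_on D) * ennreal (h x)"
        by (simp add: ennreal_mult h0 nn_integral_multc)
      also have "\<dots> \<le> ennreal kernel_const * ennreal (h x)"
        by (intro mult_right_mono kernel_const) simp
      finally show "(\<integral>\<^sup>+y. ennreal (inverse_distance \<epsilon> x y * h x) \<partial>lebesgue_on D) \<le> ennreal kernel_const * ennreal (h x)" .
    qed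
    also have "\<dots> = ennreal (kernel_const * ?I)"
      by (subst nn_integral_cmult) (auto simp: hI ennreal_mult kernel_const I0)
    finally show ?thesis .
  qed
  have 2: "(\<integral>\<^sup>+z. ennreal (inverse_distance \<epsilon> (fst z) (snd z) * h (snd z)) \<partial>?MM) \<le> ennreal (kernel_const * ?I)"
  proof -
    have "(\<integral>\<^sup>+z. ennreal (inverse_distance \<epsilon> (fst z) (snd z) * h (snd z)) \<partial>?MM) =
      (\<integral>\<^sup>+y. (\<integral>\<^sup>+x. ennreal (inverse_distance \<epsilon> x y * h y) \<partial>lebesgue_on D) \<partial>lebesgue_on D)"
      by (subst MM.nn_integral_snd[symmetric]) auto
    also have "\<dots> = (\<integral>\<^sup>+x. (\<integral>\<^sup>+y. ennreal (inverse_distance \<epsilon> x y * h x) \<partial>lebesgue_on D) \<partial>lebesgue_on D)"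
      by (subst inverse_distance_sym) simp
    also have "\<dots> = (\<integral>\<^sup>+z. ennreal (inverse_distance \<epsilon> (fst z) (snd z) * h (fst z)) \<partial>?MM)"
      by (subst M.nn_integral_fst[symmetric]) auto
    finally show ?thesis using 1 by simp
  qed
  have "(\<integral>\<^sup>+z. ennreal (?F z) \<partial>?MM) =
      (\<integral>\<^sup>+z. ennreal (inverse_distance \<epsilon> (fst z) (snd z) * h (fst z)) + ennreal (inverse_distance \<epsilon> (fst z) (snd z) * h (snd z)) \<partial>?MM)"
    by (intro nn_integral_cong) (simp add: distrib_left ennreal_plus h0)
  also have "\<dots> = (\<integral>\<^sup>+z. ennreal (inverse_distance \<epsilon> (fst z) (snd z) * h (fst z)) \<partial>?MM) +
      (\<integral>\<^sup>+z. ennreal (inverse_distance \<epsilon> (fst z) (snd z) * h (snd z)) \<partial>?MM)"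
    by (rule nn_integral_add) auto
  also have "\<dots> \<le> ennreal (kernel_const * ?I) + ennreal (kernel_const * ?I)"
    using 1 2 by (rule add_mono)
  also have "\<dots> = ennreal (2 * kernel_const * ?I)"
    using kernel_const(1) I0 by (simp add: ennreal_plus[symmetric] del: ennreal_plus)
  finally have 3: "(\<integral>\<^sup>+z. ennreal (?F z) \<partial>?MM) \<le> ennreal (2 * kernel_const * ?I)" .
  have F0: "0 \<le> ?F z" for z using h0 by simp
  show int: "integrable ?MM ?F"
  proof (rule integrableI_bounded)
    show "(\<integral>\<^sup>+z. ennreal (norm (?F z)) \<partial>?MM) < \<infinity>"
      using 3 F0 by (simp add: le_less_trans)
  qed measurable
  show "integral\<^sup>L ?MM ?F \<le> 2 * kernel_const * ?I"
    using 3 nn_integral_eq_integral[OF int] F0 kernel_const(1) I0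
    by (simp add: ennreal_le_iff)
qed

lemma stored_density_eq:
  "stored_density D \<epsilon> J g f x = (LINT y|lebesgue_on D. pair_energy f x y)"
proof -
  have "stored_density D \<epsilon> J g f x = (LINT y|lebesgue. indicator D y *\<^sub>R pair_energy f x y)"
    unfolding stored_density_def set_lebesgue_integral_def
  proof (rule Bochner_Integration.integral_cong[OF refl])
    fix y
    show "indicator (ball x \<epsilon> \<inter> D) y *\<^sub>R (norm (y - x) * bond_energy \<epsilon> J g y x (strain D y x f)) = indicator D y *\<^sub>R pair_energy f x y"
      using pair_energy_outside[where x=x and y=y and f=f]
      by (cases "norm (y - x) < \<epsilon>") (auto simp: pair_energy_def indicator_def dist_norm norm_minus_commute)
  qed
  then show ?thesis using D_lmeasurable by (subst integral_restrict_space) auto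
qed

lemma internal_force_eq:
  "internal_force D \<epsilon> J g f x = 2 *\<^sub>R (LINT y|lebesgue_on D. pair_force f x y)"
proof -
  have "internal_force D \<epsilon> J g f x = (LINT y|lebesgue. 2 *\<^sub>R (indicator D y *\<^sub>R pair_force f x y))"
    unfolding internal_force_def set_lebesgue_integral_def
  proof (rule Bochner_Integration.integral_cong[OF refl])
    fix y
    show "indicator (ball x \<epsilon> \<inter> D) y *\<^sub>R (2 * bond_force \<epsilon> J g y x (strain D y x f)) *\<^sub>R bond_dir y x = 2 *\<^sub>R (indicator D y *\<^sub>R pair_force f x y)"
      using pair_force_outside[where x=x and y=y and f=f]
      by (cases "norm (y - x) < \<epsilon>") (auto simp: pair_force_def indicator_def dist_norm norm_minus_commute)
  qed
  also have "\<dots> = 2 *\<^sub>R (LINT y|lebesgue. indicator D y *\<^sub>R pair_force f x y)"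
    by (rule integral_scaleR_right)
  finally show ?thesis using D_lmeasurable by (subst integral_restrict_space) auto
qed

text \<open>First variation of \<open>stored_density\<close> at \<open>f\<close> in the direction
  \<open>\<phi>\<close>. Only bonds issuing from \<open>x\<close> occur, and \<open>\<phi> y\<close>
  stays inside the integral, so pointwise it is not the work of the internal force at
  \<open>x\<close>.\<close>

definition energy_variation :: "(real^2 \<Rightarrow> real^2) \<Rightarrow> (real^2 \<Rightarrow> real^2) \<Rightarrow> real^2 \<Rightarrow> real" where
  "energy_variation f \<phi> x = (LINT y|lebesgue_on D. pair_force f x y \<bullet> (\<phi> y - \<phi> x))"

lemma pair_force_section_integrable:
  assumes f: "f \<in> borel_measurable (lebesgue_on D)" and x: "x \<in> D"
  shows "integrable (lebesgue_on D) (pair_force f x)"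
proof (rule Bochner_Integration.integrable_bound)
  show "integrable (lebesgue_on D) (\<lambda>y. MJ * K1 * sqrt \<epsilon> / normalization * inverse_distance \<epsilon> x y)"
    by (intro integrable_mult_right inverse_distance_integrable x)
  show "pair_force f x \<in> borel_measurable (lebesgue_on D)"
    by (rule section_measurable[OF pair_force_measurable[OF f] x])
  show "AE y in lebesgue_on D. norm (pair_force f x y) \<le> norm (MJ * K1 * sqrt \<epsilon> / normalization * inverse_distance \<epsilon> x y)"
    by (intro AE_I2) (use pair_force_bound in \<open>metis abs_ge_self order_trans real_norm_def\<close>)
qed

lemma pair_energy_integrable:
  assumes f: "f \<in> borel_measurable (lebesgue_on D)"
  shows "integrable (lebesgue_on D \<Otimes>\<^sub>M lebesgue_on D) (\<lambda>z. pair_energy f (fst z) (snd z))"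
  using pair_energy_measurable[OF f] pair_energy_bound
  by (intro MM.integrable_const_bound[where B="MJ * Kg / normalization"]) auto

lemma pair_energy_section_integrable:
  assumes f: "f \<in> borel_measurable (lebesgue_on D)" and x: "x \<in> D"
  shows "integrable (lebesgue_on D) (pair_energy f x)"
  using section_measurable[OF pair_energy_measurable[OF f] x] pair_energy_bound
  by (intro M.integrable_const_bound[where B="MJ * Kg / normalization"]) auto

lemma stored_density_integrable:
  assumes "f \<in> borel_measurable (lebesgue_on D)"
  shows "integrable (lebesgue_on D) (stored_density D \<epsilon> J g f)"
  using MM.integrable_fst'[OF pair_energy_integrable[OF assms]]
  by (simp add: stored_density_eq[abs_def])

text \<open>An \<open>L\<^sup>2\<close> field on a set of finite measure is integrable, so the
  kernel estimate applies with the norm of \<open>\<phi>\<close> as weight. The general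
  \<open>G\<close> serves the difference in the variation and the sum in the flux.\<close>

lemma pair_power_integrable:
  assumes f: "f \<in> borel_measurable (lebesgue_on D)" and \<phi>: "\<phi> \<in> L2_fields D"
    and G: "G \<in> borel_measurable (lebesgue_on D \<Otimes>\<^sub>M lebesgue_on D)"
    and le: "\<And>z. norm (G z) \<le> norm (\<phi> (fst z)) + norm (\<phi> (snd z))"
  shows "integrable (lebesgue_on D \<Otimes>\<^sub>M lebesgue_on D) (\<lambda>z. pair_force f (fst z) (snd z) \<bullet> G z)"
proof (rule Bochner_Integration.integrable_bound)
  let ?c = "MJ * K1 * sqrt \<epsilon> / normalization"
  show "integrable (lebesgue_on D \<Otimes>\<^sub>M lebesgue_on D)
      (\<lambda>z. ?c * (inverse_distance \<epsilon> (fst z) (snd z) * (norm (\<phi> (fst z)) + norm (\<phi> (snd z)))))"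
    by (intro integrable_mult_right weighted_kernel_integral L2_fields_integrable_norm D_lmeasurable \<phi>) simp
  show "(\<lambda>z. pair_force f (fst z) (snd z) \<bullet> G z) \<in> borel_measurable (lebesgue_on D \<Otimes>\<^sub>M lebesgue_on D)"
    using pair_force_measurable[OF f] G by measurable
  show "AE z in lebesgue_on D \<Otimes>\<^sub>M lebesgue_on D. norm (pair_force f (fst z) (snd z) \<bullet> G z) \<le>
      norm (?c * (inverse_distance \<epsilon> (fst z) (snd z) * (norm (\<phi> (fst z)) + norm (\<phi> (snd z)))))"
  proof (rule AE_I2)
    fix z
    have "norm (pair_force f (fst z) (snd z) \<bullet> G z) \<le> norm (pair_force f (fst z) (snd z)) * norm (G z)"
      using Cauchy_Schwarz_ineq2 by simp
    also have "\<dots> \<le> (?c * inverse_distance \<epsilon> (fst z) (snd z)) * (norm (\<phi> (fst z)) + norm (\<phi> (snd z)))"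
      by (intro mult_mono pair_force_bound le norm_ge_zero order_trans[OF norm_ge_zero pair_force_bound])
    finally show "norm (pair_force f (fst z) (snd z) \<bullet> G z) \<le>
      norm (?c * (inverse_distance \<epsilon> (fst z) (snd z) * (norm (\<phi> (fst z)) + norm (\<phi> (snd z)))))"
      by (simp only: mult.assoc real_norm_def)
  qed
qed

lemma pair_variation_integrable:
  assumes f: "f \<in> borel_measurable (lebesgue_on D)" and \<phi>: "\<phi> \<in> L2_fields D"
  shows "integrable (lebesgue_on D \<Otimes>\<^sub>M lebesgue_on D)
      (\<lambda>z. pair_force f (fst z) (snd z) \<bullet> (\<phi> (snd z) - \<phi> (fst z)))"
  using L2_fieldsD(1)[OF \<phi>]
  by (intro pair_power_integrable[OF f \<phi>])
     (auto intro: order_trans[OF norm_triangle_ineq4] simp: add.commute)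

lemma energy_variation_integrable:
  assumes "f \<in> borel_measurable (lebesgue_on D)" "\<phi> \<in> L2_fields D"
  shows "integrable (lebesgue_on D) (energy_variation f \<phi>)"
  using MM.integrable_fst'[OF pair_variation_integrable[OF assms]]
  by (simp add: energy_variation_def[abs_def])

text \<open>Integrating the pairwise estimate over \<open>D \<times> D\<close> leaves only integrals
  of the increment and of the mismatch, with constants independent of the fields.\<close>

lemma stored_density_linearization:
  assumes f0: "f0 \<in> L2_fields D" and f1: "f1 \<in> L2_fields D" and \<phi>: "\<phi> \<in> L2_fields D"
  shows "(LINT x|lebesgue_on D. \<bar>stored_density D \<epsilon> J g f1 x - stored_density D \<epsilon> J g f0 x - energy_variation f0 \<phi> x\<bar>)
    \<le> energy_const * (2 * kernel_const * (LINT x|lebesgue_on D. (norm (f1 x - f0 x))\<^sup>2 + norm (f1 x - f0 x - \<phi> x)))"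
proof -
  note m = L2_fieldsD(1)[OF f0] L2_fieldsD(1)[OF f1]
  define h where "h x = (norm (f1 x - f0 x))\<^sup>2 + norm (f1 x - f0 x - \<phi> x)" for x
  define L where "L z = pair_energy f1 (fst z) (snd z) - pair_energy f0 (fst z) (snd z)
      - pair_force f0 (fst z) (snd z) \<bullet> (\<phi> (snd z) - \<phi> (fst z))" for z
  have h: "integrable (lebesgue_on D) h"
    unfolding h_def
    using L2_fieldsD(2)[OF L2_fields_diff[OF f1 f0]]
      L2_fields_integrable_norm[OF D_lmeasurable L2_fields_diff[OF L2_fields_diff[OF f1 f0] \<phi>]]
    by (rule Bochner_Integration.integrable_add)
  have h0: "0 \<le> h x" for x by (simp add: h_def)
  have L: "integrable (lebesgue_on D \<Otimes>\<^sub>M lebesgue_on D) L"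
    unfolding L_def
    by (intro Bochner_Integration.integrable_diff pair_energy_integrable pair_variation_integrable m \<phi>)
  have "(LINT x|lebesgue_on D. \<bar>stored_density D \<epsilon> J g f1 x - stored_density D \<epsilon> J g f0 x - energy_variation f0 \<phi> x\<bar>)
      \<le> (LINT x|lebesgue_on D. LINT y|lebesgue_on D. \<bar>L (x, y)\<bar>)"
  proof (rule integral_mono_AE)
    show "integrable (lebesgue_on D) (\<lambda>x. \<bar>stored_density D \<epsilon> J g f1 x - stored_density D \<epsilon> J g f0 x - energy_variation f0 \<phi> x\<bar>)"
      by (intro integrable_abs Bochner_Integration.integrable_diff stored_density_integrable energy_variation_integrable m \<phi>)
    show "integrable (lebesgue_on D) (\<lambda>x. LINT y|lebesgue_on D. \<bar>L (x, y)\<bar>)"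
      by (rule MM.integrable_fst'[OF integrable_abs[OF L]])
    show "AE x in lebesgue_on D. \<bar>stored_density D \<epsilon> J g f1 x - stored_density D \<epsilon> J g f0 x - energy_variation f0 \<phi> x\<bar>
        \<le> (LINT y|lebesgue_on D. \<bar>L (x, y)\<bar>)"
      \<comment> \<open>\<open>\<phi>\<close> may be unbounded, so the section of the variation is
        known to be integrable only for almost every \<open>x\<close>, whereas pair energies are
        bounded and integrable for every \<open>x\<close> in \<open>D\<close>.\<close>
      using MM.AE_integrable_fst'[OF pair_variation_integrable[OF m(1) \<phi>]] AE_space
    proof eventually_elim
      case (elim x)
      then have x: "x \<in> D" by simp
      have "stored_density D \<epsilon> J g f1 x - stored_density D \<epsilon> J g f0 x - energy_variation f0 \<phi> x = (LINT y|lebesgue_on D. L (x, y))"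
        unfolding stored_density_eq energy_variation_def L_def
        using elim pair_energy_section_integrable[OF m(1) x] pair_energy_section_integrable[OF m(2) x] by simp
      then show ?case using integral_abs_bound by metis
    qed
  qed
  also have "\<dots> = (LINT z|(lebesgue_on D \<Otimes>\<^sub>M lebesgue_on D). \<bar>L z\<bar>)"
    by (rule MM.integral_fst'[OF integrable_abs[OF L]])
  also have "\<dots> \<le> (LINT z|(lebesgue_on D \<Otimes>\<^sub>M lebesgue_on D).
      energy_const * (inverse_distance \<epsilon> (fst z) (snd z) * (h (fst z) + h (snd z))))"
    using pair_energy_linearization
    by (intro integral_mono integrable_abs L integrable_mult_right weighted_kernel_integral(1)[OF h h0])
       (auto simp: L_def h_def)
  also have "\<dots> \<le> energy_const * (2 * kernel_const * (LINT x|lebesgue_on D. h x))"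
    using weighted_kernel_integral(2)[OF h h0] energy_const_nonneg by (simp add: mult_left_mono)
  finally show ?thesis by (simp add: h_def)
qed

text \<open>Both sides integrate one function on pairs: the left over \<open>P \<times> D\<close>,
  the flux over \<open>(D - P) \<times> P\<close> up to a null set. Exchanging the end points maps
  the bonds that leave \<open>P\<close> in the first set onto the second and reverses the sign,
  which explains the minus.\<close>

lemma power_balance:
  assumes f: "f \<in> borel_measurable (lebesgue_on D)" and \<phi>: "\<phi> \<in> L2_fields D"
    and P: "P \<in> sets lebesgue" "P \<subseteq> D" and null: "negligible (closure P - P)"
  shows "(LINT x|lebesgue_on D. indicator P x * (\<phi> x \<bullet> internal_force D \<epsilon> J g f x + energy_variation f \<phi> x))
    = - nonlocal_flux D \<epsilon> J g P f \<phi>"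
proof -
  let ?M = "lebesgue_on D"
  define \<Phi> where "\<Phi> z = pair_force f (fst z) (snd z) \<bullet> (\<phi> (fst z) + \<phi> (snd z))" for z
  have \<Phi>: "integrable (?M \<Otimes>\<^sub>M ?M) \<Phi>"
    unfolding \<Phi>_def using L2_fieldsD(1)[OF \<phi>]
    by (intro pair_power_integrable[OF f \<phi>]) (auto intro: norm_triangle_ineq)
  have anti: "\<Phi> (y, x) = - \<Phi> (x, y)" for x y
    by (simp add: \<Phi>_def pair_force_antisym[of f y x] add.commute)
  have PM: "P \<in> sets ?M" using P D_lmeasurable by (simp add: sets_restrict_space_iff)
  have [measurable]: "(\<lambda>z. indicator P (fst z)) \<in> borel_measurable (?M \<Otimes>\<^sub>M ?M)"
     "(\<lambda>z. indicator P (snd z)) \<in> borel_measurable (?M \<Otimes>\<^sub>M ?M)"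
    using measurable_compose[OF measurable_fst borel_measurable_indicator[OF PM]]
      measurable_compose[OF measurable_snd borel_measurable_indicator[OF PM]] by auto
  have int: "integrable (?M \<Otimes>\<^sub>M ?M) (\<lambda>z. c z * \<Phi> z)"
    if "c \<in> borel_measurable (?M \<Otimes>\<^sub>M ?M)" "\<And>z. \<bar>c z\<bar> \<le> 1" for c :: "_ \<Rightarrow> real"
    by (rule Bochner_Integration.integrable_bound[OF \<Phi>])
       (use that \<Phi> in \<open>auto simp: abs_mult intro!: mult_left_le_one_le\<close>)
  have iP: "integrable (?M \<Otimes>\<^sub>M ?M) (\<lambda>z. indicator P (fst z) * \<Phi> z)"
      "integrable (?M \<Otimes>\<^sub>M ?M) (\<lambda>z. indicator P (snd z) * \<Phi> z)"
      "integrable (?M \<Otimes>\<^sub>M ?M) (\<lambda>z. (indicator P (fst z) * indicator P (snd z)) * \<Phi> z)"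
      "integrable (?M \<Otimes>\<^sub>M ?M) (\<lambda>z. ((1 - indicator P (fst z)) * indicator P (snd z)) * \<Phi> z)"
    by (rule int; measurable; simp add: indicator_def)+
  have swap: "(LINT z|(?M \<Otimes>\<^sub>M ?M). c z * \<Phi> z) = - (LINT z|(?M \<Otimes>\<^sub>M ?M). c (snd z, fst z) * \<Phi> z)"
    if c: "c \<in> borel_measurable (?M \<Otimes>\<^sub>M ?M)" for c :: "_ \<Rightarrow> real"
  proof -
    have "(LINT z|(?M \<Otimes>\<^sub>M ?M). c z * \<Phi> z) = (LINT (x, y)|(?M \<Otimes>\<^sub>M ?M). c (y, x) * \<Phi> (y, x))"
      using c \<Phi> by (intro MM.integral_product_swap[symmetric] borel_measurable_times) auto
    also have "\<dots> = (LINT z|(?M \<Otimes>\<^sub>M ?M). - (c (snd z, fst z) * \<Phi> z))"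
    proof (rule Bochner_Integration.integral_cong[OF refl])
      fix z
      show "(case z of (x, y) \<Rightarrow> c (y, x) * \<Phi> (y, x)) = - (c (snd z, fst z) * \<Phi> z)"
        using anti[of "snd z" "fst z"] by (simp add: case_prod_beta)
    qed
    finally show ?thesis by simp
  qed
  define A where "A = (LINT z|(?M \<Otimes>\<^sub>M ?M). indicator P (fst z) * \<Phi> z)"
  \<comment> \<open>The weight is symmetric, so the swap shows the integral to be its own
    negative.\<close>
  have both: "(LINT z|(?M \<Otimes>\<^sub>M ?M). indicator P (fst z) * indicator P (snd z) * \<Phi> z) = 0"
    using swap[of "\<lambda>z. indicator P (fst z) * indicator P (snd z)"] by (simp add: ac_simps)
  have second: "(LINT z|(?M \<Otimes>\<^sub>M ?M). indicator P (snd z) * \<Phi> z) = - A"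
    using swap[of "\<lambda>z. indicator P (snd z)"] by (simp add: A_def)
  have "(LINT x|?M. indicator P x * (\<phi> x \<bullet> internal_force D \<epsilon> J g f x + energy_variation f \<phi> x)) =
      (LINT x|?M. LINT y|?M. indicator P x * \<Phi> (x, y))"
  proof (rule integral_cong_AE)
    have pm: "(\<lambda>x. LINT y|?M. pair_force f x y) \<in> borel_measurable ?M"
      using pair_force_measurable[OF f] by (intro M.borel_measurable_lebesgue_integral) (simp add: case_prod_beta)
    then show "(\<lambda>x. indicator P x * (\<phi> x \<bullet> internal_force D \<epsilon> J g f x + energy_variation f \<phi> x)) \<in> borel_measurable ?M"
      unfolding internal_force_eq
      by (intro borel_measurable_times borel_measurable_add borel_measurable_inner borel_measurable_scaleR
          borel_measurable_const borel_measurable_indicator[OF PM] L2_fieldsD(1)[OF \<phi>]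
          borel_measurable_integrable[OF energy_variation_integrable[OF f \<phi>]])
    show "(\<lambda>x. LINT y|?M. indicator P x * \<Phi> (x, y)) \<in> borel_measurable ?M"
      using borel_measurable_integrable[OF MM.integrable_fst'[OF iP(1)]] by simp
    show "AE x in ?M. indicator P x * (\<phi> x \<bullet> internal_force D \<epsilon> J g f x + energy_variation f \<phi> x) = (LINT y|?M. indicator P x * \<Phi> (x, y))"
      using MM.AE_integrable_fst'[OF pair_variation_integrable[OF f \<phi>]] AE_space
    proof eventually_elim
      case (elim x)
      then have x: "x \<in> D" by simp
      note i = pair_force_section_integrable[OF f x]
      have F: "\<phi> x \<bullet> internal_force D \<epsilon> J g f x = (LINT y|?M. pair_force f x y \<bullet> (2 *\<^sub>R \<phi> x))"
        unfolding internal_force_eq by (subst integral_inner_left[OF i]) (simp add: inner_commute)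
      have "2 *\<^sub>R \<phi> x + (\<phi> y - \<phi> x) = \<phi> x + \<phi> y" for y by (simp add: scaleR_2)
      then have eq: "pair_force f x y \<bullet> (2 *\<^sub>R \<phi> x) + pair_force f x y \<bullet> (\<phi> y - \<phi> x) = \<Phi> (x, y)" for y
        by (simp only: \<Phi>_def fst_conv snd_conv inner_add_right[symmetric])
      have "\<phi> x \<bullet> internal_force D \<epsilon> J g f x + energy_variation f \<phi> x =
          (LINT y|?M. pair_force f x y \<bullet> (2 *\<^sub>R \<phi> x) + pair_force f x y \<bullet> (\<phi> y - \<phi> x))"
        unfolding F energy_variation_def using i elim
        by (intro Bochner_Integration.integral_add[symmetric] integrable_inner_left) auto
      also have "\<dots> = (LINT y|?M. \<Phi> (x, y))"
        by (simp only: eq)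
      finally show ?case by simp
    qed
  qed
  also have "\<dots> = A"
    unfolding A_def using MM.integral_fst'[OF iP(1)] by simp
  finally have lhs: "(LINT x|?M. indicator P x * (\<phi> x \<bullet> internal_force D \<epsilon> J g f x + energy_variation f \<phi> x)) = A" .
  have inner: "(LINT y:ball x \<epsilon> \<inter> P|lebesgue. (bond_force \<epsilon> J g y x (strain D y x f) *\<^sub>R bond_dir y x) \<bullet> (\<phi> x + \<phi> y))
      = (LINT y|?M. indicator P y * \<Phi> (x, y))" for x
  proof -
    have "(LINT y:ball x \<epsilon> \<inter> P|lebesgue. (bond_force \<epsilon> J g y x (strain D y x f) *\<^sub>R bond_dir y x) \<bullet> (\<phi> x + \<phi> y))
        = (LINT y|lebesgue. indicator D y *\<^sub>R (indicator P y * \<Phi> (x, y)))"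
      unfolding set_lebesgue_integral_def
    proof (rule Bochner_Integration.integral_cong[OF refl])
      fix y
      show "indicator (ball x \<epsilon> \<inter> P) y *\<^sub>R ((bond_force \<epsilon> J g y x (strain D y x f) *\<^sub>R bond_dir y x) \<bullet> (\<phi> x + \<phi> y))
          = indicator D y *\<^sub>R (indicator P y * \<Phi> (x, y))"
        using pair_force_outside[where x=x and y=y and f=f] P(2)
        by (cases "norm (y - x) < \<epsilon>") (auto simp: pair_force_def[symmetric] \<Phi>_def indicator_def dist_norm norm_minus_commute)
    qed
    then show ?thesis using D_lmeasurable by (subst integral_restrict_space) auto
  qed
  have m1: "(\<lambda>x. LINT y|?M. indicator P y * \<Phi> (x, y)) \<in> borel_measurable ?M"
    using borel_measurable_integrable[OF MM.integrable_fst'[OF iP(2)]] by simp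
  have cP: "closure P \<inter> D \<in> sets ?M"
    using D_lmeasurable by (auto simp: sets_restrict_space)
  have "nonlocal_flux D \<epsilon> J g P f \<phi> = (LINT x|lebesgue. indicator D x *\<^sub>R ((1 - indicator (closure P \<inter> D) x) * (LINT y|?M. indicator P y * \<Phi> (x, y))))"
    unfolding nonlocal_flux_def inner unfolding set_lebesgue_integral_def
  proof (rule Bochner_Integration.integral_cong[OF refl])
    fix x
    show "indicator (D - closure P) x *\<^sub>R (LINT y|?M. indicator P y * \<Phi> (x, y)) =
        indicator D x *\<^sub>R ((1 - indicator (closure P \<inter> D) x) * (LINT y|?M. indicator P y * \<Phi> (x, y)))"
      by (cases "x \<in> D"; cases "x \<in> closure P") simp_all
  qed
  also have "\<dots> = (LINT x|?M. (1 - indicator (closure P \<inter> D) x) * (LINT y|?M. indicator P y * \<Phi> (x, y)))"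
    using D_lmeasurable by (subst integral_restrict_space) auto
  also have "\<dots> = (LINT x|?M. LINT y|?M. (1 - indicator P x) * (indicator P y * \<Phi> (x, y)))"
  proof (rule integral_cong_AE)
    show "(\<lambda>x. (1 - indicator (closure P \<inter> D) x) * (LINT y|?M. indicator P y * \<Phi> (x, y))) \<in> borel_measurable ?M"
      using m1 borel_measurable_indicator[OF cP] by measurable
    show "(\<lambda>x. LINT y|?M. (1 - indicator P x) * (indicator P y * \<Phi> (x, y))) \<in> borel_measurable ?M"
      unfolding integral_mult_right_zero
      by (intro borel_measurable_times borel_measurable_diff borel_measurable_const borel_measurable_indicator[OF PM] m1)
    \<comment> \<open>The flux runs over the complement of the closure, the pair integral over the
      complement of \<open>P\<close>; the part of the boundary between them is null.\<close>
    have "AE x in lebesgue. x \<notin> closure P - P"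
      using null unfolding negligible_iff_null_sets by (rule AE_not_in)
    then have "AE x in ?M. x \<notin> closure P - P"
      using D_lmeasurable by (subst AE_restrict_space_iff) auto
    with AE_space show "AE x in ?M. (1 - indicator (closure P \<inter> D) x) * (LINT y|?M. indicator P y * \<Phi> (x, y)) =
        (LINT y|?M. (1 - indicator P x) * (indicator P y * \<Phi> (x, y)))"
    proof eventually_elim
      case (elim x)
      then have "indicator (closure P \<inter> D) x = (indicator P x :: real)"
        using closure_subset[of P] by (auto simp: indicator_def)
      then show ?case by (simp only: integral_mult_right_zero)
    qed
  qed
  also have "\<dots> = (LINT z|(?M \<Otimes>\<^sub>M ?M). (1 - indicator P (fst z)) * indicator P (snd z) * \<Phi> z)"
    using MM.integral_fst'[OF iP(4)] by (simp add: mult.assoc)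
  also have "\<dots> = (LINT z|(?M \<Otimes>\<^sub>M ?M). indicator P (snd z) * \<Phi> z - indicator P (fst z) * indicator P (snd z) * \<Phi> z)"
    by (rule Bochner_Integration.integral_cong) (auto simp: algebra_simps)
  also have "\<dots> = - A - 0"
    unfolding both[symmetric] second[symmetric]
    by (rule Bochner_Integration.integral_diff[OF iP(2,3)])
  finally show ?thesis using lhs by simp
qed

end

section \<open>Differentiability of the energy density\<close>

text \<open>Young's inequality with a free weight, integrated and then optimised: the best weight is
  the ratio of the two norms. If one of them vanishes, the weight is pushed to an extreme to make
  the other term arbitrarily small.\<close>

lemma integral_Cauchy_Schwarz:
  fixes f h :: "'a \<Rightarrow> real"
  assumes [measurable]: "f \<in> borel_measurable M" "h \<in> borel_measurable M"
    and f: "integrable M (\<lambda>x. (f x)\<^sup>2)" and h: "integrable M (\<lambda>x. (h x)\<^sup>2)"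
  shows "integrable M (\<lambda>x. f x * h x)"
    and "(LINT x|M. \<bar>f x * h x\<bar>) \<le> sqrt (LINT x|M. (f x)\<^sup>2) * sqrt (LINT x|M. (h x)\<^sup>2)"
proof -
  let ?A = "LINT x|M. (f x)\<^sup>2" and ?B = "LINT x|M. (h x)\<^sup>2" and ?I = "LINT x|M. \<bar>f x * h x\<bar>"
  have young: "2 * \<bar>x * y\<bar> \<le> r * x\<^sup>2 + y\<^sup>2 / r" if "0 < r" for x y r :: real
  proof -
    have "2 * (r * \<bar>x\<bar>) * \<bar>y\<bar> \<le> (r * \<bar>x\<bar>)\<^sup>2 + \<bar>y\<bar>\<^sup>2" by (rule sum_squares_bound)
    also have "\<dots> = r * (r * x\<^sup>2 + y\<^sup>2 / r)"
      using that by (simp add: power_mult_distrib distrib_left power2_eq_square)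
    finally have "r * (2 * \<bar>x * y\<bar>) \<le> r * (r * x\<^sup>2 + y\<^sup>2 / r)" by (simp add: abs_mult ac_simps)
    then show ?thesis using that by simp
  qed
  show int: "integrable M (\<lambda>x. f x * h x)"
  proof (rule Bochner_Integration.integrable_bound)
    show "integrable M (\<lambda>x. (f x)\<^sup>2 + (h x)\<^sup>2)" using f h by simp
    show "AE x in M. norm (f x * h x) \<le> norm ((f x)\<^sup>2 + (h x)\<^sup>2)"
    proof (rule AE_I2)
      fix x
      have "\<bar>f x * h x\<bar> \<le> 2 * \<bar>f x * h x\<bar>" by simp
      also have "\<dots> \<le> (f x)\<^sup>2 + (h x)\<^sup>2" using young[of 1 "f x" "h x"] by simp
      finally show "norm (f x * h x) \<le> norm ((f x)\<^sup>2 + (h x)\<^sup>2)" by simp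
    qed
  qed measurable
  have ratio: "x / ((x + 1) / r) \<le> r" "r / (x + 1) * x \<le> r" if "0 < r" "0 \<le> x" for x r :: real
    using that by (simp_all add: pos_divide_le_eq add_nonneg_pos algebra_simps)
  have A0: "0 \<le> ?A" and B0: "0 \<le> ?B" and I0: "0 \<le> ?I" by simp_all
  have le: "2 * ?I \<le> r * ?A + ?B / r" if "0 < r" for r
  proof -
    have "(LINT x|M. 2 * \<bar>f x * h x\<bar>) \<le> (LINT x|M. r * (f x)\<^sup>2 + (h x)\<^sup>2 / r)"
      using int f h young[OF that] by (intro integral_mono) auto
    then show ?thesis using f h int by simp
  qed
  show "?I \<le> sqrt ?A * sqrt ?B"
  proof (cases "?A = 0 \<or> ?B = 0")
    case True
    have "?I \<le> 0"
    proof (rule field_le_epsilon)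
      fix r :: real assume r: "0 < r"
      show "?I \<le> 0 + r"
      proof (cases "?A = 0")
        case True
        \<comment> \<open>The weight leaves a term of size at most \<open>r\<close>; the 1 keeps it
          positive when \<open>?B\<close> vanishes too.\<close>
        have "2 * ?I \<le> ?B / ((?B + 1) / r)" using le[of "(?B + 1) / r"] r B0 True by simp
        also have "\<dots> \<le> r" using r B0 by (intro ratio)
        finally show ?thesis using I0 by linarith
      next
        case False
        then have B: "?B = 0" using \<open>?A = 0 \<or> ?B = 0\<close> by simp
        have "2 * ?I \<le> (r / (?A + 1)) * ?A" using le[of "r / (?A + 1)"] r A0 B by simp
        also have "\<dots> \<le> r" using r A0 by (intro ratio)
        finally show ?thesis using I0 by linarith
      qed
    qed
    also have "0 \<le> sqrt ?A * sqrt ?B" using A0 B0 by simp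
    finally show ?thesis .
  next
    case False
    then have A: "0 < ?A" and B: "0 < ?B" using A0 B0 by linarith+
    define \<alpha> \<beta> where "\<alpha> = sqrt ?A" and "\<beta> = sqrt ?B"
    have ab: "0 < \<alpha>" "0 < \<beta>" "?A = \<alpha> * \<alpha>" "?B = \<beta> * \<beta>" using A B by (auto simp: \<alpha>_def \<beta>_def)
    have "2 * ?I \<le> \<beta> / \<alpha> * ?A + ?B / (\<beta> / \<alpha>)" using le[of "\<beta> / \<alpha>"] ab(1,2) by simp
    also have "\<dots> = 2 * (\<alpha> * \<beta>)" unfolding ab(3,4) using ab(1,2) by simp
    finally show ?thesis by (simp add: \<alpha>_def \<beta>_def)
  qed
qed

section \<open>Derivative bounds for the cohesive potential\<close>

lemma has_derivative_imp_has_real_derivative: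
  fixes f :: "real \<Rightarrow> real"
  assumes "(f has_derivative F) (at x)"
  shows "(f has_real_derivative F 1) (at x)"
proof -
  have "(*) (F 1) = F"
  proof (rule ext)
    fix t
    have "F (t *\<^sub>R 1) = t *\<^sub>R F 1" by (rule linear_scale[OF has_derivative_linear[OF assms]])
    then show "F 1 * t = F t" by (metis mult.commute mult_1_right real_scaleR_def)
  qed
  then show ?thesis using assms unfolding has_field_derivative_def by (simp only:)
qed

lemma Ck_on_Suc_real:
  assumes "Ck_on (Suc k) UNIV f"
  obtains f' where "\<And>x::real. (f has_real_derivative f' x) (at x)" "Ck_on k UNIV f'"
proof -
  obtain F where F: "\<forall>x\<in>UNIV. (f has_derivative F x) (at x within UNIV)" "\<forall>v. Ck_on k UNIV (\<lambda>x. F x v)"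
    using assms by auto
  show ?thesis
    using F by (intro that[of "\<lambda>x. F x 1"]) (auto intro: has_derivative_imp_has_real_derivative)
qed

lemma bounded_if_zero_outside:
  fixes f :: "real \<Rightarrow> real"
  assumes "continuous_on UNIV f" "\<And>r. rp < \<bar>r\<bar> \<Longrightarrow> f r = 0"
  obtains K where "\<And>r. \<bar>f r\<bar> \<le> K"
proof -
  have "bounded (f ` {-rp..rp})"
    using assms(1) by (intro compact_imp_bounded compact_continuous_image continuous_on_subset[OF assms(1)]) auto
  then obtain K where "\<forall>y\<in>f ` {-rp..rp}. norm y \<le> K" unfolding bounded_iff by blast
  then have K: "\<bar>f r\<bar> \<le> K" if "r \<in> {-rp..rp}" for r using that by simp
  have "\<bar>f r\<bar> \<le> max K 0" for r
  proof (cases "rp < \<bar>r\<bar>")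
    case False
    then have "\<bar>f r\<bar> \<le> K" by (intro K) auto
    then show ?thesis by simp
  qed (simp add: assms(2))
  then show ?thesis by (rule that)
qed

text \<open>\<open>deriv g\<close> vanishes for \<open>rp \<le> \<bar>r\<bar>\<close>, so the first
  two derivatives are continuous with bounded support and hence bounded. The bound on the second is
  the Lipschitz constant of the first.\<close>

lemma cohesive_potential_derivative_bounds:
  assumes "cohesive_potential g h rc rp Cp"
  obtains g1 K1 K2 Kg where "\<And>r. (g has_real_derivative g1 r) (at r)" "\<And>r. \<bar>g1 r\<bar> \<le> K1"
    "\<And>r s. \<bar>g1 r - g1 s\<bar> \<le> K2 * \<bar>r - s\<bar>" "g1 0 = 0" "\<And>r. \<bar>g r\<bar> \<le> Kg"
proof -
  have g: "bounded (range g)" "smooth_fun_on UNIV g" "deriv g 0 = 0" "\<And>r. rp \<le> \<bar>r\<bar> \<Longrightarrow> deriv g r = 0"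
    using assms by (auto simp: cohesive_potential_def)
  obtain Kg where Kg: "\<And>r. \<bar>g r\<bar> \<le> Kg" using g(1) by (auto simp: bounded_iff)
  have "Ck_on (Suc (Suc 0)) UNIV g" using g(2) unfolding smooth_fun_on_def by blast
  then obtain g1 where g1: "\<And>r. (g has_real_derivative g1 r) (at r)" and c1: "Ck_on (Suc 0) UNIV g1"
    using Ck_on_Suc_real by metis
  obtain g2 where g2: "\<And>r. (g1 has_real_derivative g2 r) (at r)" and c2: "Ck_on 0 UNIV g2"
    using Ck_on_Suc_real[OF c1] by metis
  have g1_deriv: "g1 r = deriv g r" for r using DERIV_imp_deriv[OF g1] by simp
  have g1_0: "g1 r = 0" if "rp \<le> \<bar>r\<bar>" for r using g(4)[OF that] by (simp add: g1_deriv)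
  \<comment> \<open>The strict inequality provides an open neighbourhood on which \<open>g1\<close>
    is zero.\<close>
  have g2_0: "g2 r = 0" if "rp < \<bar>r\<bar>" for r
  proof (rule DERIV_unique[OF g2])
    have "open {r. rp < \<bar>r\<bar>}" by (intro open_Collect_less continuous_intros)
    then show "(g1 has_real_derivative 0) (at r)"
      by (rule has_field_derivative_transform_within_open[of "\<lambda>_. 0", rotated]) (use that g1_0 in auto)
  qed
  obtain K1 where K1: "\<And>r. \<bar>g1 r\<bar> \<le> K1"
    by (rule bounded_if_zero_outside[of g1 rp])
       (use g1_0 g2 in \<open>auto intro!: continuous_at_imp_continuous_on DERIV_isCont\<close>)
  obtain K2 where K2: "\<And>r. \<bar>g2 r\<bar> \<le> K2"
    by (rule bounded_if_zero_outside[of g2 rp]) (use g2_0 c2 in auto)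
  have lip: "\<bar>g1 r - g1 s\<bar> \<le> K2 * \<bar>r - s\<bar>" for r s
    using field_differentiable_bound[of UNIV g1 g2 K2 r s] g2 K2 by simp
  show ?thesis
    by (rule that[OF g1 K1 lip _ Kg]) (simp add: g1_deriv g(3))
qed

section \<open>Geometry of the notched plate\<close>

lemma open_plate: "open (plate a b)"
  unfolding plate_def Collect_conj_eq by (intro open_Int open_Collect_less continuous_intros)

lemma notched_plate_lmeasurable: "notched_plate a b l d \<in> lmeasurable"
proof (rule bounded_set_imp_lmeasurable)
  have "plate a b \<subseteq> cbox (vector [0, -b/2]) (vector [a, b/2])"
    by (auto simp: plate_def mem_box_cart forall_2)
  then show "bounded (notched_plate a b l d)"
    unfolding notched_plate_def by (meson bounded_cbox bounded_subset Diff_subset subset_trans)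
  have [measurable]: "(\<lambda>x::real^2. x $ i) \<in> borel_measurable borel" for i
    by (intro borel_measurable_continuous_onI continuous_intros)
  have "notch l d \<in> sets borel"
    unfolding notch_def by measurable
  then have "notched_plate a b l d \<in> sets borel"
    unfolding notched_plate_def by (rule sets.Diff[OF borel_open[OF open_plate]])
  then show "notched_plate a b l d \<in> sets lebesgue" by (simp add: sets_completionI_sets)
qed

text \<open>The segment from a point on the flat edge of the notch to a point on the centre line enters the
  notch, so a convex subset of the notched plate that meets the centre line stays off that edge.\<close>

lemma convex_subset_interior_notched_plate:
  assumes d: "0 < d" and C: "convex C" "C \<subseteq> notched_plate a b l d" and z: "z \<in> C" "z $ 2 = 0"
  shows "C \<subseteq> interior (notched_plate a b l d)"
proof
  fix x assume x: "x \<in> C"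
  then have xD: "x \<in> plate a b" "x \<notin> notch l d" using C by (auto simp: notched_plate_def)
  \<comment> \<open>The plate without the closed notch, written with open conditions. The points
    with \<open>\<bar>x$2\<bar> = d\<close> to the right of the flat edges fall under the second
    one, where the root is 0.\<close>
  define U where "U = plate a b \<inter> ({x. d < \<bar>x$2\<bar>} \<union> {x. sqrt (max 0 (d^2 - (x$2)^2)) < x$1 - (l - d)})"
  have "open U" unfolding U_def
    by (intro open_Int open_plate open_Un open_Collect_less continuous_intros)
  moreover have "U \<subseteq> notched_plate a b l d"
  proof
    fix y assume y: "y \<in> U"
    have "y \<notin> notch l d"
    proof
      assume n: "y \<in> notch l d"
      then have y2: "\<bar>y$2\<bar> < d" by (auto simp: notch_def)
      then have "(y$2)^2 \<le> d^2" by (intro abs_le_square_iff[THEN iffD1]) auto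
      then have "0 \<le> sqrt (d^2 - (y$2)^2)" "sqrt (d^2 - (y$2)^2) < y$1 - (l - d)"
        using y y2 by (auto simp: U_def max_def)
      moreover have "y$1 \<le> l - d \<or> y$1 \<le> l - d + sqrt (d^2 - (y$2)^2)"
        using n by (auto simp: notch_def)
      ultimately show False by linarith
    qed
    then show "y \<in> notched_plate a b l d" using y by (simp add: U_def notched_plate_def)
  qed
  moreover have "x \<in> U"
  proof (rule ccontr)
    assume nU: "x \<notin> U"
    have x1: "0 < x$1" using xD by (simp add: plate_def)
    have "\<not> \<bar>x$2\<bar> < d"
    proof
      assume x2: "\<bar>x$2\<bar> < d"
      then have sq: "(x$2)^2 \<le> d^2" by (intro abs_le_square_iff[THEN iffD1]) auto
      then have "x$1 - (l - d) \<le> sqrt (d^2 - (x$2)^2)" using nU xD by (auto simp: U_def max_def split: if_splits)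
      then show False using xD x2 x1 by (auto simp: notch_def not_le)
    qed
    then have x2: "\<bar>x$2\<bar> = d" using nU xD by (auto simp: U_def)
    then have "(x$2)^2 = d^2" by (metis power2_abs)
    then have xl: "x$1 \<le> l - d" using nU xD by (auto simp: U_def)
    define K where "K = z$1 - (l - d)"
    \<comment> \<open>The point at parameter \<open>\<theta>\<close> of the segment from
      \<open>x\<close> to \<open>z\<close> falls into the notch as soon as
      \<open>\<theta> * (K^2 + d^2) \<le> 2 * d^2\<close>. Half of the largest such value is taken
      because it is also at most 1.\<close>
    define \<theta> where "\<theta> = d^2 / (K^2 + d^2)"
    have pos: "0 < K^2 + d^2" using d by (simp add: add_nonneg_pos)
    have th: "0 < \<theta>" "\<theta> \<le> 1" using d pos by (auto simp: \<theta>_def)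
    define y where "y = (1 - \<theta>) *\<^sub>R x + \<theta> *\<^sub>R z"
    have yC: "y \<in> C" unfolding y_def using th by (intro convexD_alt[OF C(1) x z(1)]) auto
    then have yD: "y \<in> plate a b" "y \<notin> notch l d" using C by (auto simp: notched_plate_def)
    have y2: "y$2 = (1 - \<theta>) * x$2" by (simp add: y_def z)
    have ay2: "\<bar>y$2\<bar> = (1 - \<theta>) * d" using th by (simp add: y2 abs_mult x2)
    have sy: "(y$2)^2 = (1 - \<theta>)^2 * d^2" using ay2 by (metis power2_abs power_mult_distrib)
    have "y$1 = (1 - \<theta>) * x$1 + \<theta> * z$1" by (simp add: y_def)
    also have "\<dots> \<le> (1 - \<theta>) * (l - d) + \<theta> * z$1"
      using th xl by (intro add_right_mono mult_left_mono) auto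
    also have "\<dots> = l - d + \<theta> * K" by (simp add: K_def algebra_simps)
    finally have y1: "y$1 - (l - d) \<le> \<theta> * K" by simp
    have "(\<theta> * K)^2 \<le> d^2 - (y$2)^2"
    proof -
      have "\<theta> * (K^2 + d^2) = d^2" using pos by (simp add: \<theta>_def)
      then have "\<theta> * (\<theta> * (K^2 + d^2)) \<le> \<theta> * (2 * d^2)" using th d by (intro mult_left_mono) auto
      then show ?thesis unfolding sy by (simp add: power2_eq_square algebra_simps)
    qed
    then have "\<theta> * K \<le> sqrt (d^2 - (y$2)^2)" by (rule real_le_rsqrt)
    moreover have "0 < y$1" using yD by (simp add: plate_def)
    moreover have "\<bar>y$2\<bar> < d" using ay2 th d by simp
    ultimately show False using yD y1 by (auto simp: notch_def not_le abs_less_iff)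
  qed
  ultimately show "x \<in> interior (notched_plate a b l d)" by (meson interiorI)
qed

section \<open>Increments of fields in the norm of the energy space\<close>

lemma L2_norm_power2: "(L2_norm D f)\<^sup>2 = (LINT x|lebesgue_on D. (norm (f x))\<^sup>2)"
  by (simp add: L2_norm_def)

lemma L2_norm_scaleR: "L2_norm D (\<lambda>x. c *\<^sub>R f x) = \<bar>c\<bar> * L2_norm D f"
  by (simp add: L2_norm_def power_mult_distrib real_sqrt_mult)

lemma integral_inner_le_L2_norm:
  assumes f: "f \<in> L2_fields D" and h: "h \<in> L2_fields D"
  shows "integrable (lebesgue_on D) (\<lambda>x. f x \<bullet> h x)"
    and "(LINT x|lebesgue_on D. \<bar>f x \<bullet> h x\<bar>) \<le> L2_norm D f * L2_norm D h"
proof -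
  note [measurable] = L2_fieldsD(1)[OF f] L2_fieldsD(1)[OF h]
  note CS = integral_Cauchy_Schwarz[of "\<lambda>x. norm (f x)" "lebesgue_on D" "\<lambda>x. norm (h x)", OF _ _ L2_fieldsD(2)[OF f] L2_fieldsD(2)[OF h]]
  show i: "integrable (lebesgue_on D) (\<lambda>x. f x \<bullet> h x)"
  proof (rule Bochner_Integration.integrable_bound)
    show "integrable (lebesgue_on D) (\<lambda>x. norm (f x) * norm (h x))" by (rule CS(1)) measurable
    show "AE x in lebesgue_on D. norm (f x \<bullet> h x) \<le> norm (norm (f x) * norm (h x))"
      using Cauchy_Schwarz_ineq2 by (auto intro!: AE_I2)
  qed measurable
  have "(LINT x|lebesgue_on D. \<bar>f x \<bullet> h x\<bar>) \<le> (LINT x|lebesgue_on D. \<bar>norm (f x) * norm (h x)\<bar>)"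
    using Cauchy_Schwarz_ineq2 by (intro integral_mono integrable_abs i CS(1)) auto
  also have "\<dots> \<le> L2_norm D f * L2_norm D h"
    unfolding L2_norm_def by (rule CS(2)) measurable
  finally show "(LINT x|lebesgue_on D. \<bar>f x \<bullet> h x\<bar>) \<le> L2_norm D f * L2_norm D h" .
qed

lemma integral_norm_le_L2_norm:
  assumes D: "D \<in> lmeasurable" and f: "f \<in> L2_fields D"
  shows "(LINT x|lebesgue_on D. norm (f x)) \<le> sqrt (measure lebesgue D) * L2_norm D f"
proof -
  interpret finite_measure "lebesgue_on D" using D by (rule finite_measure_lebesgue_on)
  note [measurable] = L2_fieldsD(1)[OF f]
  have "(LINT x|lebesgue_on D. \<bar>1 * norm (f x)\<bar>) \<le> sqrt (LINT x|lebesgue_on D. 1\<^sup>2) * sqrt (LINT x|lebesgue_on D. (norm (f x))\<^sup>2)"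
    by (rule integral_Cauchy_Schwarz(2)) (use L2_fieldsD(2)[OF f] in auto)
  moreover have "measure (lebesgue_on D) D = measure lebesgue D"
    using D by (simp add: measure_restrict_space)
  ultimately show ?thesis by (simp add: L2_norm_def)
qed

text \<open>With \<open>z\<close> the error of the difference quotient, the increment is
  \<open>h\<close> times the sum of \<open>\<phi>\<close> and this error. Differentiability thus
  gives a squared increment of order \<open>h\<^sup>2\<close> and a mismatch of order
  \<open>h * z\<close>, the two inputs of the linearizations.\<close>

lemma difference_quotient_estimates:
  assumes fs: "fs \<in> L2_fields D" and ft: "ft \<in> L2_fields D" and \<phi>: "\<phi> \<in> L2_fields D" and h: "h \<noteq> 0"
  defines "z \<equiv> L2_norm D (\<lambda>x. (fs x - ft x) /\<^sub>R h - \<phi> x)"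
  shows "(LINT x|lebesgue_on D. (norm (fs x - ft x))\<^sup>2) \<le> 2 * h\<^sup>2 * ((L2_norm D \<phi>)\<^sup>2 + z\<^sup>2)"
    and "L2_norm D (\<lambda>x. fs x - ft x - h *\<^sub>R \<phi> x) = \<bar>h\<bar> * z"
proof -
  let ?q = "\<lambda>x. (fs x - ft x) /\<^sub>R h - \<phi> x"
  have q: "?q \<in> L2_fields D"
    by (intro L2_fields_diff L2_fields_scaleR fs ft \<phi>)
  have eq: "fs x - ft x - h *\<^sub>R \<phi> x = h *\<^sub>R ?q x" for x
    using h by (simp add: scaleR_diff_right)
  show "L2_norm D (\<lambda>x. fs x - ft x - h *\<^sub>R \<phi> x) = \<bar>h\<bar> * z"
    unfolding eq z_def by (rule L2_norm_scaleR)
  have "(LINT x|lebesgue_on D. (norm (fs x - ft x))\<^sup>2) \<le>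
      (LINT x|lebesgue_on D. 2 * h\<^sup>2 * ((norm (\<phi> x))\<^sup>2 + (norm (?q x))\<^sup>2))"
  proof (rule integral_mono)
    show "integrable (lebesgue_on D) (\<lambda>x. (norm (fs x - ft x))\<^sup>2)"
      by (rule L2_fieldsD(2)[OF L2_fields_diff[OF fs ft]])
    show "integrable (lebesgue_on D) (\<lambda>x. 2 * h\<^sup>2 * ((norm (\<phi> x))\<^sup>2 + (norm (?q x))\<^sup>2))"
      by (intro integrable_mult_right Bochner_Integration.integrable_add L2_fieldsD(2) \<phi> q)
    fix x
    have "fs x - ft x = h *\<^sub>R (\<phi> x + ?q x)"
      using h by simp
    then have "norm (fs x - ft x) = \<bar>h\<bar> * norm (\<phi> x + ?q x)" by (metis norm_scaleR)
    also have "\<dots> \<le> \<bar>h\<bar> * (norm (\<phi> x) + norm (?q x))"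
      by (intro mult_left_mono norm_triangle_ineq) simp
    finally have "(norm (fs x - ft x))\<^sup>2 \<le> (\<bar>h\<bar> * (norm (\<phi> x) + norm (?q x)))\<^sup>2"
      by (rule power_mono) simp
    also have "\<dots> = h\<^sup>2 * (norm (\<phi> x) + norm (?q x))\<^sup>2" by (simp add: power_mult_distrib)
    also have "\<dots> \<le> h\<^sup>2 * (2 * ((norm (\<phi> x))\<^sup>2 + (norm (?q x))\<^sup>2))"
      using sum_squares_bound[of "norm (\<phi> x)" "norm (?q x)"] by (intro mult_left_mono) (auto simp: power2_sum)
    finally show "(norm (fs x - ft x))\<^sup>2 \<le> 2 * h\<^sup>2 * ((norm (\<phi> x))\<^sup>2 + (norm (?q x))\<^sup>2)"
      by (simp only: mult.assoc mult.left_commute[of "h\<^sup>2" 2])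
  qed
  also have "\<dots> = 2 * h\<^sup>2 * ((L2_norm D \<phi>)\<^sup>2 + z\<^sup>2)"
    unfolding z_def L2_norm_power2
    using L2_fieldsD(2)[OF \<phi>] L2_fieldsD(2)[OF q] by simp
  finally show "(LINT x|lebesgue_on D. (norm (fs x - ft x))\<^sup>2) \<le> 2 * h\<^sup>2 * ((L2_norm D \<phi>)\<^sup>2 + z\<^sup>2)" .
qed

lemma kinetic_density_integrable:
  assumes "f \<in> L2_fields D"
  shows "integrable (lebesgue_on D) (kinetic_density \<rho> f)"
  using L2_fieldsD(2)[OF assms] by (simp add: kinetic_density_def[abs_def])

text \<open>The remainder is exactly \<open>\<rho> / 2\<close> times the squared increment plus
  \<open>\<rho>\<close> times the inner product of \<open>f0\<close> with the mismatch; the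
  Cauchy-Schwarz inequality bounds the latter.\<close>

lemma kinetic_density_linearization:
  assumes f0: "f0 \<in> L2_fields D" and f1: "f1 \<in> L2_fields D" and \<phi>: "\<phi> \<in> L2_fields D" and \<rho>: "0 \<le> \<rho>"
  shows "(LINT x|lebesgue_on D. \<bar>kinetic_density \<rho> f1 x - kinetic_density \<rho> f0 x - \<rho> * (f0 x \<bullet> \<phi> x)\<bar>)
    \<le> \<rho> / 2 * (LINT x|lebesgue_on D. (norm (f1 x - f0 x))\<^sup>2) + \<rho> * (L2_norm D f0 * L2_norm D (\<lambda>x. f1 x - f0 x - \<phi> x))"
proof -
  let ?d = "\<lambda>x. f1 x - f0 x" and ?z = "\<lambda>x. f1 x - f0 x - \<phi> x"
  have d: "?d \<in> L2_fields D" and z: "?z \<in> L2_fields D"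
    by (intro L2_fields_diff f0 f1 \<phi>)+
  note iz = integral_inner_le_L2_norm[OF f0 z]
  have "(LINT x|lebesgue_on D. \<bar>kinetic_density \<rho> f1 x - kinetic_density \<rho> f0 x - \<rho> * (f0 x \<bullet> \<phi> x)\<bar>) \<le>
      (LINT x|lebesgue_on D. \<rho> / 2 * (norm (?d x))\<^sup>2 + \<rho> * \<bar>f0 x \<bullet> ?z x\<bar>)"
  proof (rule integral_mono)
    show "integrable (lebesgue_on D) (\<lambda>x. \<bar>kinetic_density \<rho> f1 x - kinetic_density \<rho> f0 x - \<rho> * (f0 x \<bullet> \<phi> x)\<bar>)"
      by (intro integrable_abs Bochner_Integration.integrable_diff kinetic_density_integrable integrable_mult_right
          integral_inner_le_L2_norm(1) f0 f1 \<phi>)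
    show "integrable (lebesgue_on D) (\<lambda>x. \<rho> / 2 * (norm (?d x))\<^sup>2 + \<rho> * \<bar>f0 x \<bullet> ?z x\<bar>)"
      by (intro Bochner_Integration.integrable_add integrable_mult_right integrable_abs iz(1) L2_fieldsD(2) d)
    fix x
    have "kinetic_density \<rho> f1 x - kinetic_density \<rho> f0 x - \<rho> * (f0 x \<bullet> \<phi> x) = \<rho> / 2 * (norm (?d x))\<^sup>2 + \<rho> * (f0 x \<bullet> ?z x)"
      unfolding kinetic_density_def power2_norm_eq_inner
      by (simp add: inner_diff_left inner_diff_right inner_commute algebra_simps add_divide_distrib diff_divide_distrib)
    then show "\<bar>kinetic_density \<rho> f1 x - kinetic_density \<rho> f0 x - \<rho> * (f0 x \<bullet> \<phi> x)\<bar> \<le> \<rho> / 2 * (norm (?d x))\<^sup>2 + \<rho> * \<bar>f0 x \<bullet> ?z x\<bar>"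
      using \<rho> by (simp only:) (intro order_trans[OF abs_triangle_ineq], simp add: abs_mult)
  qed
  also have "\<dots> = \<rho> / 2 * (LINT x|lebesgue_on D. (norm (?d x))\<^sup>2) + \<rho> * (LINT x|lebesgue_on D. \<bar>f0 x \<bullet> ?z x\<bar>)"
    using L2_fieldsD(2)[OF d] integrable_abs[OF iz(1)] by simp
  also have "\<dots> \<le> \<rho> / 2 * (LINT x|lebesgue_on D. (norm (?d x))\<^sup>2) + \<rho> * (L2_norm D f0 * L2_norm D ?z)"
    using iz(2) \<rho> by (intro add_left_mono mult_left_mono) auto
  finally show ?thesis .
qed

section \<open>Time derivative of the energy density in the integral norm\<close>

context bond_model begin

lemma energy_variation_scaleR: "energy_variation f (\<lambda>x. c *\<^sub>R \<phi> x) x = c * energy_variation f \<phi> x"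
proof -
  have "pair_force f x y \<bullet> (c *\<^sub>R \<phi> y - c *\<^sub>R \<phi> x) = c * (pair_force f x y \<bullet> (\<phi> y - \<phi> x))" for y
    by (simp add: inner_diff_right right_diff_distrib)
  then show ?thesis by (simp only: energy_variation_def integral_mult_right_zero)
qed

text \<open>The linearizations are applied with the predicted increments
  \<open>(s - t) *\<^sub>R v t\<close> for the displacement and \<open>(s - t) *\<^sub>R w t\<close>
  for the velocity. Membership in \<open>L2_fields\<close> is asked only near \<open>t\<close>,
  since nothing is known outside the time interval.\<close>

lemma energy_L1_derivative:
  fixes u v w :: "real \<Rightarrow> real^2 \<Rightarrow> real^2" and \<rho> t :: real
  defines "en \<equiv> \<lambda>s x. kinetic_density \<rho> (v s) x + stored_density D \<epsilon> J g (u s) x"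
  assumes \<rho>: "0 \<le> \<rho>"
    and L2: "\<forall>\<^sub>F s in at t. u s \<in> L2_fields D \<and> v s \<in> L2_fields D"
    and ut: "u t \<in> L2_fields D" and vt: "v t \<in> L2_fields D" and wt: "w t \<in> L2_fields D"
    and du: "((\<lambda>s. L2_norm D (\<lambda>x. (u s x - u t x) /\<^sub>R (s - t) - v t x)) \<longlongrightarrow> 0) (at t)"
    and dv: "((\<lambda>s. L2_norm D (\<lambda>x. (v s x - v t x) /\<^sub>R (s - t) - w t x)) \<longlongrightarrow> 0) (at t)"
  shows "((\<lambda>s. (LINT x|lebesgue_on D. \<bar>en s x - en t x - (s - t) * (\<rho> * (v t x \<bullet> w t x) + energy_variation (u t) (v t) x)\<bar>) / \<bar>s - t\<bar>) \<longlongrightarrow> 0) (at t)"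
proof -
  let ?M = "lebesgue_on D"
  define zu where "zu s = L2_norm D (\<lambda>x. (u s x - u t x) /\<^sub>R (s - t) - v t x)" for s
  define zv where "zv s = L2_norm D (\<lambda>x. (v s x - v t x) /\<^sub>R (s - t) - w t x)" for s
  define c where "c = energy_const * (2 * kernel_const)"
  define m where "m = sqrt (measure lebesgue D)"
  \<comment> \<open>The estimates divided by \<open>\<bar>s - t\<bar>\<close>: quadratic terms keep
    one factor \<open>\<bar>s - t\<bar>\<close>, mismatch terms keep the quotient errors
    \<open>zu\<close> and \<open>zv\<close>. The constant \<open>m\<close> passes from the
    \<open>L\<^sup>2\<close> norm to the integral of the norm.\<close>
  define bound where "bound s = \<rho> / 2 * (2 * \<bar>s - t\<bar> * ((L2_norm D (w t))\<^sup>2 + (zv s)\<^sup>2)) + \<rho> * (L2_norm D (v t) * zv s)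
     + c * (2 * \<bar>s - t\<bar> * ((L2_norm D (v t))\<^sup>2 + (zu s)\<^sup>2) + m * zu s)" for s
  have c0: "0 \<le> c" unfolding c_def using energy_const_nonneg kernel_const(1) by simp
  have bound_lim: "(bound \<longlongrightarrow> 0) (at t)"
  proof -
    have "((\<lambda>s. \<rho> / 2 * (2 * \<bar>s - t\<bar> * ((L2_norm D (w t))\<^sup>2 + (zv s)\<^sup>2)) + \<rho> * (L2_norm D (v t) * zv s)
     + c * (2 * \<bar>s - t\<bar> * ((L2_norm D (v t))\<^sup>2 + (zu s)\<^sup>2) + m * zu s)) \<longlongrightarrow>
       \<rho> / 2 * (2 * \<bar>t - t\<bar> * ((L2_norm D (w t))\<^sup>2 + 0\<^sup>2)) + \<rho> * (L2_norm D (v t) * 0)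
     + c * (2 * \<bar>t - t\<bar> * ((L2_norm D (v t))\<^sup>2 + 0\<^sup>2) + m * 0)) (at t)"
      by (intro tendsto_intros du[folded zu_def] dv[folded zv_def])
    then show ?thesis by (simp add: bound_def[abs_def])
  qed
  have "\<forall>\<^sub>F s in at t. norm ((LINT x|?M. \<bar>en s x - en t x - (s - t) * (\<rho> * (v t x \<bullet> w t x) + energy_variation (u t) (v t) x)\<bar>) / \<bar>s - t\<bar>) \<le> bound s"
    using L2 eventually_neq_at_within[of t t UNIV]
  proof eventually_elim
    case (elim s)
    define h where "h = s - t"
    have h: "h \<noteq> 0" using elim by (simp add: h_def)
    have us: "u s \<in> L2_fields D" and vs: "v s \<in> L2_fields D" using elim by auto
    let ?K = "\<lambda>x. kinetic_density \<rho> (v s) x - kinetic_density \<rho> (v t) x - \<rho> * (v t x \<bullet> (h *\<^sub>R w t x))"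
    let ?S = "\<lambda>x. stored_density D \<epsilon> J g (u s) x - stored_density D \<epsilon> J g (u t) x - energy_variation (u t) (\<lambda>x. h *\<^sub>R v t x) x"
    have hw: "(\<lambda>x. h *\<^sub>R w t x) \<in> L2_fields D" and hv: "(\<lambda>x. h *\<^sub>R v t x) \<in> L2_fields D"
      by (intro L2_fields_scaleR wt vt)+
    have iK: "integrable ?M ?K"
      by (intro Bochner_Integration.integrable_diff kinetic_density_integrable integrable_mult_right
          integral_inner_le_L2_norm(1) vs vt hw)
    have iS: "integrable ?M ?S"
      by (intro Bochner_Integration.integrable_diff stored_density_integrable energy_variation_integrable
          L2_fieldsD(1)[OF us] L2_fieldsD(1)[OF ut] hv)
    note zu = difference_quotient_estimates[OF us ut vt h, folded zu_def[of s, folded h_def]]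
    note zv = difference_quotient_estimates[OF vs vt wt h, folded zv_def[of s, folded h_def]]
    have K: "(LINT x|?M. \<bar>?K x\<bar>) \<le> \<rho> / 2 * (2 * h\<^sup>2 * ((L2_norm D (w t))\<^sup>2 + (zv s)\<^sup>2)) + \<rho> * (L2_norm D (v t) * (\<bar>h\<bar> * zv s))"
      using kinetic_density_linearization[OF vt vs hw \<rho>] zv(1) \<rho> unfolding zv(2)
      by (elim order_trans) (intro add_right_mono mult_left_mono; simp)
    have S: "(LINT x|?M. \<bar>?S x\<bar>) \<le> c * (2 * h\<^sup>2 * ((L2_norm D (v t))\<^sup>2 + (zu s)\<^sup>2) + m * (\<bar>h\<bar> * zu s))"
    proof -
      have diff: "(\<lambda>x. u s x - u t x) \<in> L2_fields D" "(\<lambda>x. u s x - u t x - h *\<^sub>R v t x) \<in> L2_fields D"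
        by (intro L2_fields_diff us ut hv)+
      have "(LINT x|?M. \<bar>?S x\<bar>) \<le> c * (LINT x|?M. (norm (u s x - u t x))\<^sup>2 + norm (u s x - u t x - h *\<^sub>R v t x))"
        using stored_density_linearization[OF ut us hv] by (simp add: c_def mult.assoc)
      also have "(LINT x|?M. (norm (u s x - u t x))\<^sup>2 + norm (u s x - u t x - h *\<^sub>R v t x)) =
         (LINT x|?M. (norm (u s x - u t x))\<^sup>2) + (LINT x|?M. norm (u s x - u t x - h *\<^sub>R v t x))"
        by (intro Bochner_Integration.integral_add L2_fieldsD(2) L2_fields_integrable_norm D_lmeasurable diff)
      also have "c * \<dots> \<le> c * (2 * h\<^sup>2 * ((L2_norm D (v t))\<^sup>2 + (zu s)\<^sup>2) + m * (\<bar>h\<bar> * zu s))"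
        using integral_norm_le_L2_norm[OF D_lmeasurable diff(2)] zu(1)
        unfolding zu(2) m_def by (intro mult_left_mono add_mono c0)
      finally show ?thesis .
    qed
    have "(LINT x|?M. \<bar>en s x - en t x - h * (\<rho> * (v t x \<bullet> w t x) + energy_variation (u t) (v t) x)\<bar>) = (LINT x|?M. \<bar>?K x + ?S x\<bar>)"
      by (rule Bochner_Integration.integral_cong[OF refl])
         (simp add: en_def energy_variation_scaleR algebra_simps)
    also have "\<dots> \<le> (LINT x|?M. \<bar>?K x\<bar> + \<bar>?S x\<bar>)"
      by (intro integral_mono integrable_abs Bochner_Integration.integrable_add iK iS abs_triangle_ineq)
    also have "\<dots> = (LINT x|?M. \<bar>?K x\<bar>) + (LINT x|?M. \<bar>?S x\<bar>)"
      by (intro Bochner_Integration.integral_add integrable_abs iK iS)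
    also have "\<dots> \<le> \<rho> / 2 * (2 * h\<^sup>2 * ((L2_norm D (w t))\<^sup>2 + (zv s)\<^sup>2)) + \<rho> * (L2_norm D (v t) * (\<bar>h\<bar> * zv s))
      + c * (2 * h\<^sup>2 * ((L2_norm D (v t))\<^sup>2 + (zu s)\<^sup>2) + m * (\<bar>h\<bar> * zu s))"
      using K S by (rule add_mono)
    also have "\<dots> = \<bar>h\<bar> * bound s"
    proof -
      have h2: "h\<^sup>2 = \<bar>h\<bar> * \<bar>h\<bar>" by (simp add: power2_eq_square)
      show ?thesis unfolding bound_def h_def[symmetric] h2 by (simp only: algebra_simps)
    qed
    finally have "(LINT x|?M. \<bar>en s x - en t x - h * (\<rho> * (v t x \<bullet> w t x) + energy_variation (u t) (v t) x)\<bar>) \<le> \<bar>h\<bar> * bound s" .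
    then show ?case using h unfolding h_def[symmetric]
      by (simp add: pos_divide_le_eq mult.commute)
  qed
  then show ?thesis using bound_lim by (rule Lim_null_comparison)
qed

end

section \<open>Integrals over translated rectangles\<close>

lemma set_lebesgue_integral_subset:
  fixes f :: "'a::euclidean_space \<Rightarrow> real"
  assumes "D \<in> sets lebesgue" "A \<subseteq> D"
  shows "(LINT x:A|lebesgue. f x) = (LINT x|lebesgue_on D. indicator A x * f x)"
proof -
  have "(LINT x:A|lebesgue. f x) = (LINT x|lebesgue. indicator D x *\<^sub>R (indicator A x * f x))"
    unfolding set_lebesgue_integral_def
  proof (rule Bochner_Integration.integral_cong[OF refl])
    fix x
    show "indicator A x *\<^sub>R f x = indicator D x *\<^sub>R (indicator A x * f x)"
      using assms(2) by (cases "x \<in> A") auto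
  qed
  then show ?thesis using assms(1) by (subst integral_restrict_space) auto
qed

lemma boundary_integral_cmult:
  "boundary_integral S (\<lambda>x n. a * \<phi> x n) = a * boundary_integral S \<phi>"
  unfolding boundary_integral_def set_lebesgue_integral_def
  by (induction S) (auto simp: distrib_left mult.left_commute[of _ a] simp flip: integral_mult_right_zero)

lemma rectangle_translate: "x \<in> rectangle (c + a) e p q \<longleftrightarrow> x - a \<in> rectangle c e p q"
  by (simp add: rectangle_def algebra_simps)

text \<open>Indicators of the translates are eventually constant at every point off the frontier,
  which is null because the rectangle is convex; \<open>\<bar>f x\<bar>\<close> dominates. Mere
  integrability of \<open>f\<close> suffices, which matters for the derivative of the energy
  density, as it has no contour values.\<close>

lemma moving_rectangle_integral_tendsto:
  fixes f :: "real^2 \<Rightarrow> real" and a :: "real \<Rightarrow> real^2"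
  assumes D: "D \<in> sets lebesgue" and f: "integrable (lebesgue_on D) f" and a: "(a \<longlongrightarrow> 0) (at t)"
  shows "((\<lambda>s. LINT x|lebesgue_on D. indicator (rectangle (c + a s) e p q) x * f x) \<longlongrightarrow>
      (LINT x|lebesgue_on D. indicator (rectangle c e p q) x * f x)) (at t)"
  unfolding tendsto_at_iff_sequentially
proof (intro allI impI)
  fix s :: "nat \<Rightarrow> real"
  assume sn: "\<forall>i. s i \<in> UNIV - {t}" and s: "s \<longlonglongrightarrow> t"
  have fs: "filterlim s (at t) sequentially" using sn s by (simp add: filterlim_at)
  have as: "(\<lambda>i. a (s i)) \<longlonglongrightarrow> 0" by (rule filterlim_compose[OF a fs])
  note [measurable] = borel_measurable_integrable[OF f]
  have R: "rectangle c e p q \<inter> D \<in> sets (lebesgue_on D)" for c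
    using D open_rectangle[of c e p q] by (auto simp: sets_restrict_space_iff sets_completionI_sets)
  have meas: "(\<lambda>x. indicator (rectangle c e p q) x * f x) \<in> borel_measurable (lebesgue_on D)" for c
  proof -
    have "(\<lambda>x. indicator (rectangle c e p q \<inter> D) x * f x) \<in> borel_measurable (lebesgue_on D)"
      using borel_measurable_indicator[OF R] by measurable
    then show ?thesis
      by (rule measurable_cong[THEN iffD1, rotated]) (simp add: indicator_def)
  qed
  have "(\<lambda>i. LINT x|lebesgue_on D. indicator (rectangle (c + a (s i)) e p q) x * f x) \<longlonglongrightarrow>
      (LINT x|lebesgue_on D. indicator (rectangle c e p q) x * f x)"
  proof (rule integral_dominated_convergence[where w="\<lambda>x. \<bar>f x\<bar>"])
    show "integrable (lebesgue_on D) (\<lambda>x. \<bar>f x\<bar>)" using f by (rule integrable_abs)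
    show "AE x in lebesgue_on D. norm (indicator (rectangle (c + a (s i)) e p q) x * f x) \<le> \<bar>f x\<bar>" for i
      by (rule AE_I2) (simp add: indicator_def)
    have "AE x in lebesgue. x \<notin> frontier (rectangle c e p q)"
      using negligible_convex_frontier[OF convex_rectangle] unfolding negligible_iff_null_sets by (rule AE_not_in)
    then have "AE x in lebesgue_on D. x \<notin> frontier (rectangle c e p q)"
      using D by (subst AE_restrict_space_iff) auto
    then show "AE x in lebesgue_on D. (\<lambda>i. indicator (rectangle (c + a (s i)) e p q) x * f x) \<longlonglongrightarrow> indicator (rectangle c e p q) x * f x"
    proof eventually_elim
      case (elim x)
      have lim: "(\<lambda>i. x - a (s i)) \<longlonglongrightarrow> x" using tendsto_diff[OF tendsto_const as] by simp
      have "eventually (\<lambda>i. x \<in> rectangle (c + a (s i)) e p q \<longleftrightarrow> x \<in> rectangle c e p q) sequentially"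
      proof (cases "x \<in> rectangle c e p q")
        case True
        then have "eventually (\<lambda>i. x - a (s i) \<in> rectangle c e p q) sequentially"
          by (intro topological_tendstoD[OF lim] open_rectangle)
        then show ?thesis using True by (simp add: rectangle_translate)
      next
        case False
        then have "x \<in> - closure (rectangle c e p q)"
          using elim by (auto simp: frontier_def interior_open[OF open_rectangle])
        then have "eventually (\<lambda>i. x - a (s i) \<in> - closure (rectangle c e p q)) sequentially"
          by (intro topological_tendstoD[OF lim]) auto
        then show ?thesis
          by eventually_elim (use False closure_subset[of "rectangle c e p q"] in \<open>auto simp: rectangle_translate\<close>)
      qed
      then have "eventually (\<lambda>i. indicator (rectangle (c + a (s i)) e p q) x * f x = indicator (rectangle c e p q) x * f x) sequentially"
        by eventually_elim (simp add: indicator_def)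
      then show ?case by (rule tendsto_eventually)
    qed
  qed (use meas in auto)
  then show "((\<lambda>s. LINT x|lebesgue_on D. indicator (rectangle (c + a s) e p q) x * f x) \<circ> s) \<longlonglongrightarrow>
      (LINT x|lebesgue_on D. indicator (rectangle c e p q) x * f x)"
    by (simp add: comp_def)
qed

section \<open>Power balance for the moving rectangle\<close>

text \<open>The derivative is taken at one time \<open>t\<close> at which the representative
  \<open>en t\<close> has contour values. Densities at neighbouring times enter the quotient only
  through their integrals.\<close>

theorem proposition6:
  fixes a b d \<eta> \<epsilon> \<rho> T MJ rc rp Cp \<delta> t1 t2 p q :: real
    and J g h ell V :: "real \<Rightarrow> real"
    and gp gm :: "real \<times> real \<Rightarrow> real"
    and u v w bf :: "real \<Rightarrow> real^2 \<Rightarrow> real^2"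
    and u0 v0 :: "real^2 \<Rightarrow> real^2"
    and e k :: "real^2"
    and D :: "(real^2) set"
    and P :: "real \<Rightarrow> (real^2) set"
    and sides :: "real \<Rightarrow> ((real^2) \<times> (real^2) \<times> real) list"
    and en :: "real \<Rightarrow> real^2 \<Rightarrow> real"
  assumes geometry: "0 < a" "0 < b" "0 < d" "d < b/2" "d \<le> ell 0" "ell 0 < a"
    and D_def: "D = notched_plate a b (ell 0) d"
    and pos: "0 < \<epsilon>" "0 < \<rho>" "0 < T" "0 < \<eta>"
    and J: "influence_function J MJ"
    and g: "cohesive_potential g h rc rp Cp"
    and load_smooth: "smooth_fun_on ({0<..<a} \<times> {0..T}) gp" "smooth_fun_on ({0<..<a} \<times> {0..T}) gm"
    and load_sign: "\<And>z. z \<in> {0<..<a} \<times> {0..T} \<Longrightarrow> 0 < gp z"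
      "\<And>z. z \<in> {0<..<a} \<times> {0..T} \<Longrightarrow> gm z = - gp z"
    and bf_def: "bf = body_force a b \<eta> gp gm"
    and bf_L2: "\<And>t. t \<in> {0..T} \<Longrightarrow> bf t \<in> L2_fields D"
    and bf_bdd: "bdd_above ((\<lambda>t. (L2_norm D (bf t))^2) ` {0..T})"
    and initial: "u0 \<in> L2_dot D" "v0 \<in> L2_dot D"
    and evolution: "nonlocal_evolution D T \<rho> \<epsilon> J g bf u0 v0 u v w"
    and crack: "\<And>t. t \<in> {0..T} \<Longrightarrow> AE x in lebesgue_on D. AE y in lebesgue_on D.
        closed_segment x y \<inter> crack_line (ell 0) (ell t) \<noteq> {} \<longrightarrow>
        (2 * bond_force \<epsilon> J g y x (strain D y x (u t))) *\<^sub>R bond_dir y x = 0"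
    and times: "0 \<le> t1" "t1 < t2" "t2 \<le> T"
    and tip_velocity: "\<And>t. t \<in> {t1<..<t2} \<Longrightarrow> (ell has_real_derivative V t) (at t)"
    and rect: "norm e = 1" "0 < p" "0 < q"
    and P_def: "\<And>t. P t = rectangle (crack_tip (ell t) + k) e p q"
    and sides_def: "\<And>t. sides t = rectangle_sides (crack_tip (ell t) + k) e p q"
    and contour: "\<And>t. t \<in> {t1<..<t2} \<Longrightarrow> diameter (P t) = \<delta>"
      "\<And>t. t \<in> {t1<..<t2} \<Longrightarrow> closure (P t) \<subseteq> D"
      "\<And>t. t \<in> {t1<..<t2} \<Longrightarrow> crack_tip (ell t) \<in> P t"
      "\<And>t. t \<in> {t1<..<t2} \<Longrightarrow> closure (P t) \<inter> closure {x. bf t x \<noteq> 0} = {}"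
    and en_def: "\<And>t x. en t x = kinetic_density \<rho> (v t) x + stored_density D \<epsilon> J g (u t) x"
    and t: "t \<in> {t1<..<t2}"
    and regular: "has_contour_values (en t) (frontier (P t)) (sides t)"
  shows "((\<lambda>s. LINT x:P s|lebesgue. en s x) has_real_derivative
           (boundary_integral (sides t) (\<lambda>x n. en t x * ((V t *\<^sub>R axis 1 1) \<bullet> n))
             - nonlocal_flux D \<epsilon> J g (P t) (u t) (v t))) (at t)"
proof -
  let ?M = "lebesgue_on D" and ?e1 = "axis 1 1 :: real^2"
  obtain g1 K1 K2 Kg where g1: "\<And>r. (g has_real_derivative g1 r) (at r)" "\<And>r. \<bar>g1 r\<bar> \<le> K1"
    "\<And>r s. \<bar>g1 r - g1 s\<bar> \<le> K2 * \<bar>r - s\<bar>" "g1 0 = 0" "\<And>r. \<bar>g r\<bar> \<le> Kg"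
    using cohesive_potential_derivative_bounds[OF g] by metis
  have D_lm: "D \<in> lmeasurable" unfolding D_def by (rule notched_plate_lmeasurable)
  then have D_leb: "D \<in> sets lebesgue" by auto
  interpret bond_model D \<epsilon> MJ K1 K2 Kg J g g1
    by unfold_locales (use D_lm pos J g1 in auto)
  have tT: "t \<in> {0..T}" "\<And>s. s \<in> {t1<..<t2} \<Longrightarrow> s \<in> {0..T}" using t times by auto
  have C2: "C2_L2_dot D T u v w"
    and motion: "\<And>s. s \<in> {0..T} \<Longrightarrow> AE x in ?M. \<rho> *\<^sub>R w s x = internal_force D \<epsilon> J g (u s) x + bf s x"
    using evolution by (auto simp: nonlocal_evolution_def)
  have L2: "u s \<in> L2_fields D" "v s \<in> L2_fields D" "w s \<in> L2_fields D" if "s \<in> {0..T}" for s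
    using C2 that by (auto simp: C2_L2_dot_def L2_dot_def)
  have at: "at t within {0..T} = at t"
    using t times by (intro at_within_interior) auto
  have du: "((\<lambda>s. L2_norm D (\<lambda>x. (u s x - u t x) /\<^sub>R (s - t) - v t x)) \<longlongrightarrow> 0) (at t)"
    and dv: "((\<lambda>s. L2_norm D (\<lambda>x. (v s x - v t x) /\<^sub>R (s - t) - w t x)) \<longlongrightarrow> 0) (at t)"
    using C2 tT(1) unfolding C2_L2_dot_def has_L2_derivative_on_def by (auto simp flip: at)
  have near: "\<forall>\<^sub>F s in at t. s \<in> {t1<..<t2}"
    by (rule eventually_at_in_open'[OF _ t]) simp
  \<comment> \<open>The product rule for the kinetic part and the first variation of the stored part
    in the direction of the velocity.\<close>
  define de where "de x = \<rho> * (v t x \<bullet> w t x) + energy_variation (u t) (v t) x" for x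
  have L1: "((\<lambda>s. (LINT x|?M. \<bar>en s x - en t x - (s - t) * de x\<bar>) / \<bar>s - t\<bar>) \<longlongrightarrow> 0) (at t)"
    unfolding en_def de_def
  proof (rule energy_L1_derivative)
    show "\<forall>\<^sub>F s in at t. u s \<in> L2_fields D \<and> v s \<in> L2_fields D"
      using near by eventually_elim (use L2 tT in auto)
  qed (use pos L2 tT du dv in auto)
  have en_int: "integrable ?M (en s)" if "s \<in> {0..T}" for s
  proof -
    have "en s = (\<lambda>x. kinetic_density \<rho> (v s) x + stored_density D \<epsilon> J g (u s) x)" by (simp add: fun_eq_iff en_def)
    then show ?thesis
      using kinetic_density_integrable[OF L2(2)[OF that]] stored_density_integrable[OF L2_fieldsD(1)[OF L2(1)[OF that]]]
      by simp
  qed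
  have de_int: "integrable ?M de"
    unfolding de_def[abs_def]
    by (intro Bochner_Integration.integrable_add integrable_mult_right integral_inner_le_L2_norm(1)
        energy_variation_integrable L2_fieldsD(1)[OF L2(1)] L2 tT)
  define c where "c = crack_tip (ell t) + k"
  have Pc: "P s = rectangle (c + (ell s - ell t) *\<^sub>R ?e1) e p q" for s
  proof -
    have "crack_tip (ell s) + k = c + (ell s - ell t) *\<^sub>R ?e1"
      by (simp add: c_def crack_tip_def vec_eq_iff forall_2 axis_def)
    then show ?thesis by (simp add: P_def)
  qed
  have Pt: "P t = rectangle c e p q" by (simp add: Pc)
  have P_leb: "P s \<in> sets lebesgue" for s
    unfolding P_def by (simp add: sets_completionI_sets open_rectangle)
  have P_sub: "P s \<subseteq> D" if "s \<in> {t1<..<t2}" for s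
    using contour(2)[OF that] closure_subset by blast

  have G: "((\<lambda>\<tau>. LINT x:rectangle (c + \<tau> *\<^sub>R ?e1) e p q|lebesgue. en t x) has_real_derivative
           boundary_integral (sides t) (\<lambda>x n. en t x * (?e1 \<bullet> n))) (at 0)"
    unfolding sides_def c_def[symmetric]
  proof (rule moving_rectangle_flux[OF rect D_leb en_int[OF tT(1)]])
    \<comment> \<open>The flat notch edges belong to \<open>D\<close>, so containment of the closure
      in \<open>D\<close> alone would allow contact with them. The crack tip lies on the centre
      line, and convexity then excludes contact.\<close>
    show "closure (rectangle c e p q) \<subseteq> interior D"
      unfolding D_def
    proof (rule convex_subset_interior_notched_plate)
      show "convex (closure (rectangle c e p q))" by (intro convex_closure convex_rectangle)
      show "closure (rectangle c e p q) \<subseteq> notched_plate a b (ell 0) d"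
        using contour(2)[OF t] by (simp add: Pt D_def)
      show "crack_tip (ell t) \<in> closure (rectangle c e p q)"
        using contour(3)[OF t] closure_subset by (auto simp: Pt)
    qed (use geometry in \<open>auto simp: crack_tip_def\<close>)
    show "has_contour_values (en t) (frontier (rectangle c e p q)) (rectangle_sides c e p q)"
      using regular by (simp add: Pt sides_def c_def)
  qed
  \<comment> \<open>Differentiating in the displacement and then applying the chain rule through
    \<open>ell\<close> also covers times at which the tip is at rest.\<close>
  have transport: "((\<lambda>s. LINT x:P s|lebesgue. en t x) has_real_derivative
           boundary_integral (sides t) (\<lambda>x n. en t x * (?e1 \<bullet> n)) * V t) (at t)"
  proof -
    have "((\<lambda>s. ell s - ell t) has_real_derivative V t) (at t)"
      by (auto intro!: derivative_eq_intros tip_velocity[OF t])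
    moreover have "((\<lambda>\<tau>. LINT x:rectangle (c + \<tau> *\<^sub>R ?e1) e p q|lebesgue. en t x) has_real_derivative
           boundary_integral (sides t) (\<lambda>x n. en t x * (?e1 \<bullet> n))) (at (ell t - ell t))"
      using G by simp
    ultimately show ?thesis unfolding Pc by (rule DERIV_chain2[rotated])
  qed
  \<comment> \<open>On \<open>P t\<close> the body force vanishes, so the inertial term in
    \<open>de\<close> can be exchanged for the internal force before the pair cancellation is
    used.\<close>
  have power: "(LINT x|?M. indicator (P t) x * de x) = - nonlocal_flux D \<epsilon> J g (P t) (u t) (v t)"
  proof -
    have "(LINT x|?M. indicator (P t) x * de x) =
       (LINT x|?M. indicator (P t) x * (v t x \<bullet> internal_force D \<epsilon> J g (u t) x + energy_variation (u t) (v t) x))"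
    proof (rule integral_cong_AE)
      show "(\<lambda>x. indicator (P t) x * de x) \<in> borel_measurable ?M"
        using P_leb D_leb P_sub[OF t]
        by (intro borel_measurable_times borel_measurable_indicator borel_measurable_integrable[OF de_int])
           (auto simp: sets_restrict_space_iff)
      show "AE x in ?M. indicator (P t) x * de x =
          indicator (P t) x * (v t x \<bullet> internal_force D \<epsilon> J g (u t) x + energy_variation (u t) (v t) x)"
        using motion[OF tT(1)]
      proof eventually_elim
        case (elim x)
        show ?case
        proof (cases "x \<in> P t")
          case True
          then have "x \<notin> closure {x. bf t x \<noteq> 0}"
            using contour(4)[OF t] closure_subset by blast
          then have "bf t x = 0" using closure_subset[of "{x. bf t x \<noteq> 0}"] by auto
          then have "internal_force D \<epsilon> J g (u t) x = \<rho> *\<^sub>R w t x" using elim by simp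
          then show ?thesis by (simp add: de_def)
        qed simp
      qed
      have "(\<lambda>x. LINT y|?M. pair_force (u t) x y) \<in> borel_measurable ?M"
        using pair_force_measurable[OF L2_fieldsD(1)[OF L2(1)[OF tT(1)]]]
        by (intro M.borel_measurable_lebesgue_integral) (simp add: case_prod_beta)
      then show "(\<lambda>x. indicator (P t) x * (v t x \<bullet> internal_force D \<epsilon> J g (u t) x + energy_variation (u t) (v t) x)) \<in> borel_measurable ?M"
        unfolding internal_force_eq
        using P_leb D_leb P_sub[OF t]
        by (intro borel_measurable_times borel_measurable_add borel_measurable_inner borel_measurable_scaleR
            borel_measurable_const borel_measurable_indicator L2_fieldsD(1)[OF L2(2)[OF tT(1)]]
            borel_measurable_integrable[OF energy_variation_integrable[OF L2_fieldsD(1)[OF L2(1)[OF tT(1)]] L2(2)[OF tT(1)]]])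
           (auto simp: sets_restrict_space_iff)
    qed
    also have "\<dots> = - nonlocal_flux D \<epsilon> J g (P t) (u t) (v t)"
    proof (rule power_balance[OF L2_fieldsD(1)[OF L2(1)[OF tT(1)]] L2(2)[OF tT(1)] P_leb P_sub[OF t]])
      show "negligible (closure (P t) - P t)"
        using negligible_convex_frontier[OF convex_rectangle[of c e p q]]
        by (simp add: Pt frontier_def interior_open[OF open_rectangle])
    qed
    finally show ?thesis .
  qed
  let ?F = "\<lambda>s. LINT x:P s|lebesgue. en s x" and ?B = "boundary_integral (sides t) (\<lambda>x n. en t x * (?e1 \<bullet> n)) * V t"
  define X where "X s = (LINT x|?M. indicator (P s) x * (en s x - en t x - (s - t) * de x)) / (s - t)" for s
  have X_lim: "(X \<longlongrightarrow> 0) (at t)"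
  proof (rule Lim_null_comparison[OF _ L1])
    \<comment> \<open>Dropping the indicator of \<open>P s\<close> after taking absolute values
      makes the bound independent of where the rectangle is.\<close>
    show "\<forall>\<^sub>F s in at t. norm (X s) \<le> (LINT x|?M. \<bar>en s x - en t x - (s - t) * de x\<bar>) / \<bar>s - t\<bar>"
      using near
    proof eventually_elim
      case (elim s)
      have i: "integrable ?M (\<lambda>x. en s x - en t x - (s - t) * de x)"
        by (intro Bochner_Integration.integrable_diff integrable_mult_right en_int de_int tT elim)
      have "\<bar>LINT x|?M. indicator (P s) x * (en s x - en t x - (s - t) * de x)\<bar> \<le>
         (LINT x|?M. \<bar>indicator (P s) x * (en s x - en t x - (s - t) * de x)\<bar>)"
        by (rule integral_abs_bound)
      also have "\<dots> \<le> (LINT x|?M. \<bar>en s x - en t x - (s - t) * de x\<bar>)"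
      proof (rule integral_mono')
        show "integrable ?M (\<lambda>x. \<bar>en s x - en t x - (s - t) * de x\<bar>)" using i by (rule integrable_abs)
      qed (simp_all add: indicator_def)
      finally show ?case unfolding X_def real_norm_def abs_divide by (rule divide_right_mono) simp
    qed
  qed
  have restrict: "(LINT x:P s|lebesgue. f x) = (LINT x|?M. indicator (P s) x * f x)" if "s \<in> {t1<..<t2}" for s and f :: "real^2 \<Rightarrow> real"
    by (rule set_lebesgue_integral_subset[OF D_leb P_sub[OF that]])
  have P_int: "integrable ?M (\<lambda>x. indicator (P s) x * f x)" if "integrable ?M f" "s \<in> {t1<..<t2}" for s and f :: "real^2 \<Rightarrow> real"
    using integrable_mult_indicator[of "P s" ?M f] that P_leb D_leb P_sub[OF that(2)]
    by (simp add: sets_restrict_space_iff)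
  have "((\<lambda>s. (?F s - ?F t) / (s - t)) \<longlongrightarrow> 0 + ?B + - nonlocal_flux D \<epsilon> J g (P t) (u t) (v t)) (at t)"
  proof (rule Lim_transform_eventually)
    have "isCont ell t" using tip_velocity[OF t] by (rule DERIV_isCont)
    then have "((\<lambda>s. (ell s - ell t) *\<^sub>R ?e1) \<longlongrightarrow> (ell t - ell t) *\<^sub>R ?e1) (at t)"
      unfolding isCont_def by (intro tendsto_intros)
    then have "((\<lambda>s. LINT x|?M. indicator (P s) x * de x) \<longlongrightarrow> (LINT x|?M. indicator (P t) x * de x)) (at t)"
      unfolding Pt unfolding Pc by (intro moving_rectangle_integral_tendsto D_leb de_int) simp
    then show "((\<lambda>s. X s + ((LINT x:P s|lebesgue. en t x) - (LINT x:P t|lebesgue. en t x)) / (s - t)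
         + (LINT x|?M. indicator (P s) x * de x)) \<longlongrightarrow> 0 + ?B + - nonlocal_flux D \<epsilon> J g (P t) (u t) (v t)) (at t)"
      unfolding power using transport[unfolded has_field_derivative_iff] by (intro tendsto_add X_lim)
    show "\<forall>\<^sub>F s in at t. X s + ((LINT x:P s|lebesgue. en t x) - (LINT x:P t|lebesgue. en t x)) / (s - t)
         + (LINT x|?M. indicator (P s) x * de x) = (?F s - ?F t) / (s - t)"
      using near eventually_neq_at_within[of t t UNIV]
    proof eventually_elim
      case (elim s)
      note i = P_int[OF en_int[OF tT(2)[OF elim(1)]] elim(1)] P_int[OF en_int[OF tT(1)] elim(1)] P_int[OF de_int elim(1)]
      have "(LINT x|?M. indicator (P s) x * (en s x - en t x - (s - t) * de x)) =
        (LINT x|?M. indicator (P s) x * en s x - indicator (P s) x * en t x - (s - t) * (indicator (P s) x * de x))"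
        by (rule Bochner_Integration.integral_cong[OF refl]) (simp add: algebra_simps)
      also have "\<dots> = (LINT x|?M. indicator (P s) x * en s x) - (LINT x|?M. indicator (P s) x * en t x)
         - (s - t) * (LINT x|?M. indicator (P s) x * de x)"
        using i by simp
      finally have "X s = ((LINT x|?M. indicator (P s) x * en s x) - (LINT x|?M. indicator (P s) x * en t x)) / (s - t)
         - (LINT x|?M. indicator (P s) x * de x)"
        using elim(2) by (simp add: X_def diff_divide_distrib)
      then show ?case
        unfolding restrict[OF elim(1)] restrict[OF t] by (simp add: diff_divide_distrib)
    qed
  qed
  moreover have "boundary_integral (sides t) (\<lambda>x n. en t x * ((V t *\<^sub>R ?e1) \<bullet> n)) = ?B"
    using boundary_integral_cmult[of "sides t" "V t" "\<lambda>x n. en t x * (?e1 \<bullet> n)"]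
    by (simp add: mult.left_commute mult.commute[of _ "V t"])
  ultimately show ?thesis
    unfolding has_field_derivative_iff by simp
qed

end
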